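(* Let $d\ge 2$, $n\in\mathbb N_0$, $\kappa\in\mathbb R^{d+1}$ with all $\kappa_i>-1$, and let $\nu,\mu\in\mathbb N_0^d$ with $|\nu|=|\mu|=n$. Let $(12\dots d)\in S_{d+1}$ be the cyclic permutation $1\mapsto 2\mapsto\cdots\mapsto d\mapsto 1$ (fixing $d+1$). Then $$\widehat c_{\nu,\mu}^{\,(12\dots d)}(\kappa)=(-1)^{n+\nu_d}\sqrt{w_{\mathsf R}(\hat\nu;\beta,n)}\;\widehat{\mathsf R}_{\hat\mu}(\hat\nu;\beta,n),$$ where $\widehat{\mathsf R}_{\hat\mu}(\hat\nu;\beta,n)$ is the orthonormal Racah polynomial of $d-1$ variables with indices $\hat\mu=(\mu_d,\mu_{d-1},\dots,\mu_2)$, variables $\hat\nu=(|\boldsymbol\nu^d|,|\boldsymbol\nu^{d-1}|,\dots,|\boldsymbol\nu^2|)$ and parameters $\beta_j=\kappa_1+|\boldsymbol\kappa^{d+2-j}|+j$ for $j=0,1,\dots,d$. One also has $$\widehat c_{\nu,\mu}^{\,(12\dots d)}(\kappa)=(-1)^{n+\nu_d}\sqrt{w_{\mathsf R}(\tilde\mu;\tilde\beta,n)}\;\widehat{\mathsf R}_{\tilde\nu}(\tilde\mu;\tilde\beta,n),$$ where $\widehat{\mathsf R}_{\tilde\nu}(\tilde\mu;\tilde\beta,n)$ is the orthonormal Racah polynomial of $d-1$ variables with indices $\tilde\nu=(\nu_1,\dots,\nu_{d-1})$, variables $\tilde\mu=(|\boldsymbol\mu_1|,|\boldsymbol\mu_2|,\dots,|\boldsymbol\mu_{d-1}|)$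 and parameters $\tilde\beta_0=\kappa_1$, $\tilde\beta_j=-|\boldsymbol\kappa^{j+1}|-2n-d+j$ for $j=1,\dots,d$.
   Context: **Vectors.** $|y|$ is the sum of the entries of a vector $y$; $\mathbf y_j=(y_1,\dots,y_j)$ is its initial part and $\mathbf y^j$ its tail from the $j$-th to the last entry (so $\boldsymbol\kappa^j=(\kappa_j,\dots,\kappa_{d+1})$ and $\boldsymbol\nu^j=(\nu_j,\dots,\nu_d)$); empty parts have sum $0$. $(a)_k=a(a+1)\cdots(a+k-1)$. **Jacobi polynomials on the simplex.** $T^d=\{x\in\mathbb R^d:x_i\ge0,|x|\le1\}$, $W_\kappa(x)=x_1^{\kappa_1}\cdots x_d^{\kappa_d}(1-|x|)^{\kappa_{d+1}}$, $\langle f,g\rangle_{W_\kappa}=\frac{\Gamma(|\kappa|+d+1)}{\prod_{i=1}^{d+1}\Gamma(\kappa_i+1)}\int_{T^d}fgW_\kappa\,dx$. For $\nu\in\mathbb N_0^d$ put $a_j=a_j(\kappa,\nu)=|\boldsymbol\kappa^{j+1}|+2|\boldsymbol\nu^{j+1}|+d-j$ and $$P_\nu^\kappa(x)=\prod_{j=1}^d(1-|\mathbf x_{j-1}|)^{\nu_j}P_{\nu_j}^{(a_j,\kappa_j)}\Big(\frac{2x_j}{1-|\mathbf x_{j-1}|}-1\Big),$$ with $P_n^{(\alpha,\beta)}$ the classical Jacobi polynomials ($P_n^{(\alpha,\beta)}(1)=(\alpha+1)_n/n!$). For each $n$, $\{P_\nu^\kappa:|\nu|=n\}$ is an orthogonal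 basis of the space $\mathcal V_n^d(W_\kappa)$ of polynomials of degree $n$ orthogonal to all polynomials of lower degree. Let $A_\nu(\kappa)=\langle P_\nu^\kappa,P_\nu^\kappa\rangle_{W_\kappa}$. **Permutations and connection coefficients.** For $\tau\in S_{d+1}$, $\tau y=(y_{\tau(1)},\dots,y_{\tau(d+1)})$ for $y\in\mathbb R^{d+1}$, and for $x\in T^d$, $\tau x=(x_{\tau(1)},\dots,x_{\tau(d)})$ with $x_{d+1}:=1-|x|$. The coefficients $c^\tau_{\nu,\mu}(\kappa)$ are defined by $P_\nu^{\tau\kappa}(\tau x)=\sum_{|\mu|=n}c^\tau_{\nu,\mu}(\kappa)P_\mu^\kappa(x)$, $|\nu|=n$, and the normalized ones by $\widehat c^{\,\tau}_{\nu,\mu}(\kappa)=\sqrt{A_\mu(\kappa)/A_\nu(\tau\kappa)}\;c^\tau_{\nu,\mu}(\kappa)$. **Racah polynomials of $p$ variables** (here $p=d-1$). Let $N\in\mathbb N_0$, $\beta=(\beta_0,\dots,\beta_{p+1})$, $V_N=\{x\in\mathbb N_0^p:0\le x_1\le\cdots\le x_p\le N\}$, $x_0=0$, $x_{p+1}=N$, $$w_{\mathsf R}(x;\beta,N)=\prod_{j=0}^p\frac{(\beta_{j+1}-\beta_j)_{x_{j+1}-x_j}(\beta_{j+1})_{x_{j+1}+x_j}}{(x_{j+1}-x_j)!\,(\beta_j+1)_{x_{j+1}+x_j}}\prod_{j=1}^p\frac{((\beta_j+2)/2)_{x_j}}{(\beta_j/2)_{x_j}}.$$ For $\nu\in\mathbb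 N_0^p$, $|\nu|\le N$, $$\mathsf R_\nu(x;\beta,N)=\prod_{j=1}^p(u_j)_{\nu_j}(v_j)_{\nu_j}(t_j)_{\nu_j}\;{}_4F_3\!\left(\begin{matrix}-\nu_j,\ \nu_j+2|\boldsymbol\nu_{j-1}|+\beta_{j+1}-\beta_0-1,\ |\boldsymbol\nu_{j-1}|-x_j,\ |\boldsymbol\nu_{j-1}|+\beta_j+x_j\\ u_j,\ v_j,\ t_j\end{matrix};1\right),$$ $u_j=2|\boldsymbol\nu_{j-1}|+\beta_j-\beta_0$, $v_j=|\boldsymbol\nu_{j-1}|+\beta_{j+1}+x_{j+1}$, $t_j=|\boldsymbol\nu_{j-1}|-x_{j+1}$, where $(u)_m(v)_m(t)_m\,{}_4F_3(-m,a,b,c;u,v,t;1)$ means $\sum_{k=0}^m\frac{(-m)_k(a)_k(b)_k(c)_k}{k!}(u+k)_{m-k}(v+k)_{m-k}(t+k)_{m-k}$. These are mutually orthogonal on $V_N$ with weight $w_{\mathsf R}$; $\widehat{\mathsf R}_\nu=\mathsf R_\nu/r_\nu$ with $r_\nu^2=\sum_{y\in V_N}w_{\mathsf R}(y;\beta,N)\mathsf R_\nu(y;\beta,N)^2$. The product $\sqrt{w_{\mathsf R}}\,\widehat{\mathsf R}_\nu$ is read as $\mathsf R_\nu\cdot\sqrt{w_{\mathsf R}/r_\nu^2}$ (positive root), extended by continuity in the parameters at removable singularities. *)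

theory Defs
  imports "HOL-Analysis.Analysis" "HOL-Combinatorics.Cycles"
begin

text \<open>
  The dimension is a number, so vectors are functions on \<open>nat\<close> whose entries are indexed
  from 1 (Racah parameters from 0). Real vectors are only inspected on their index range;
  sets of vectors that are summed or integrated over have a fixed value off that range.
\<close>

definition multi_idx :: "nat \<Rightarrow> nat \<Rightarrow> (nat \<Rightarrow> nat) set" where
  "multi_idx d n = {\<nu>. (\<forall>i. i \<notin> {1..d} \<longrightarrow> \<nu> i = 0) \<and> (\<Sum>i=1..d. \<nu> i) = n}"

section \<open>Jacobi polynomials on the simplex\<close>

definition unit_simplex :: "nat \<Rightarrow> (nat \<Rightarrow> real) set" where
  "unit_simplex d = {x \<in> {1..d} \<rightarrow>\<^sub>E UNIV. (\<forall>i\<in>{1..d}. 0 \<le> x i) \<and> (\<Sum>i=1..d. x i) \<le> 1}"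

definition simplex_weight :: "nat \<Rightarrow> (nat \<Rightarrow> real) \<Rightarrow> (nat \<Rightarrow> real) \<Rightarrow> real" where
  "simplex_weight d \<kappa> x =
     (\<Prod>i=1..d. x i powr \<kappa> i) * (1 - (\<Sum>i=1..d. x i)) powr \<kappa> (d + 1)"

definition simplex_inner ::
    "nat \<Rightarrow> (nat \<Rightarrow> real) \<Rightarrow> ((nat \<Rightarrow> real) \<Rightarrow> real) \<Rightarrow> ((nat \<Rightarrow> real) \<Rightarrow> real) \<Rightarrow> real" where
  "simplex_inner d \<kappa> f g =
     Gamma ((\<Sum>i=1..d+1. \<kappa> i) + real d + 1) / (\<Prod>i=1..d+1. Gamma (\<kappa> i + 1)) *
     (LINT x:unit_simplex d|(Pi\<^sub>M {1..d} (\<lambda>_. lborel)). f x * g x * simplex_weight d \<kappa> x)"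

text \<open>
  The classical Jacobi polynomial
  \<open>(\<alpha>+1)\<^sub>n / n! * \<^sub>2F\<^sub>1(-n, n+\<alpha>+\<beta>+1; \<alpha>+1; (1-x)/2)\<close>, with the factor \<open>(\<alpha>+1)\<^sub>n\<close> moved into the sum.
\<close>

definition jacobi :: "nat \<Rightarrow> real \<Rightarrow> real \<Rightarrow> real \<Rightarrow> real" where
  "jacobi n \<alpha> \<beta> x =
     (\<Sum>k\<le>n. pochhammer (real n + \<alpha> + \<beta> + 1) k * pochhammer (\<alpha> + real k + 1) (n - k)
        / (fact k * fact (n - k)) * ((x - 1) / 2) ^ k)"

definition simplex_jacobi_param :: "nat \<Rightarrow> (nat \<Rightarrow> real) \<Rightarrow> (nat \<Rightarrow> nat) \<Rightarrow> nat \<Rightarrow> real" where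
  "simplex_jacobi_param d \<kappa> \<nu> j =
     (\<Sum>i=j+1..d+1. \<kappa> i) + 2 * real (\<Sum>i=j+1..d. \<nu> i) + real (d - j)"

text \<open>
  On the simplex the convention \<open>a / 0 = 0\<close> does no harm here: if the partial sum
  \<open>x\<^sub>1 + \<dots> + x\<^bsub>j-1\<^esub>\<close> is 1, then \<open>x\<^sub>j = 0\<close> and the \<open>j\<close>-th factor, a homogeneous polynomial of
  degree \<open>\<nu>\<^sub>j\<close> in \<open>x\<^sub>j\<close> and \<open>1 - x\<^sub>1 - \<dots> - x\<^bsub>j-1\<^esub>\<close>, has the value \<open>0 ^ \<nu>\<^sub>j\<close>, as below.
  Off the simplex this may fail.
\<close>

definition simplex_jacobi ::
    "nat \<Rightarrow> (nat \<Rightarrow> real) \<Rightarrow> (nat \<Rightarrow> nat) \<Rightarrow> (nat \<Rightarrow> real) \<Rightarrow> real" where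
  "simplex_jacobi d \<kappa> \<nu> x =
     (\<Prod>j=1..d. (1 - (\<Sum>i=1..<j. x i)) ^ \<nu> j *
        jacobi (\<nu> j) (simplex_jacobi_param d \<kappa> \<nu> j) (\<kappa> j)
          (2 * x j / (1 - (\<Sum>i=1..<j. x i)) - 1))"

definition jacobi_norm_sq :: "nat \<Rightarrow> (nat \<Rightarrow> real) \<Rightarrow> (nat \<Rightarrow> nat) \<Rightarrow> real" where
  "jacobi_norm_sq d \<kappa> \<nu> =
     simplex_inner d \<kappa> (simplex_jacobi d \<kappa> \<nu>) (simplex_jacobi d \<kappa> \<nu>)"

section \<open>Connection coefficients\<close>

text \<open>Permutations of \<open>{1..d+1}\<close> act on parameters by \<open>\<tau>\<kappa> = \<kappa> \<circ> \<tau>\<close>.\<close>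

definition perm_point :: "nat \<Rightarrow> (nat \<Rightarrow> nat) \<Rightarrow> (nat \<Rightarrow> real) \<Rightarrow> (nat \<Rightarrow> real)" where
  "perm_point d \<tau> x =
     (\<lambda>i\<in>{1..d}. (x(d + 1 := 1 - (\<Sum>k=1..d. x k))) (\<tau> i))"

definition conn_coeff ::
    "nat \<Rightarrow> (nat \<Rightarrow> nat) \<Rightarrow> (nat \<Rightarrow> real) \<Rightarrow> (nat \<Rightarrow> nat) \<Rightarrow> (nat \<Rightarrow> nat) \<Rightarrow> real" where
  "conn_coeff d \<tau> \<kappa> \<nu> =
     (THE c. (\<forall>\<mu>. \<mu> \<notin> multi_idx d (\<Sum>i=1..d. \<nu> i) \<longrightarrow> c \<mu> = 0) \<and>
        (\<forall>x\<in>unit_simplex d. simplex_jacobi d (\<kappa> \<circ> \<tau>) \<nu> (perm_point d \<tau> x) =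
           (\<Sum>\<mu>\<in>multi_idx d (\<Sum>i=1..d. \<nu> i). c \<mu> * simplex_jacobi d \<kappa> \<mu> x)))"

definition conn_coeff_normalized ::
    "nat \<Rightarrow> (nat \<Rightarrow> nat) \<Rightarrow> (nat \<Rightarrow> real) \<Rightarrow> (nat \<Rightarrow> nat) \<Rightarrow> (nat \<Rightarrow> nat) \<Rightarrow> real" where
  "conn_coeff_normalized d \<tau> \<kappa> \<nu> \<mu> =
     sqrt (jacobi_norm_sq d \<kappa> \<mu> / jacobi_norm_sq d (\<kappa> \<circ> \<tau>) \<nu>) * conn_coeff d \<tau> \<kappa> \<nu> \<mu>"

section \<open>Racah polynomials of \<open>p\<close> variables\<close>

definition racah_lattice :: "nat \<Rightarrow> nat \<Rightarrow> (nat \<Rightarrow> nat) set" where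
  "racah_lattice p N =
     {x. (\<forall>i. i \<notin> {1..p} \<longrightarrow> x i = 0) \<and> (\<forall>i\<in>{1..p}. x i \<le> N) \<and>
         (\<forall>i\<in>{1..p}. \<forall>j\<in>{1..p}. i \<le> j \<longrightarrow> x i \<le> x j)}"

text \<open>The conventions \<open>x\<^sub>0 = 0\<close> and \<open>x\<^bsub>p+1\<^esub> = N\<close>.\<close>

definition racah_ext :: "nat \<Rightarrow> nat \<Rightarrow> (nat \<Rightarrow> nat) \<Rightarrow> (nat \<Rightarrow> nat)" where
  "racah_ext p N x = x(0 := 0, p + 1 := N)"

definition racah_weight ::
    "nat \<Rightarrow> nat \<Rightarrow> (nat \<Rightarrow> nat) \<Rightarrow> (nat \<Rightarrow> real) \<Rightarrow> real" where
  "racah_weight p N x \<beta> =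
     (let X = racah_ext p N x in
      (\<Prod>j=0..p. pochhammer (\<beta> (j + 1) - \<beta> j) (X (j + 1) - X j)
            * pochhammer (\<beta> (j + 1)) (X (j + 1) + X j)
            / (fact (X (j + 1) - X j) * pochhammer (\<beta> j + 1) (X (j + 1) + X j))) *
      (\<Prod>j=1..p. pochhammer ((\<beta> j + 2) / 2) (X j) / pochhammer (\<beta> j / 2) (X j)))"

text \<open>\<open>(u)\<^sub>m (v)\<^sub>m (t)\<^sub>m \<^sub>4F\<^sub>3(-m, a, b, c; u, v, t; 1)\<close>, as a polynomial in all its parameters.\<close>

definition terminating_4F3 ::
    "nat \<Rightarrow> real \<Rightarrow> real \<Rightarrow> real \<Rightarrow> real \<Rightarrow> real \<Rightarrow> real \<Rightarrow> real" where
  "terminating_4F3 m a b c u v t =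
     (\<Sum>k\<le>m. pochhammer (- real m) k * pochhammer a k * pochhammer b k * pochhammer c k / fact k
        * pochhammer (u + real k) (m - k) * pochhammer (v + real k) (m - k)
        * pochhammer (t + real k) (m - k))"

definition racah_poly ::
    "nat \<Rightarrow> nat \<Rightarrow> (nat \<Rightarrow> nat) \<Rightarrow> (nat \<Rightarrow> nat) \<Rightarrow> (nat \<Rightarrow> real) \<Rightarrow> real" where
  "racah_poly p N \<nu> x \<beta> =
     (let X = racah_ext p N x in
      \<Prod>j=1..p. let s = real (\<Sum>i=1..<j. \<nu> i) in
        terminating_4F3 (\<nu> j)
          (real (\<nu> j) + 2 * s + \<beta> (j + 1) - \<beta> 0 - 1) (s - real (X j)) (s + \<beta> j + real (X j))
          (2 * s + \<beta> j - \<beta> 0) (s + \<beta> (j + 1) + real (X (j + 1))) (s - real (X (j + 1))))"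

definition racah_norm_sq ::
    "nat \<Rightarrow> nat \<Rightarrow> (nat \<Rightarrow> nat) \<Rightarrow> (nat \<Rightarrow> real) \<Rightarrow> real" where
  "racah_norm_sq p N \<nu> \<beta> =
     (\<Sum>y\<in>racah_lattice p N. racah_weight p N y \<beta> * (racah_poly p N \<nu> y \<beta>)\<^sup>2)"

text \<open>
  The parameters at which no denominator in \<open>w / r\<^sub>\<nu>\<^sup>2\<close> vanishes; only there do the formulas
  with total division have their literal meaning.
\<close>

definition racah_regular :: "nat \<Rightarrow> nat \<Rightarrow> (nat \<Rightarrow> nat) \<Rightarrow> (nat \<Rightarrow> real) set" where
  "racah_regular p N \<nu> =
     {\<beta>. (\<forall>y\<in>racah_lattice p N.
            (\<forall>j\<in>{0..p}. pochhammer (\<beta> j + 1)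
               (racah_ext p N y (j + 1) + racah_ext p N y j) \<noteq> 0) \<and>
            (\<forall>j\<in>{1..p}. pochhammer (\<beta> j / 2) (y j) \<noteq> 0)) \<and>
         racah_norm_sq p N \<nu> \<beta> \<noteq> 0}"

text \<open>
  \<open>sqrt w\<close> times the orthonormal Racah polynomial, read as \<open>R\<^sub>\<nu> * sqrt (w / r\<^sub>\<nu>\<^sup>2)\<close>, since \<open>w\<close>
  and \<open>r\<^sub>\<nu>\<^sup>2\<close> may both be negative. At a singular \<open>\<beta>\<close> the value is the limit along regular
  parameters; the topology is the product topology, of which only the entries
  \<open>0, \<dots>, p + 1\<close> matter.
\<close>

definition racah_weighted_orthonormal ::
    "nat \<Rightarrow> nat \<Rightarrow> (nat \<Rightarrow> nat) \<Rightarrow> (nat \<Rightarrow> nat) \<Rightarrow> (nat \<Rightarrow> real) \<Rightarrow> real" where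
  "racah_weighted_orthonormal p N \<nu> x \<beta> =
     (let F = (\<lambda>\<beta>. racah_poly p N \<nu> x \<beta> * sqrt (racah_weight p N x \<beta> / racah_norm_sq p N \<nu> \<beta>))
      in if \<beta> \<in> racah_regular p N \<nu> then F \<beta> else Lim (at \<beta> within racah_regular p N \<nu>) F)"

end

theory Submission
  imports Defs
begin

text \<open>
Write \<open>x\<^bsub>d+1\<^esub> = 1 - |x|\<close> and let \<open>hjac m \<alpha> \<beta> r t\<close> be the Jacobi polynomial made homogeneous, a
binary form of degree \<open>m\<close>. On the simplex, \<open>P\<^sub>\<nu>(x)\<close> is the product over \<open>j\<close> of the forms of
degree \<open>\<nu>\<^sub>j\<close> at \<open>(x\<^bsub>j+1\<^esub> + \<dots> + x\<^bsub>d+1\<^esub>, x\<^sub>j)\<close>. Each factor sees the later variables only through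
their sum, so exchanging two neighbouring variables changes just two factors. The cycle is a
composition of \<open>d - 1\<close> such exchanges, which carry \<open>x\<^sub>1\<close> from the last place to the first. An
exchange preserves the total degree of the tail behind it, hence the intermediate indices are
determined by \<open>\<nu>\<close> and \<open>\<mu>\<close>, and the connection coefficient is a product of \<open>d - 1\<close> two-variable
coefficients, without any summation (\<open>cyc_expansion_step\<close>, \<open>conn_coeff_cyc\<close>). This product is the
multivariate Racah polynomial.

The two-variable exchange is an identity between ternary forms in \<open>u, v, w\<close>. Both sides are
annihilated by \<open>u\<partial>\<^sub>u\<^sup>2 + (b+1)\<partial>\<^sub>u + v\<partial>\<^sub>v\<^sup>2 + (c+1)\<partial>\<^sub>v + w\<partial>\<^sub>w\<^sup>2 + (a+1)\<partial>\<^sub>w\<close>, and a form annihilated by this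
operator vanishes as soon as it vanishes on one face of the triangle
(\<open>harmonic_form_zero_on_face\<close>). On a face the identity has one variable and follows by expanding
powers in Jacobi polynomials. The faces \<open>v = 0\<close> and \<open>u = 0\<close> give two different \<open>\<^sub>4F\<^sub>3\<close> for the
same coefficient, and these become the two Racah representations. Both expansions rest on one
telescoping sum (\<open>telescoping_binomial_sum\<close>).

The norm of a Racah polynomial is never evaluated. The two Jacobi families are orthogonal for the
same inner product, so the normalized coefficients form an orthogonal matrix. If its entries are a
sign times \<open>R * sqrt (k * w)\<close>, where \<open>k\<close> is constant along a row or a column, then unit length of
that row or column says exactly that \<open>k = 1 / r\<^sup>2\<close> (\<open>unit_vector_racah\<close>). What has to be computed is
the norm of \<open>P\<^sub>\<nu>\<close>, by splitting the integral over the simplex into Beta integrals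
(\<open>jacobi_norm_sq_eq\<close>), and the proportionality of \<open>w\<close> to the squares of the prefactors
(\<open>reduced_weight_tail_point\<close>, \<open>reduced_weight_head_point\<close>).

At singular parameters, \<open>w / r\<^sup>2\<close> is unchanged if the factor \<open>(\<beta>\<^bsub>p+1\<^esub>)\<^bsub>2N\<^esub>\<close>, which does not depend on
the lattice point, is removed from \<open>w\<close>. What remains of \<open>w\<close> after cancellation is continuous at
all parameters that occur, so the limit is the value of the reduced quotient
(\<open>racah_weighted_orthonormal_eq\<close>).
\<close>

abbreviation poch :: "real \<Rightarrow> nat \<Rightarrow> real" where
  "poch \<equiv> pochhammer"

abbreviation jparam :: "nat \<Rightarrow> (nat \<Rightarrow> real) \<Rightarrow> (nat \<Rightarrow> nat) \<Rightarrow> nat \<Rightarrow> real" where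
  "jparam \<equiv> simplex_jacobi_param"

abbreviation integrable_exponents :: "nat \<Rightarrow> (nat \<Rightarrow> real) \<Rightarrow> bool" where
  "integrable_exponents d \<kappa> \<equiv> \<forall>i\<in>{1..d+1}. \<kappa> i > -1"

lemma minus_one_power_cancel: "(-1 :: real) ^ k * ((-1) ^ k * x) = x"
  by (simp flip: power_mult_distrib mult.assoc)

section \<open>Alternating sums of Pochhammer symbols\<close>

lemma alternating_binomial_sum_Suc:
  fixes f :: "nat \<Rightarrow> real"
  shows "(\<Sum>i\<le>Suc n. (-1) ^ i * real (Suc n choose i) * f i)
       = (\<Sum>i\<le>n. (-1) ^ i * real (n choose i) * (f i - f (Suc i)))"
proof -
  have "(\<Sum>i\<le>Suc n. (-1) ^ i * real (Suc n choose i) * f i)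
      = f 0 + (\<Sum>i\<le>n. (-1) ^ Suc i * real (Suc n choose Suc i) * f (Suc i))"
    by (subst sum.atMost_Suc_shift) simp
  also have "(\<Sum>i\<le>n. (-1) ^ Suc i * real (Suc n choose Suc i) * f (Suc i))
      = (\<Sum>i\<le>n. - ((-1) ^ i * real (n choose i) * f (Suc i)))
        + (\<Sum>i\<le>n. (-1) ^ Suc i * real (n choose Suc i) * f (Suc i))"
    by (subst sum.distrib [symmetric], rule sum.cong) (auto simp: algebra_simps)
  also have "f 0 + \<dots> = (\<Sum>i\<le>n. - ((-1) ^ i * real (n choose i) * f (Suc i)))
        + (\<Sum>i\<le>Suc n. (-1) ^ i * real (n choose i) * f i)"
    unfolding sum.atMost_Suc_shift [of "\<lambda>i. (-1) ^ i * real (n choose i) * f i"] by simp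
  also have "\<dots> = (\<Sum>i\<le>n. (-1) ^ i * real (n choose i) * (f i - f (Suc i)))"
    by (simp add: sum.distrib [symmetric] algebra_simps sum_subtractf)
  finally show ?thesis .
qed

lemma pochhammer_difference:
  fixes z :: real
  shows "poch z (Suc q) - poch (z + 1) (Suc q) = - real (Suc q) * poch (z + 1) q"
proof -
  have "poch z (Suc q) = z * poch (z + 1) q"
    by (simp add: pochhammer_rec)
  moreover have "poch (z + 1) (Suc q) = poch (z + 1) q * (z + 1 + real q)"
    by (simp add: pochhammer_Suc)
  ultimately show ?thesis by (simp add: algebra_simps)
qed

text \<open>
Up to sign this is the \<open>n\<close>-th difference of a monic polynomial of degree \<open>q \<le> n\<close>.
\<close>

lemma alternating_binomial_pochhammer_sum:
  fixes z :: real
  assumes "q \<le> n"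
  shows "(\<Sum>i\<le>n. (-1) ^ i * real (n choose i) * poch (z + real i) q)
       = (if q = n then (-1) ^ n * fact n else 0)"
  using assms
proof (induction n arbitrary: q z)
  case 0
  then show ?case by simp
next
  case (Suc n)
  show ?case
  proof (cases q)
    case 0
    then show ?thesis by (subst alternating_binomial_sum_Suc) simp
  next
    case (Suc p)
    have "poch (z + real i) (Suc p) - poch (z + real (Suc i)) (Suc p)
        = - real (Suc p) * poch (z + 1 + real i) p" for i
      using pochhammer_difference [of "z + real i" p] by (simp only: of_nat_Suc add_ac)
    then have "(\<Sum>i\<le>Suc n. (-1) ^ i * real (Suc n choose i) * poch (z + real i) q)
        = (\<Sum>i\<le>n. (-1) ^ i * real (n choose i) * (- real (Suc p) * poch (z + 1 + real i) p))"
      unfolding alternating_binomial_sum_Suc \<open>q = Suc p\<close> by simp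
    also have "\<dots> = - real (Suc p) * (\<Sum>i\<le>n. (-1) ^ i * real (n choose i) * poch (z + 1 + real i) p)"
      by (simp add: sum_distrib_left mult_ac)
    also have "\<dots> = (if q = Suc n then (-1) ^ Suc n * fact (Suc n) else 0)"
      using Suc.IH [of p "z + 1"] Suc.prems \<open>q = Suc p\<close> by (simp add: algebra_simps)
    finally show ?thesis .
  qed
qed

text \<open>
The quotient \<open>(z + 2 r) / (z + r)\<^bsub>M+1\<^esub>\<close> occurs below with \<open>r = 0\<close> and with \<open>z\<close> possibly \<open>0\<close>. Splitting
the vanishing factor off the Pochhammer symbol gives it a meaning there too.
\<close>

lemma pochhammer_quotient_expand:
  fixes z :: real
  assumes "r \<ge> 1" "r \<le> M" "z > -1"
  shows "poch (z + real r) (Suc M)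
       = (z + 2 * real r) * (poch (z + real r) r * poch (z + 2 * real r + 1) (M - r))"
proof -
  have "poch (z + real r) (Suc M) = poch (z + real r) (Suc r) * poch (z + 2 * real r + 1) (M - r)"
    using pochhammer_product [of "Suc r" "Suc M" "z + real r"] assms by (simp add: algebra_simps)
  then show ?thesis by (simp add: pochhammer_Suc algebra_simps)
qed

text \<open>
For \<open>M > 0\<close> the partial sum up to \<open>R\<close> is \<open>(-1)\<^sup>R (M-1 choose R) / (z + R + 1)\<^sub>M\<close>. The summand is the continuous
version of \<open>(z + 2 r) / (z + r)\<^bsub>M+1\<^esub>\<close>, because in the applications \<open>z\<close> can be \<open>0\<close>.
\<close>

lemma telescoping_binomial_sum:
  fixes z :: real
  assumes z: "z > -1"
  shows "(\<Sum>r\<le>M. (-1) ^ r * real (M choose r)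
            / (poch (z + real r) r * poch (z + 2 * real r + 1) (M - r)))
       = (if M = 0 then 1 else 0)"
proof (cases M)
  case 0
  then show ?thesis by simp
next
  case (Suc K)
  have "(\<Sum>r\<le>R. (-1) ^ r * real (M choose r)
            / (poch (z + real r) r * poch (z + 2 * real r + 1) (M - r)))
       = (-1) ^ R * real (K choose R) / poch (z + real R + 1) M" if "R \<le> M" for R
    using that
  proof (induction R)
    case 0
    then show ?case by simp
  next
    case (Suc R)
    define P where "P = poch (z + real R + 2) K"
    define y where "y = z + real R + 1"
    have y: "y > 0" using z by (simp add: y_def)
    have P: "P > 0" unfolding P_def by (rule pochhammer_pos) (use z in simp)
    have e1: "poch (z + real R + 1) M = y * P"
      unfolding y_def P_def \<open>M = Suc K\<close> by (simp add: pochhammer_rec add.commute add.left_commute)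
    have e2: "poch (z + real (Suc R) + 1) M = P * (y + real M)"
      unfolding y_def P_def \<open>M = Suc K\<close> by (simp add: pochhammer_Suc algebra_simps)
    define Q where "Q = poch (z + real (Suc R)) (Suc R) * poch (z + 2 * real (Suc R) + 1) (M - Suc R)"
    have e3: "(y + real R + 1) * Q = y * P * (y + real M)"
    proof -
      have "poch (z + real (Suc R)) (Suc M) = y * (P * (y + real M))"
        using e2 by (subst pochhammer_rec) (simp add: y_def algebra_simps)
      then show ?thesis
        using pochhammer_quotient_expand [of "Suc R" M z] Suc.prems z
        unfolding Q_def y_def by (simp add: algebra_simps)
    qed
    have yR: "y + real R + 1 > 0" using y by simp
    have Q: "Q = y * P * (y + real M) / (y + real R + 1)"
      using e3 yR by (simp add: field_simps)
    have b1: "real (M choose Suc R) = real (K choose R) + real (K choose Suc R)"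
      unfolding \<open>M = Suc K\<close> by simp
    have b2: "real (Suc R) * real (K choose Suc R) = (real K - real R) * real (K choose R)"
    proof -
      have "Suc R * (K choose Suc R) = (K - R) * (K choose R)"
        by (metis binomial_absorb_comp binomial_absorption mult.commute)
      then have "real (Suc R) * real (K choose Suc R) = real (K - R) * real (K choose R)"
        by (metis of_nat_mult)
      then show ?thesis using Suc.prems \<open>M = Suc K\<close> by (simp add: of_nat_diff)
    qed
    have yM: "y + real M > 0" using y by simp
    \<comment> \<open>the induction step over the common denominator \<open>y * P * (y + real M)\<close>\<close>
    have key: "- real (K choose R) * (y + real M) + real (M choose Suc R) * (y + real R + 1)
        = real (K choose Suc R) * y * 1"
      using b2 unfolding b1 \<open>M = Suc K\<close> by (simp add: algebra_simps)
    have "(\<Sum>r\<le>Suc R. (-1) ^ r * real (M choose r)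
            / (poch (z + real r) r * poch (z + 2 * real r + 1) (M - r)))
        = (-1) ^ R * real (K choose R) / (y * P) + (-1) ^ Suc R * real (M choose Suc R) / Q"
      using Suc by (simp add: e1 Q_def)
    also have "\<dots> = (-1) ^ Suc R * (- real (K choose R) * (y + real M) + real (M choose Suc R) * (y
        + real R + 1))
         / (y * P * (y + real M))"
    proof -
      have "(-1) ^ R * real (K choose R) / (y * P)
          = (-1) ^ R * real (K choose R) * (y + real M) / (y * P * (y + real M))"
        using yM by simp
      then show ?thesis unfolding Q by (simp add: algebra_simps flip: add_divide_distrib)
    qed
    also have "\<dots> = (-1) ^ Suc R * real (K choose Suc R) / (P * (y + real M))"
      unfolding key using y by simp
    finally show ?case by (simp only: e2)
  qed
  from this [of M] show ?thesis using Suc by simp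
qed

section \<open>Homogeneous Jacobi polynomials\<close>

text \<open>
The form \<open>(r + t)\<^sup>m P\<^sub>m\<^bsup>(\<alpha>,\<beta>)\<^esup>((t - r) / (r + t))\<close>, expanded in \<open>r\<^sup>s t\<^bsup>m-s\<^esup>\<close>. In this basis the
two parameters play symmetric roles, and Beta integrals and differential operators act term by
term.
\<close>

definition hjac :: "nat \<Rightarrow> real \<Rightarrow> real \<Rightarrow> real \<Rightarrow> real \<Rightarrow> real" where
  "hjac m \<alpha> \<beta> r t =
     (\<Sum>s\<le>m. (-1) ^ s * poch (\<alpha> + 1 + real s) (m - s) * poch (\<beta> + 1 + real (m - s)) s
        / (fact s * fact (m - s)) * r ^ s * t ^ (m - s))"

text \<open>
The Chu--Vandermonde sum, after both Pochhammer symbols have been reflected so that neither their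
starting points nor their lengths are tied together.
\<close>

lemma chu_vandermonde_mixed:
  fixes \<alpha> \<beta> :: real
  assumes "k \<le> n"
  shows "(\<Sum>s\<le>k. real (k choose s) * poch (\<alpha> + 1 + real s) (k - s)
            * poch (\<beta> + 1 + real (n - s)) s)
       = poch (real n + \<alpha> + \<beta> + 1) k"
proof -
  have "(\<Sum>s\<le>k. real (k choose s) * poch (\<alpha> + 1 + real s) (k - s)
            * poch (\<beta> + 1 + real (n - s)) s)
      = (\<Sum>s\<le>k. (-1) ^ k * (real (k choose s) * poch (- \<beta> - real n) s
            * poch (- \<alpha> - real k) (k - s)))"
  proof (intro sum.cong refl)
    fix s assume s: "s \<in> {..k}"
    have "poch (- (\<beta> + real n)) s = (-1) ^ s * poch (\<beta> + real n - real s + 1) s"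
      by (rule pochhammer_minus)
    moreover have "poch (- (\<alpha> + real k)) (k - s)
        = (-1) ^ (k - s) * poch (\<alpha> + real k - real (k - s) + 1) (k - s)"
      by (rule pochhammer_minus)
    moreover have "(-1 :: real) ^ k = (-1) ^ s * (-1) ^ (k - s)"
      using s by (simp flip: power_add)
    moreover have "real (n - s) = real n - real s" "real (k - s) = real k - real s"
      using s assms by (simp_all add: of_nat_diff)
    moreover have "(-1 :: real) ^ s * (-1) ^ s = 1" "(-1 :: real) ^ (k - s) * (-1) ^ (k - s) = 1"
      by (simp_all flip: power_mult_distrib)
    ultimately show "real (k choose s) * poch (\<alpha> + 1 + real s) (k - s)
            * poch (\<beta> + 1 + real (n - s)) s
        = (-1) ^ k * (real (k choose s) * poch (- \<beta> - real n) s
            * poch (- \<alpha> - real k) (k - s))"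
      by (simp add: algebra_simps)
  qed
  also have "\<dots> = (-1) ^ k * poch (- (real n + \<alpha> + \<beta> + real k)) k"
    using pochhammer_binomial_sum [of "- \<beta> - real n" "- \<alpha> - real k" k]
    by (simp add: sum_distrib_left algebra_simps)
  also have "\<dots> = poch (real n + \<alpha> + \<beta> + 1) k"
    by (subst pochhammer_minus) (simp flip: power_mult_distrib mult.assoc add: algebra_simps)
  finally show ?thesis .
qed

text \<open>
Substitute \<open>t = (r + t) - r\<close>. For \<open>r + t = 1\<close> this is the defining sum of the Jacobi polynomial.
\<close>

lemma hjac_sum_form:
  "hjac m \<alpha> \<beta> r t =
     (\<Sum>k\<le>m. poch (real m + \<alpha> + \<beta> + 1) k * poch (\<alpha> + real k + 1) (m - k)
        / (fact k * fact (m - k)) * (- r) ^ k * (r + t) ^ (m - k))"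
proof -
  define A where "A s = (-1) ^ s * poch (\<alpha> + 1 + real s) (m - s) * poch (\<beta> + 1 + real (m - s)) s
        / (fact s * fact (m - s))" for s
  have t: "t ^ j = (\<Sum>i\<le>j. real (j choose i) * (- r) ^ i * (r + t) ^ (j - i))" for j
    using binomial_ring [of "- r" "r + t" j] by simp
  have "hjac m \<alpha> \<beta> r t = (\<Sum>s\<le>m. \<Sum>i\<le>m - s. A s * r ^ s * (real ((m - s) choose i) * (- r) ^ i * (r
      + t) ^ (m - s - i)))"
    unfolding hjac_def A_def [symmetric] by (subst t) (simp only: sum_distrib_left diff_diff_left)
  also have "\<dots> = (\<Sum>(s, i)\<in>(SIGMA s:{..m}. {..m - s}). A s * r ^ s * (real ((m - s) choose i) * (- r) ^ i
      * (r + t) ^ (m - s - i)))"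
    by (simp add: sum.Sigma)
  also have "\<dots> = (\<Sum>(k, s)\<in>(SIGMA k:{..m}. {..k}). A s * r ^ s * (real ((m - s) choose (k - s))
      * (- r) ^ (k - s) * (r + t) ^ (m - k)))"
    by (rule sum.reindex_bij_witness [where i = "\<lambda>(k, s). (s, k - s)" and j = "\<lambda>(s, i). (s + i, s)"]) auto
  also have "\<dots> = (\<Sum>k\<le>m. \<Sum>s\<le>k. A s * r ^ s * (real ((m - s) choose (k - s)) * (- r) ^ (k - s) * (r
      + t) ^ (m - k)))"
    by (simp add: sum.Sigma)
  also have "\<dots> = (\<Sum>k\<le>m. poch (real m + \<alpha> + \<beta> + 1) k * poch (\<alpha> + real k + 1) (m - k)
        / (fact k * fact (m - k)) * (- r) ^ k * (r + t) ^ (m - k))"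
  proof (intro sum.cong refl)
    fix k assume k: "k \<in> {..m}"
    have "A s * r ^ s * (real ((m - s) choose (k - s)) * (- r) ^ (k - s) * (r + t) ^ (m - k))
        = real (k choose s) * poch (\<alpha> + 1 + real s) (k - s) * poch (\<beta> + 1 + real (m - s)) s
          * (poch (\<alpha> + real k + 1) (m - k) / (fact k * fact (m - k)) * (- r) ^ k * (r + t) ^ (m - k))"
      if s: "s \<in> {..k}" for s
    proof -
      have e1: "poch (\<alpha> + 1 + real s) (m - s) = poch (\<alpha> + 1 + real s) (k - s) * poch (\<alpha> + real k + 1) (m - k)"
        using pochhammer_product [of "k - s" "m - s" "\<alpha> + 1 + real s"] s k
        by (simp add: of_nat_diff algebra_simps)
      have e2: "real ((m - s) choose (k - s)) = fact (m - s) / (fact (k - s) * fact (m - k))"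
        using s k by (subst binomial_fact) auto
      have e3: "real (k choose s) = fact k / (fact s * fact (k - s))"
        using s k by (subst binomial_fact) auto
      have e4: "(- r) ^ k = (-1) ^ s * r ^ s * (- r) ^ (k - s)"
      proof -
        have "(- r) ^ k = (- r) ^ s * (- r) ^ (k - s)" using s by (simp flip: power_add)
        then show ?thesis by (simp add: power_minus [of r s])
      qed
      show ?thesis unfolding A_def e1 e2 e3 e4 by simp
    qed
    then have "(\<Sum>s\<le>k. A s * r ^ s * (real ((m - s) choose (k - s)) * (- r) ^ (k - s) * (r + t) ^ (m - k)))
      = (\<Sum>s\<le>k. real (k choose s) * poch (\<alpha> + 1 + real s) (k - s) * poch (\<beta> + 1 + real (m - s)) s
          * (poch (\<alpha> + real k + 1) (m - k) / (fact k * fact (m - k)) * (- r) ^ k * (r + t) ^ (m - k)))"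
      by (intro sum.cong refl)
    also have "\<dots> = poch (real m + \<alpha> + \<beta> + 1) k
          * (poch (\<alpha> + real k + 1) (m - k) / (fact k * fact (m - k)) * (- r) ^ k * (r + t) ^ (m - k))"
      using k by (simp only: sum_distrib_right [symmetric] chu_vandermonde_mixed atMost_iff)
    finally show "(\<Sum>s\<le>k. A s * r ^ s * (real ((m - s) choose (k - s)) * (- r) ^ (k - s) * (r + t) ^ (m - k)))
      = poch (real m + \<alpha> + \<beta> + 1) k * poch (\<alpha> + real k + 1) (m - k)
        / (fact k * fact (m - k)) * (- r) ^ k * (r + t) ^ (m - k)"
      by simp
  qed
  finally show ?thesis .
qed

lemma hjac_at_t_zero: "hjac m \<alpha> \<beta> r 0 = (-1) ^ m * poch (\<beta> + 1) m / fact m * r ^ m"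
proof -
  have "hjac m \<alpha> \<beta> r 0 = (\<Sum>s\<le>m. if s = m then (-1) ^ m * poch (\<beta> + 1) m / fact m * r ^ m else 0)"
    unfolding hjac_def by (intro sum.cong refl) (auto simp: power_0_left)
  then show ?thesis by simp
qed

lemma hjac_0 [simp]: "hjac 0 \<alpha> \<beta> r t = 1"
  by (simp add: hjac_def)

lemma hjac_scale: "hjac m \<alpha> \<beta> (c * r) (c * t) = c ^ m * hjac m \<alpha> \<beta> r t"
proof -
  have "(c * r) ^ s * (c * t) ^ (m - s) = c ^ m * (r ^ s * t ^ (m - s))" if "s \<le> m" for s
  proof -
    have "c ^ m = c ^ s * c ^ (m - s)" using that by (simp flip: power_add)
    then show ?thesis by (simp add: power_mult_distrib mult_ac)
  qed
  then show ?thesis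
    unfolding hjac_def sum_distrib_left
    by (intro sum.cong refl) (simp only: mult.assoc atMost_iff, simp only: mult_ac)
qed

lemma jacobi_eq_hjac: "jacobi m \<alpha> \<beta> (2 * t - 1) = hjac m \<alpha> \<beta> (1 - t) t"
proof -
  have e: "(2 * t - 1 - 1) / 2 = - (1 - t)" by simp
  show ?thesis
    unfolding jacobi_def hjac_sum_form e by (intro sum.cong refl) (simp add: add_ac)
qed

text \<open>
The case \<open>s = 0\<close> covers the points of the simplex where a denominator vanishes: both sides are
\<open>0 ^ m\<close>.
\<close>

lemma jacobi_factor_eq_hjac:
  assumes "0 < s \<or> x = 0 \<and> s = 0"
  shows "s ^ m * jacobi m \<alpha> \<beta> (2 * x / s - 1) = hjac m \<alpha> \<beta> (s - x) x"
proof (cases "s = 0")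
  case True
  with assms have "x = 0" by auto
  with True show ?thesis
    by (cases m) (auto simp: jacobi_def hjac_at_t_zero)
next
  case False
  have "jacobi m \<alpha> \<beta> (2 * x / s - 1) = hjac m \<alpha> \<beta> (1 - x / s) (x / s)"
    using jacobi_eq_hjac [of m \<alpha> \<beta> "x / s"] by simp
  then have "s ^ m * jacobi m \<alpha> \<beta> (2 * x / s - 1) = hjac m \<alpha> \<beta> (s * (1 - x / s)) (s * (x / s))"
    by (simp only: hjac_scale)
  then show ?thesis using False by (simp add: algebra_simps)
qed

section \<open>Powers as combinations of Jacobi polynomials\<close>

text \<open>
On the face \<open>v = 0\<close> the forms on the right-hand side of an exchange become
\<open>w\<^sup>l hjac (M - l) (A + 2 l) b w u\<close>, whose first parameter moves with the index. Comparing
coefficients of \<open>w\<^sup>k (w + u)\<^bsup>M-k\<^esup>\<close> leaves a telescoping sum.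
\<close>

lemma power_eq_sum_hjac_shifted:
  fixes A b u w :: real
  assumes A: "A > -1"
  shows "(w + u) ^ M = (\<Sum>l\<le>M. fact M / fact l * poch (real M + A + b + 1) l
      / (poch (A + real l) l * poch (A + 2 * real l + 1) (M - l))
      * w ^ l * hjac (M - l) (A + 2 * real l) b w u)"
proof -
  define B where "B l = fact M / fact l * poch (real M + A + b + 1) l
      / (poch (A + real l) l * poch (A + 2 * real l + 1) (M - l))" for l
  define G where "G l k = poch (real (M - l) + (A + 2 * real l) + b + 1) k
      * poch (A + 2 * real l + real k + 1) (M - l - k) / (fact k * fact (M - l - k))" for l k
  have "(\<Sum>l\<le>M. B l * w ^ l * hjac (M - l) (A + 2 * real l) b w u)
      = (\<Sum>l\<le>M. \<Sum>k\<le>M - l. B l * w ^ l * (G l k * (- w) ^ k * (w + u) ^ (M - l - k)))"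
    unfolding hjac_sum_form G_def by (simp only: sum_distrib_left)
  also have "\<dots> = (\<Sum>(l, k)\<in>(SIGMA l:{..M}. {..M - l}). B l * w ^ l * (G l k * (- w) ^ k * (w
      + u) ^ (M - l - k)))"
    by (simp add: sum.Sigma)
  also have "\<dots> = (\<Sum>(k, l)\<in>(SIGMA k:{..M}. {..k}). B l * w ^ l * (G l (k - l) * (- w) ^ (k - l) * (w
      + u) ^ (M - k)))"
    by (rule sum.reindex_bij_witness [where i = "\<lambda>(k, s). (s, k - s)" and j = "\<lambda>(s, i). (s + i, s)"]) auto
  also have "\<dots> = (\<Sum>k\<le>M. \<Sum>l\<le>k. B l * w ^ l * (G l (k - l) * (- w) ^ (k - l) * (w + u) ^ (M - k)))"
    by (simp add: sum.Sigma)
  also have "\<dots> = (\<Sum>k\<le>M. if k = 0 then (w + u) ^ M else 0)"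
  proof (intro sum.cong refl)
    fix k assume k: "k \<in> {..M}"
    \<comment> \<open>what the coefficient of \<open>w\<^sup>k (w + u)\<^bsup>M-k\<^esup>\<close> has in common for all \<open>l\<close>\<close>
    define R where "R = fact M / (fact k * fact (M - k)) * poch (real M + A + b + 1) k * (- w) ^ k * (w
        + u) ^ (M - k)"
    have "B l * w ^ l * (G l (k - l) * (- w) ^ (k - l) * (w + u) ^ (M - k))
        = R * ((-1) ^ l * real (k choose l) / (poch (A + real l) l * poch (A + 2 * real l + 1) (k - l)))"
      if l: "l \<in> {..k}" for l
    proof -
      have e1: "poch (real M + A + b + 1) k
          = poch (real M + A + b + 1) l * poch (real M + A + b + 1 + real l) (k - l)"
        using l by (intro pochhammer_product) simp
      have e1': "real (M - l) + (A + 2 * real l) + b + 1 = real M + A + b + 1 + real l"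
        using l k by (simp add: of_nat_diff)
      have e2: "poch (A + 2 * real l + 1) (M - l)
          = poch (A + 2 * real l + 1) (k - l) * poch (A + 2 * real l + real (k - l) + 1) (M - k)"
        using pochhammer_product [of "k - l" "M - l" "A + 2 * real l + 1"] l k by (simp add: algebra_simps)
      have e3: "real (k choose l) = fact k / (fact l * fact (k - l))"
        using l by (subst binomial_fact) auto
      have e4: "(- w) ^ k = (-1) ^ l * w ^ l * (- w) ^ (k - l)"
      proof -
        have "(- w) ^ k = (- w) ^ l * (- w) ^ (k - l)" using l by (simp flip: power_add)
        then show ?thesis by (simp add: power_minus [of w l])
      qed
      have e5: "M - l - (k - l) = M - k" using l by simp
      have p: "poch (A + 2 * real l + real (k - l) + 1) (M - k) \<noteq> 0"
        by (rule less_imp_neq [THEN not_sym], rule pochhammer_pos) (use A in simp)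
      show ?thesis
        unfolding B_def G_def R_def e1 e1' e2 e3 e4 e5 using p by (simp add: minus_one_power_cancel mult_ac)
    qed
    then have "(\<Sum>l\<le>k. B l * w ^ l * (G l (k - l) * (- w) ^ (k - l) * (w + u) ^ (M - k)))
        = R * (\<Sum>l\<le>k. (-1) ^ l * real (k choose l) / (poch (A + real l) l * poch (A + 2 * real l + 1) (k - l)))"
      by (simp only: sum_distrib_left cong: sum.cong)
    also have "\<dots> = R * (if k = 0 then 1 else 0)"
      by (simp only: telescoping_binomial_sum [OF A])
    finally show "(\<Sum>l\<le>k. B l * w ^ l * (G l (k - l) * (- w) ^ (k - l) * (w + u) ^ (M - k)))
        = (if k = 0 then (w + u) ^ M else 0)"
      by (simp add: R_def)
  qed
  finally show ?thesis by (simp add: B_def)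
qed

text \<open>
The expansion needed on the face \<open>u = 0\<close>, where the Jacobi parameters do not depend on the index.
\<close>

lemma power_eq_sum_hjac:
  fixes a c v w :: real
  assumes a: "a > -1" and c: "c > -1"
  shows "w ^ j = (\<Sum>l\<le>j. (-1) ^ l * fact j * poch (a + 1) j
      / (fact (j - l) * poch (a + 1) l * poch (a + c + 1 + real l) l
          * poch (a + c + 2 * real l + 2) (j - l))
      * (w + v) ^ (j - l) * hjac l a c w v)"
proof -
  define B where "B l = (-1) ^ l * fact j * poch (a + 1) j
      / (fact (j - l) * poch (a + 1) l * poch (a + c + 1 + real l) l
          * poch (a + c + 2 * real l + 2) (j - l))" for l
  define G where "G l k = poch (real l + a + c + 1) k * poch (a + real k + 1) (l - k)
     / (fact k * fact (l - k))" for l k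
  have "(\<Sum>l\<le>j. B l * (w + v) ^ (j - l) * hjac l a c w v)
      = (\<Sum>l\<le>j. \<Sum>k\<le>l. B l * (w + v) ^ (j - l) * (G l k * (- w) ^ k * (w + v) ^ (l - k)))"
    unfolding hjac_sum_form G_def by (simp only: sum_distrib_left)
  also have "\<dots> = (\<Sum>(l, k)\<in>(SIGMA l:{..j}. {..l}). B l * (w + v) ^ (j - l) * (G l k * (- w) ^ k * (w
      + v) ^ (l - k)))"
    by (simp add: sum.Sigma)
  also have "\<dots> = (\<Sum>(k, r)\<in>(SIGMA k:{..j}. {..j - k}). B (k + r) * G (k + r) k * (- w) ^ k * (w + v) ^ (j - k))"
    by (rule sum.reindex_bij_witness [where i = "\<lambda>(k, r). (k + r, k)" and j = "\<lambda>(l, k). (k, l - k)"])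
      (auto simp: mult_ac simp flip: power_add)
  also have "\<dots> = (\<Sum>k\<le>j. \<Sum>r\<le>j - k. B (k + r) * G (k + r) k * (- w) ^ k * (w + v) ^ (j - k))"
    by (simp add: sum.Sigma)
  also have "\<dots> = (\<Sum>k\<le>j. if k = j then w ^ j else 0)"
  proof (intro sum.cong refl)
    fix k assume k: "k \<in> {..j}"
    \<comment> \<open>what the coefficient of \<open>w\<^sup>k (w + v)\<^bsup>j-k\<^esup>\<close> has in common for all \<open>l\<close>\<close>
    define R where "R = fact j * poch (a + 1) j / (poch (a + 1) k * fact k * fact (j - k)) * w ^ k * (w
        + v) ^ (j - k)"
    define z where "z = a + c + 1 + 2 * real k"
    have z: "z > -1" using a c by (simp add: z_def)
    have "B (k + r) * G (k + r) k * (- w) ^ k * (w + v) ^ (j - k)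
        = R * ((-1) ^ r * real ((j - k) choose r) / (poch (z + real r) r * poch (z + 2 * real r
            + 1) (j - k - r)))"
      if r: "r \<in> {..j - k}" for r
    proof -
      have e1: "poch (a + c + 1 + real (k + r)) (k + r)
          = poch (real (k + r) + a + c + 1) k * poch (z + real r) r"
        using pochhammer_product [of k "k + r" "a + c + 1 + real (k + r)"]
        by (simp add: z_def algebra_simps)
      have e2: "a + c + 2 * real (k + r) + 2 = z + 2 * real r + 1" by (simp add: z_def)
      have e3: "real ((j - k) choose r) = fact (j - k) / (fact r * fact (j - k - r))"
        using r by (subst binomial_fact) auto
      have e4: "poch (a + 1) (k + r) = poch (a + 1) k * poch (a + real k + 1) r"
        using pochhammer_product [of k "k + r" "a + 1"] by (simp add: algebra_simps)
      have e5: "j - (k + r) = j - k - r" "k + r - k = r" by simp_all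
      have p1: "poch (a + real k + 1) r \<noteq> 0"
        by (rule less_imp_neq [THEN not_sym], rule pochhammer_pos) (use a in simp)
      have p2: "poch (real (k + r) + a + c + 1) k \<noteq> 0"
      proof (cases k)
        case (Suc k')
        then show ?thesis
          by (intro less_imp_neq [THEN not_sym] pochhammer_pos) (use a c in simp)
      qed simp
      show ?thesis
        unfolding B_def G_def R_def e1 e2 e3 e4 e5 power_minus [of w k] power_add using p1 p2
        by (simp add: minus_one_power_cancel mult_ac)
    qed
    then have "(\<Sum>r\<le>j - k. B (k + r) * G (k + r) k * (- w) ^ k * (w + v) ^ (j - k))
        = R * (\<Sum>r\<le>j - k. (-1) ^ r * real ((j - k) choose r) / (poch (z + real r) r * poch (z + 2 * real r
            + 1) (j - k - r)))"
      by (simp only: sum_distrib_left cong: sum.cong)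
    also have "\<dots> = R * (if j - k = 0 then 1 else 0)"
      by (simp only: telescoping_binomial_sum [OF z])
    also have "\<dots> = (if k = j then w ^ j else 0)"
    proof -
      have "poch (a + 1) j \<noteq> 0"
        by (rule less_imp_neq [THEN not_sym], rule pochhammer_pos) (use a in simp)
      then show ?thesis using k by (auto simp: R_def)
    qed
    finally show "(\<Sum>r\<le>j - k. B (k + r) * G (k + r) k * (- w) ^ k * (w + v) ^ (j - k)) = (if k
        = j then w ^ j else 0)" .
  qed
  finally show ?thesis by (simp add: B_def)
qed

section \<open>Ternary forms annihilated by the weighted Laplacian\<close>

text \<open>
\<open>p\<close> is a form of degree \<open>n\<close> in \<open>u, v, w\<close> with
\<open>(u\<partial>\<^sub>u\<^sup>2 + (b+1)\<partial>\<^sub>u + v\<partial>\<^sub>v\<^sup>2 + (c+1)\<partial>\<^sub>v + w\<partial>\<^sub>w\<^sup>2 + (a+1)\<partial>\<^sub>w) p = 0\<close>. With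
\<open>u, v, w\<close> replaced by squares this is the
Laplace equation of Dunkl theory. The condition is put on a coefficient array, where the operator
is a three-term relation.
\<close>

definition harmonic_form ::
    "nat \<Rightarrow> real \<Rightarrow> real \<Rightarrow> real \<Rightarrow> (real \<Rightarrow> real \<Rightarrow> real \<Rightarrow> real) \<Rightarrow> bool" where
  "harmonic_form n b c a p \<longleftrightarrow>
     (\<exists>e. (\<forall>u v w. p u v w = (\<Sum>i\<le>n. \<Sum>j\<le>n - i. e i j (n - i - j) * u ^ i * v ^ j * w ^ (n - i - j))) \<and>
       (\<forall>i j k. Suc (i + j + k) = n \<longrightarrow>
          (real i + 1) * (real i + 1 + b) * e (Suc i) j k
        + (real j + 1) * (real j + 1 + c) * e i (Suc j) k
        + (real k + 1) * (real k + 1 + a) * e i j (Suc k) = 0))"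

lemma harmonic_form_zero: "harmonic_form n b c a (\<lambda>u v w. 0)"
  unfolding harmonic_form_def by (rule exI [of _ "\<lambda>i j k. 0"]) simp

lemma harmonic_form_lincomb:
  assumes "harmonic_form n b c a p" "harmonic_form n b c a q"
  shows "harmonic_form n b c a (\<lambda>u v w. p u v w + r * q u v w)"
proof -
  obtain e where e: "\<And>u v w. p u v w = (\<Sum>i\<le>n. \<Sum>j\<le>n - i. e i j (n - i - j) * u ^ i * v ^ j * w ^ (n - i - j))"
    "\<And>i j k. Suc (i + j + k) = n \<Longrightarrow>
          (real i + 1) * (real i + 1 + b) * e (Suc i) j k
        + (real j + 1) * (real j + 1 + c) * e i (Suc j) k
        + (real k + 1) * (real k + 1 + a) * e i j (Suc k) = 0"
    using assms(1) unfolding harmonic_form_def by blast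
  obtain f where f: "\<And>u v w. q u v w = (\<Sum>i\<le>n. \<Sum>j\<le>n - i. f i j (n - i - j) * u ^ i * v ^ j * w ^ (n - i - j))"
    "\<And>i j k. Suc (i + j + k) = n \<Longrightarrow>
          (real i + 1) * (real i + 1 + b) * f (Suc i) j k
        + (real j + 1) * (real j + 1 + c) * f i (Suc j) k
        + (real k + 1) * (real k + 1 + a) * f i j (Suc k) = 0"
    using assms(2) unfolding harmonic_form_def by blast
  have "(real i + 1) * (real i + 1 + b) * (e (Suc i) j k + r * f (Suc i) j k)
        + (real j + 1) * (real j + 1 + c) * (e i (Suc j) k + r * f i (Suc j) k)
        + (real k + 1) * (real k + 1 + a) * (e i j (Suc k) + r * f i j (Suc k)) = 0"
    if "Suc (i + j + k) = n" for i j k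
  proof -
    have "(real i + 1) * (real i + 1 + b) * (e (Suc i) j k + r * f (Suc i) j k)
        + (real j + 1) * (real j + 1 + c) * (e i (Suc j) k + r * f i (Suc j) k)
        + (real k + 1) * (real k + 1 + a) * (e i j (Suc k) + r * f i j (Suc k))
        = ((real i + 1) * (real i + 1 + b) * e (Suc i) j k
        + (real j + 1) * (real j + 1 + c) * e i (Suc j) k
        + (real k + 1) * (real k + 1 + a) * e i j (Suc k)) + r * ((real i + 1) * (real i + 1 + b)
            * f (Suc i) j k
        + (real j + 1) * (real j + 1 + c) * f i (Suc j) k
        + (real k + 1) * (real k + 1 + a) * f i j (Suc k))"
      by (simp only: distrib_left mult_ac add_ac)
    then show ?thesis by (simp only: e(2) [OF that] f(2) [OF that] mult_zero_right add_0)
  qed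
  moreover have "p u v w + r * q u v w
      = (\<Sum>i\<le>n. \<Sum>j\<le>n - i. (e i j (n - i - j) + r * f i j (n - i - j)) * u ^ i * v ^ j * w ^ (n - i - j))"
          for u v w
    unfolding e(1) f(1) by (simp add: sum_distrib_left sum.distrib distrib_left distrib_right mult_ac)
  ultimately show ?thesis
    unfolding harmonic_form_def by (intro exI [of _ "\<lambda>i j k. e i j k + r * f i j k"]) blast
qed

lemma harmonic_form_sum:
  assumes "finite S" "\<And>l. l \<in> S \<Longrightarrow> harmonic_form n b c a (p l)"
  shows "harmonic_form n b c a (\<lambda>u v w. \<Sum>l\<in>S. r l * p l u v w)"
  using assms
proof (induction S rule: finite_induct)
  case empty
  then show ?case by (simp add: harmonic_form_zero)
next
  case (insert x S)
  have "harmonic_form n b c a (\<lambda>u v w. (\<Sum>l\<in>S. r l * p l u v w) + r x * p x u v w)"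
    by (rule harmonic_form_lincomb) (use insert in auto)
  then show ?case using insert by (simp add: add.commute)
qed

lemma harmonic_form_swap:
  assumes "harmonic_form n b c a p"
  shows "harmonic_form n c b a (\<lambda>u v w. p v u w)"
proof -
  obtain e where e: "\<And>u v w. p u v w = (\<Sum>i\<le>n. \<Sum>j\<le>n - i. e i j (n - i - j) * u ^ i * v ^ j * w ^ (n - i - j))"
    "\<And>i j k. Suc (i + j + k) = n \<Longrightarrow>
          (real i + 1) * (real i + 1 + b) * e (Suc i) j k
        + (real j + 1) * (real j + 1 + c) * e i (Suc j) k
        + (real k + 1) * (real k + 1 + a) * e i j (Suc k) = 0"
    using assms unfolding harmonic_form_def by blast
  have "p v u w = (\<Sum>i\<le>n. \<Sum>j\<le>n - i. e j i (n - i - j) * u ^ i * v ^ j * w ^ (n - i - j))" for u v w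
    unfolding e(1) sum.Sigma [OF finite_atMost ballI [OF finite_atMost]]
    by (rule sum.reindex_bij_witness [where i = "\<lambda>(i, j). (j, i)" and j = "\<lambda>(i, j). (j, i)"])
      (auto simp: diff_commute mult_ac add.commute)
  moreover have "(real i + 1) * (real i + 1 + c) * e j (Suc i) k
        + (real j + 1) * (real j + 1 + b) * e (Suc j) i k
        + (real k + 1) * (real k + 1 + a) * e j i (Suc k) = 0"
    if "Suc (i + j + k) = n" for i j k
    using e(2) [of j i k] that by (simp add: add_ac)
  ultimately show ?thesis
    unfolding harmonic_form_def by (intro exI [of _ "\<lambda>i j k. e j i k"]) blast
qed

text \<open>
The relation expresses the coefficients with \<open>v\<close>-degree \<open>j + 1\<close> by those of degree \<open>j\<close>, since
\<open>(j + 1) (j + 1 + c)\<close> is not \<open>0\<close>.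
\<close>

lemma harmonic_form_zero_on_face:
  assumes p: "harmonic_form n b c a p" and c: "c > -1" and z: "\<And>u w. p u 0 w = 0"
  shows "p u v w = 0"
proof -
  obtain e where e: "\<And>u v w. p u v w = (\<Sum>i\<le>n. \<Sum>j\<le>n - i. e i j (n - i - j) * u ^ i * v ^ j * w ^ (n - i - j))"
    "\<And>i j k. Suc (i + j + k) = n \<Longrightarrow>
          (real i + 1) * (real i + 1 + b) * e (Suc i) j k
        + (real j + 1) * (real j + 1 + c) * e i (Suc j) k
        + (real k + 1) * (real k + 1 + a) * e i j (Suc k) = 0"
    using p unfolding harmonic_form_def by blast
  have "(\<Sum>i\<le>n. e i 0 (n - i) * u ^ i) = 0" for u
  proof -
    have "(\<Sum>j\<le>n - i. e i j (n - i - j) * u ^ i * 0 ^ j * 1 ^ (n - i - j)) = e i 0 (n - i) * u ^ i" for i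
      by (subst sum.remove [of _ 0]) (auto intro!: sum.neutral)
    then show ?thesis using z [of u 1] unfolding e(1) by simp
  qed
  then have z0: "e i 0 k = 0" if "i + k = n" for i k
    using that Transcendental.polyfun_eq_0 [of "\<lambda>i. e i 0 (n - i)" n] by (metis add_diff_cancel_left' le_add1)
  have "e i j k = 0" if "i + j + k = n" for i j k
    using that
  proof (induction j arbitrary: i k)
    case 0
    then show ?case using z0 by simp
  next
    case (Suc j)
    have "e (Suc i) j k = 0" "e i j (Suc k) = 0" using Suc by auto
    with e(2) [of i j k] Suc.prems have "(real j + 1) * (real j + 1 + c) * e i (Suc j) k = 0"
      by simp
    moreover have "(real j + 1) * (real j + 1 + c) \<noteq> 0"
    proof -
      have "real j + 1 + c > 0" using c by linarith
      then show ?thesis by simp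
    qed
    ultimately show ?case by simp
  qed
  then show ?thesis unfolding e(1) by (auto intro!: sum.neutral)
qed

definition hjac_coeff :: "nat \<Rightarrow> real \<Rightarrow> real \<Rightarrow> nat \<Rightarrow> real" where
  "hjac_coeff m \<alpha> \<beta> s = (-1) ^ s * poch (\<alpha> + 1 + real s) (m - s) * poch (\<beta> + 1 + real (m - s)) s
        / (fact s * fact (m - s))"

text \<open>
A binary Jacobi form is harmonic in its own two variables.
\<close>

lemma hjac_coeff_recurrence:
  assumes "i + Suc s = m"
  shows "(real i + 1) * (real i + 1 + \<beta>) * hjac_coeff m \<alpha> \<beta> s
       + (real s + 1) * (real s + 1 + \<alpha>) * hjac_coeff m \<alpha> \<beta> (Suc s) = 0"
proof -
  have m: "m - s = Suc i" "m - Suc s = i" using assms by auto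
  have e1: "poch (\<alpha> + 1 + real s) (Suc i) = (\<alpha> + 1 + real s) * poch (\<alpha> + 1 + real (Suc s)) i"
    by (simp add: pochhammer_rec add_ac)
  have e2: "poch (\<beta> + 1 + real i) (Suc s) = (\<beta> + 1 + real i) * poch (\<beta> + 1 + real (Suc i)) s"
    by (simp add: pochhammer_rec add_ac)
  have f: "(fact (Suc i) :: real) = (real i + 1) * fact i" "(fact (Suc s) :: real) = (real s + 1) * fact s"
    by (simp_all add: algebra_simps)
  have n: "real i + 1 \<noteq> 0" "real s + 1 \<noteq> 0" by linarith+
  have h1: "(real i + 1) * hjac_coeff m \<alpha> \<beta> s = (-1) ^ s * poch (\<alpha> + 1 + real s) (Suc i)
      * poch (\<beta> + 1 + real (Suc i)) s / (fact s * fact i)"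
    unfolding hjac_coeff_def m f using n by simp
  have h2: "(real s + 1) * hjac_coeff m \<alpha> \<beta> (Suc s) = - ((-1) ^ s * poch (\<alpha> + 1 + real (Suc s)) i
      * poch (\<beta> + 1 + real i) (Suc s) / (fact s * fact i))"
    unfolding hjac_coeff_def m f using n by simp
  have "(real i + 1) * (real i + 1 + \<beta>) * hjac_coeff m \<alpha> \<beta> s
       + (real s + 1) * (real s + 1 + \<alpha>) * hjac_coeff m \<alpha> \<beta> (Suc s)
     = (real i + 1 + \<beta>) * ((real i + 1) * hjac_coeff m \<alpha> \<beta> s)
       + (real s + 1 + \<alpha>) * ((real s + 1) * hjac_coeff m \<alpha> \<beta> (Suc s))"
    by (simp only: mult_ac)
  also have "\<dots> = 0"
    unfolding h1 h2 e1 e2 by (simp add: add_ac mult_ac)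
  finally show ?thesis .
qed

text \<open>
Coefficients of \<open>(v + w)\<^sup>s g(v, w)\<close>, where \<open>G j k\<close> is the coefficient of \<open>v\<^sup>j w\<^sup>k\<close> in \<open>g\<close>.
\<close>

primrec times_power_sum :: "(nat \<Rightarrow> nat \<Rightarrow> real) \<Rightarrow> nat \<Rightarrow> nat \<Rightarrow> nat \<Rightarrow> real" where
  "times_power_sum G 0 = G"
| "times_power_sum G (Suc s) = (\<lambda>j k. (if j = 0 then 0 else times_power_sum G s (j - 1) k)
      + (if k = 0 then 0 else times_power_sum G s j (k - 1)))"

lemma times_power_sum_eval:
  "(\<Sum>j\<le>l + s. times_power_sum G s j (l + s - j) * v ^ j * w ^ (l + s - j))
     = (v + w) ^ s * (\<Sum>j\<le>l. G j (l - j) * v ^ j * w ^ (l - j))"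
proof (induction s)
  case 0
  then show ?case by simp
next
  case (Suc s)
  let ?E = "times_power_sum G s"
  have "(\<Sum>j\<le>l + Suc s. times_power_sum G (Suc s) j (l + Suc s - j) * v ^ j * w ^ (l + Suc s - j))
      = (\<Sum>j\<le>Suc (l + s). (if j = 0 then 0 else ?E (j - 1) (Suc (l + s) - j)) * v ^ j * w ^ (Suc (l + s) - j))
        + (\<Sum>j\<le>Suc (l + s). (if Suc (l + s) - j = 0 then 0 else ?E j (Suc (l + s) - j - 1)) * v ^ j
            * w ^ (Suc (l + s) - j))"
    by (simp only: times_power_sum.simps add_Suc_right distrib_right sum.distrib)
  also have "(\<Sum>j\<le>Suc (l + s). (if j = 0 then 0 else ?E (j - 1) (Suc (l + s) - j)) * v ^ j * w ^ (Suc (l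
      + s) - j))
      = v * (\<Sum>j\<le>l + s. ?E j (l + s - j) * v ^ j * w ^ (l + s - j))"
    by (subst sum.atMost_Suc_shift) (simp add: sum_distrib_left mult_ac)
  also have "(\<Sum>j\<le>Suc (l + s). (if Suc (l + s) - j = 0 then 0 else ?E j (Suc (l + s) - j - 1)) * v ^ j
      * w ^ (Suc (l + s) - j))
      = w * (\<Sum>j\<le>l + s. ?E j (l + s - j) * v ^ j * w ^ (l + s - j))"
  proof -
    have "(\<Sum>j\<le>Suc (l + s). (if Suc (l + s) - j = 0 then 0 else ?E j (Suc (l + s) - j - 1)) * v ^ j
        * w ^ (Suc (l + s) - j))
        = (\<Sum>j\<le>l + s. (if Suc (l + s) - j = 0 then 0 else ?E j (Suc (l + s) - j - 1)) * v ^ j * w ^ (Suc (l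
            + s) - j))"
      by simp
    also have "\<dots> = (\<Sum>j\<le>l + s. w * (?E j (l + s - j) * v ^ j * w ^ (l + s - j)))"
      by (intro sum.cong refl) (simp add: Suc_diff_le)
    finally show ?thesis by (simp only: sum_distrib_left)
  qed
  finally show ?case using Suc.IH by (simp add: algebra_simps)
qed

text \<open>
For a harmonic form \<open>g\<close> of degree \<open>l\<close>, the operator maps \<open>(v + w)\<^sup>s g\<close> to
\<open>s (s + a + c + 1 + 2 l) (v + w)\<^bsup>s-1\<^esup> g\<close>. So \<open>v + w\<close> behaves like a single variable whose exponent
is \<open>a + c + 2 l + 1\<close>, which is why this number is the parameter of the outer Jacobi factor.
\<close>

lemma times_power_sum_laplace:
  assumes G: "\<And>j k. Suc (j + k) = l \<Longrightarrow>
      (real j + 1) * (real j + 1 + c) * G (Suc j) k + (real k + 1) * (real k + 1 + a) * G j (Suc k) = 0"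
    and "Suc (j + k) = l + s"
  shows "(real j + 1) * (real j + 1 + c) * times_power_sum G s (Suc j) k
       + (real k + 1) * (real k + 1 + a) * times_power_sum G s j (Suc k)
     = real s * (real s + a + c + 1 + 2 * real l) * times_power_sum G (s - 1) j k"
  using assms(2)
proof (induction s arbitrary: j k)
  case 0
  then show ?case using G [of j k] by simp
next
  case (Suc s)
  let ?E = "times_power_sum G s" and ?D = "times_power_sum G (s - 1)"
  define A where "A = (if j = 0 then 0 else ?E (j - 1) (Suc k))"
  define B where "B = (if k = 0 then 0 else ?E (Suc j) (k - 1))"
  define A' where "A' = (if j = 0 then 0 else ?D (j - 1) k)"
  define B' where "B' = (if k = 0 then 0 else ?D j (k - 1))"
  have h1: "real j * (real j + c) * ?E j k + (real k + 1) * (real k + 1 + a) * A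
      = real s * (real s + a + c + 1 + 2 * real l) * A'"
    using Suc.IH [of "j - 1" k] Suc.prems by (cases j) (auto simp: A_def A'_def add_ac)
  have h2: "(real j + 1) * (real j + 1 + c) * B + real k * (real k + a) * ?E j k
      = real s * (real s + a + c + 1 + 2 * real l) * B'"
    using Suc.IH [of j "k - 1"] Suc.prems by (cases k) (auto simp: B_def B'_def add_ac)
  have h3: "real s * ?E j k = real s * (A' + B')"
    by (cases s) (simp_all add: A'_def B'_def)
  have jk: "real j + real k = real l + real s" using Suc.prems by linarith
  have e: "times_power_sum G (Suc s) (Suc j) k = ?E j k + B" "times_power_sum G (Suc s) j (Suc k) = A + ?E j k"
    by (simp_all add: A_def B_def)
  have "(real j + 1) * (real j + 1 + c) * (?E j k + B) + (real k + 1) * (real k + 1 + a) * (A + ?E j k)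
      = (real j * (real j + c) * ?E j k + (real k + 1) * (real k + 1 + a) * A)
        + ((real j + 1) * (real j + 1 + c) * B + real k * (real k + a) * ?E j k)
        + (2 * (real j + real k) + 2 + a + c) * ?E j k"
    by (simp add: algebra_simps)
  also have "\<dots> = (real s + a + c + 1 + 2 * real l) * (real s * (A' + B')) + (2 * (real l + real s) + 2 + a
      + c) * ?E j k"
    unfolding h1 h2 jk by (simp add: algebra_simps)
  also have "\<dots> = real (Suc s) * (real (Suc s) + a + c + 1 + 2 * real l) * ?E j k"
    unfolding h3 [symmetric] by (simp add: algebra_simps)
  finally show ?case unfolding e by simp
qed

text \<open>
In the variables \<open>u\<close> and \<open>v + w\<close> the outer factor is again harmonic, by
\<open>times_power_sum_laplace\<close>.
\<close>

lemma harmonic_form_hjac_product: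
  "harmonic_form (m + l) b c a
     (\<lambda>u v w. hjac m (a + c + 2 * real l + 1) b (v + w) u * hjac l a c w v)"
proof -
  define \<alpha> where "\<alpha> = a + c + 2 * real l + 1"
  define f where "f = hjac_coeff m \<alpha> b"
  define G where "G j k = hjac_coeff l a c k" for j k :: nat
  define E where "E = times_power_sum G"
  \<comment> \<open>The coefficient of \<open>u\<^sup>i\<close> is \<open>f (m - i) (v + w)\<^bsup>m-i\<^esup>\<close> times the inner factor.\<close>
  define e where "e i j k = (if i \<le> m then f (m - i) * E (m - i) j k else 0)" for i j k
  have G: "(real j + 1) * (real j + 1 + c) * G (Suc j) k + (real k + 1) * (real k + 1 + a) * G j (Suc k) = 0"
    if "Suc (j + k) = l" for j k
    unfolding G_def using hjac_coeff_recurrence [of j k l c a] that by simp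
  have L: "(real j + 1) * (real j + 1 + c) * E s (Suc j) k + (real k + 1) * (real k + 1 + a) * E s j (Suc k)
     = real s * (real s + \<alpha>) * E (s - 1) j k" if "Suc (j + k) = l + s" for j k s
    using times_power_sum_laplace [of l c G a j k s, OF G that] by (simp add: E_def \<alpha>_def add_ac)
  have Hl: "hjac l a c w v = (\<Sum>j\<le>l. G j (l - j) * v ^ j * w ^ (l - j))" for v w
    unfolding hjac_def G_def hjac_coeff_def
    by (rule sum.reindex_bij_witness [where i = "\<lambda>j. l - j" and j = "\<lambda>j. l - j"]) (auto simp: mult_ac)
  have Hm: "hjac m \<alpha> b r u = (\<Sum>i\<le>m. f (m - i) * u ^ i * r ^ (m - i))" for r u
    unfolding hjac_def f_def hjac_coeff_def
    by (rule sum.reindex_bij_witness [where i = "\<lambda>j. m - j" and j = "\<lambda>j. m - j"]) (auto simp: mult_ac)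
  have "hjac m \<alpha> b (v + w) u * hjac l a c w v
      = (\<Sum>i\<le>m + l. \<Sum>j\<le>m + l - i. e i j (m + l - i - j) * u ^ i * v ^ j * w ^ (m + l - i - j))" for u v w
  proof -
    have "hjac m \<alpha> b (v + w) u * hjac l a c w v
        = (\<Sum>i\<le>m. f (m - i) * u ^ i * ((v + w) ^ (m - i) * hjac l a c w v))"
      unfolding Hm by (simp add: sum_distrib_left sum_distrib_right mult_ac)
    also have "\<dots> = (\<Sum>i\<le>m. \<Sum>j\<le>m + l - i. e i j (m + l - i - j) * u ^ i * v ^ j * w ^ (m + l - i - j))"
    proof (intro sum.cong refl)
      fix i assume "i \<in> {..m}"
      then have i: "i \<le> m" "l + (m - i) = m + l - i" by auto
      have "(v + w) ^ (m - i) * hjac l a c w v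
          = (\<Sum>j\<le>m + l - i. E (m - i) j (m + l - i - j) * v ^ j * w ^ (m + l - i - j))"
        unfolding Hl E_def times_power_sum_eval [symmetric] i(2) ..
      then show "f (m - i) * u ^ i * ((v + w) ^ (m - i) * hjac l a c w v)
         = (\<Sum>j\<le>m + l - i. e i j (m + l - i - j) * u ^ i * v ^ j * w ^ (m + l - i - j))"
        using i by (simp add: e_def sum_distrib_left mult_ac)
    qed
    also have "\<dots> = (\<Sum>i\<le>m + l. \<Sum>j\<le>m + l - i. e i j (m + l - i - j) * u ^ i * v ^ j * w ^ (m + l - i - j))"
      by (rule sum.mono_neutral_left) (auto simp: e_def)
    finally show ?thesis .
  qed
  moreover have "(real i + 1) * (real i + 1 + b) * e (Suc i) j k
        + (real j + 1) * (real j + 1 + c) * e i (Suc j) k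
        + (real k + 1) * (real k + 1 + a) * e i j (Suc k) = 0"
    if n: "Suc (i + j + k) = m + l" for i j k
  proof -
    consider "i < m" | "i = m" | "i > m" by linarith
    then show ?thesis
    proof cases
      case 1
      then obtain s where s: "m - i = Suc s" "m - Suc i = s" "i + Suc s = m"
        by (metis Suc_diff_Suc add_diff_inverse_nat less_imp_le_nat not_less)
      have "(real j + 1) * (real j + 1 + c) * e i (Suc j) k + (real k + 1) * (real k + 1 + a) * e i j (Suc k)
          = f (Suc s) * ((real j + 1) * (real j + 1 + c) * E (Suc s) (Suc j) k
              + (real k + 1) * (real k + 1 + a) * E (Suc s) j (Suc k))"
        using 1 s by (simp add: e_def algebra_simps)
      also have "\<dots> = ((real s + 1) * (real s + 1 + \<alpha>) * f (Suc s)) * E s j k"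
        using L [of j k "Suc s"] n s by (simp add: add_ac mult_ac)
      finally have "(real i + 1) * (real i + 1 + b) * e (Suc i) j k
        + (real j + 1) * (real j + 1 + c) * e i (Suc j) k
        + (real k + 1) * (real k + 1 + a) * e i j (Suc k)
        = ((real i + 1) * (real i + 1 + b) * f s + (real s + 1) * (real s + 1 + \<alpha>) * f (Suc s)) * E s j k"
        using 1 s by (simp add: e_def distrib_right)
      then show ?thesis
        unfolding f_def by (simp only: hjac_coeff_recurrence [OF s(3)] mult_zero_left)
    next
      case 2
      have "(real j + 1) * (real j + 1 + c) * E 0 (Suc j) k + (real k + 1) * (real k + 1 + a)
          * E 0 j (Suc k) = 0"
        using L [of j k 0] n 2 by simp
      then have "f 0 * ((real j + 1) * (real j + 1 + c) * E 0 (Suc j) k + (real k + 1) * (real k + 1 + a)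
          * E 0 j (Suc k)) = 0"
        by simp
      then show ?thesis using 2 by (simp add: e_def distrib_left mult_ac)
    next
      case 3
      then show ?thesis by (simp add: e_def)
    qed
  qed
  ultimately show ?thesis unfolding harmonic_form_def \<alpha>_def by blast
qed

section \<open>Exchanging two variables\<close>

lemma pochhammer_neg_of_nat:
  assumes "i \<le> n"
  shows "poch (- real n) i = (-1) ^ i * fact n / fact (n - i)"
proof -
  have "(fact n :: real) = fact (n - i) * poch (real n - real i + 1) i"
    using pochhammer_product [of "n - i" n "1 :: real"] assms
    by (simp add: pochhammer_fact [symmetric] of_nat_diff add_ac)
  then show ?thesis by (simp add: pochhammer_minus)
qed

lemma pochhammer_neg_of_nat_eq_0: "n < i \<Longrightarrow> poch (- real n) i = 0"
  by (simp add: pochhammer_of_nat_eq_0_iff)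

text \<open>
For \<open>k \<le> p\<close> the symbol \<open>(-N + k)\<^bsub>m-k\<^esub>\<close> contains the factor \<open>0\<close>, for \<open>k > p\<close> the symbol \<open>(-p)\<^sub>k\<close>
does. This makes the Racah polynomials vanish at index pairs that the exchanges do not reach.
\<close>

lemma terminating_4F3_eq_0:
  assumes "p \<le> N" "N < m"
  shows "terminating_4F3 m a (- real p) c u v (- real N) = 0"
  unfolding terminating_4F3_def
proof (rule sum.neutral, rule ballI)
  fix k assume "k \<in> {..m}"
  show "poch (- real m) k * poch a k * poch (- real p) k * poch c k / fact k
        * poch (u + real k) (m - k) * poch (v + real k) (m - k)
        * poch (- real N + real k) (m - k) = 0"
  proof (cases "k \<le> p")
    case True
    then have "- real N + real k = - real (N - k)" using assms by (simp add: of_nat_diff)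
    then have "poch (- real N + real k) (m - k) = 0"
      using pochhammer_neg_of_nat_eq_0 [of "N - k" "m - k"] assms True by simp
    then show ?thesis by simp
  next
    case False
    then show ?thesis by (simp add: pochhammer_neg_of_nat_eq_0)
  qed
qed

text \<open>
The coefficient read off on the face \<open>v = 0\<close>; the \<open>\<^sub>4F\<^sub>3\<close> terminates by the last indices \<open>p\<close> and \<open>l\<close> of
the two bases.
\<close>

definition swap_coeff_last :: "nat \<Rightarrow> nat \<Rightarrow> nat \<Rightarrow> real \<Rightarrow> real \<Rightarrow> real \<Rightarrow> real" where
  "swap_coeff_last k p l a b c =
     (let N = k + p; m = N - l in
      (-1) ^ k * poch (c + 1) k * poch (a + 1) p / (fact k * fact p)
      * (fact m / (poch (c + 1) l * poch (a + 1) l * poch (real l + a + c + 1) l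
           * poch (2 * real l + a + c + 2) m))
      * terminating_4F3 l (real l + a + c + 1) (- real p) (real p + a + b + 1)
          (a + 1) (real N + a + b + c + 2) (- real N))"

text \<open>
The same coefficient read off on the face \<open>u = 0\<close>; here the \<open>\<^sub>4F\<^sub>3\<close> terminates by the first
indices \<open>k\<close> and \<open>k + p - l\<close>.
\<close>

definition swap_coeff_first :: "nat \<Rightarrow> nat \<Rightarrow> nat \<Rightarrow> real \<Rightarrow> real \<Rightarrow> real \<Rightarrow> real" where
  "swap_coeff_first k p l a b c =
     (let N = k + p; m = N - l in
      (-1) ^ k * poch (b + 1) p * poch (a + 1) p
      / (poch (b + 1) m * poch (a + 1) l * fact k * poch (real l + a + c + 1) l
           * poch (2 * real l + a + c + 2) m)
      * terminating_4F3 k (- (real N + real p + a + b + 1)) (- real m) (- (real l + real N + a + c + 1))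
          (- 2 * real N - a - b - c - 1) (- a - real N) (- real N))"

text \<open>
The basis with the variables in the order \<open>v, u\<close> (exponents \<open>c, b\<close>) is expanded in the basis with
the order \<open>u, v\<close> (exponents \<open>b, c\<close>). The third variable \<open>w\<close> with exponent \<open>a\<close> stands for the sum of
all later variables.
\<close>

definition swap_identity :: "(nat \<Rightarrow> nat \<Rightarrow> nat \<Rightarrow> real \<Rightarrow> real \<Rightarrow> real \<Rightarrow> real) \<Rightarrow> bool" where
  "swap_identity C \<longleftrightarrow> (\<forall>k p a b c u v w. a > -1 \<longrightarrow> b > -1 \<longrightarrow> c > -1 \<longrightarrow>
     hjac k (a + b + 2 * real p + 1) c (u + w) v * hjac p a b w u
     = (\<Sum>l\<le>k + p. C k p l a b c * (hjac (k + p - l) (a + c + 2 * real l + 1) b (v + w) u * hjac l a c w v)))"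

lemma swap_identity_from_face:
  assumes "a > -1" "b > -1" "c > -1"
    and face: "(\<forall>u w. hjac k (a + b + 2 * real p + 1) c (u + w) 0 * hjac p a b w u
     = (\<Sum>l\<le>k + p. C l * (hjac (k + p - l) (a + c + 2 * real l + 1) b (0 + w) u * hjac l a c w 0)))
     \<or> (\<forall>v w. hjac k (a + b + 2 * real p + 1) c (0 + w) v * hjac p a b w 0
     = (\<Sum>l\<le>k + p. C l * (hjac (k + p - l) (a + c + 2 * real l + 1) b (v + w) 0 * hjac l a c w v)))"
  shows "hjac k (a + b + 2 * real p + 1) c (u + w) v * hjac p a b w u
     = (\<Sum>l\<le>k + p. C l * (hjac (k + p - l) (a + c + 2 * real l + 1) b (v + w) u * hjac l a c w v))"
proof -
  define Q where "Q u v w = hjac k (a + b + 2 * real p + 1) c (u + w) v * hjac p a b w u" for u v w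
  define P where "P l u v w = hjac (k + p - l) (a + c + 2 * real l + 1) b (v + w) u * hjac l a c w v"
      for l u v w
  define D where "D u v w = Q u v w + (-1) * (\<Sum>l\<in>{..k + p}. C l * P l u v w)" for u v w
  have Q: "harmonic_form (k + p) b c a Q"
    unfolding Q_def
    using harmonic_form_swap [OF harmonic_form_hjac_product [of k p c b a]] by simp
  have "harmonic_form (k + p) b c a (P l)" if "l \<le> k + p" for l
    unfolding P_def
    using harmonic_form_hjac_product [of "k + p - l" l b c a] that by simp
  then have D: "harmonic_form (k + p) b c a D"
    unfolding D_def by (intro harmonic_form_lincomb Q harmonic_form_sum) auto
  from face have "D u v w = 0"
  proof
    assume "\<forall>u w. hjac k (a + b + 2 * real p + 1) c (u + w) 0 * hjac p a b w u
     = (\<Sum>l\<le>k + p. C l * (hjac (k + p - l) (a + c + 2 * real l + 1) b (0 + w) u * hjac l a c w 0))"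
    then have "D u 0 w = 0" for u w unfolding D_def Q_def P_def by simp
    then show ?thesis by (rule harmonic_form_zero_on_face [OF D assms(3)])
  next
    assume "\<forall>v w. hjac k (a + b + 2 * real p + 1) c (0 + w) v * hjac p a b w 0
     = (\<Sum>l\<le>k + p. C l * (hjac (k + p - l) (a + c + 2 * real l + 1) b (v + w) 0 * hjac l a c w v))"
    then have "D 0 v w = 0" for v w unfolding D_def Q_def P_def by simp
    then show ?thesis by (rule harmonic_form_zero_on_face [OF harmonic_form_swap [OF D] assms(2)])
  qed
  then show ?thesis by (simp add: D_def Q_def P_def)
qed

lemma pochhammer_nonzero: "x > 0 \<Longrightarrow> poch x n \<noteq> (0 :: real)"
  using pochhammer_pos [of x n] by simp

lemma pochhammer_diagonal_pos: "x > -1 \<Longrightarrow> poch (real l + x) l > (0 :: real)"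
  by (cases l) (auto intro!: pochhammer_pos)

lemma pochhammer_diagonal_nonzero: "x > -1 \<Longrightarrow> poch (real l + x) l \<noteq> 0"
  using pochhammer_diagonal_pos [of x l] by simp

text \<open>
On the face \<open>v = 0\<close> the form \<open>hjac p a b w u\<close> is a combination of \<open>w\<^sup>i (w + u)\<^bsup>p-i\<^esup>\<close>, and
\<open>power_eq_sum_hjac_shifted\<close> applies to each term after \<open>w\<^sup>i\<close> has been split off.
\<close>

lemma swap_identity_last: "swap_identity swap_coeff_last"
  unfolding swap_identity_def
proof (intro allI impI)
  fix k p :: nat and a b c u v w :: real
  assume a: "a > -1" and b: "b > -1" and c: "c > -1"
  define N where "N = k + p"
  \<comment> \<open>\<open>g\<close> expands \<open>hjac p a b w u\<close> in powers of \<open>w\<close>, \<open>B i\<close> expands \<open>w\<^sup>i (w + u)\<^bsup>N-i\<^esup>\<close> in the face forms.\<close>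
  define g where "g i = poch (real p + a + b + 1) i * poch (a + real i + 1) (p - i) / (fact i
      * fact (p - i))" for i
  define B where "B i l = fact (N - i) / fact (l - i) * poch (real N + a + b + c + 2 + real i) (l - i)
     / (poch (real l + a + c + 1 + real i) (l - i) * poch (2 * real l + a + c + 2) (N - l))" for i l
  define K where "K = (-1) ^ k * poch (c + 1) k / fact k"
  have coeff: "swap_coeff_last k p l a b c * ((-1) ^ l * poch (c + 1) l / fact l)
      = K * (\<Sum>i\<le>l. if i \<le> p then g i * (-1) ^ i * B i l else 0)" if l: "l \<le> N" for l
  proof -
    define V where "V = real N + a + b + c + 2"
    \<comment> \<open>the factor by which the \<open>i\<close>-th term of the expansion differs from the \<open>i\<close>-th term of the \<open>\<^sub>4F\<^sub>3\<close>\<close>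
    define Z where "Z = poch (a + 1) p * fact (N - l) / (fact p * (poch (a + 1) l * poch (real l + a + c + 1) l
           * poch (2 * real l + a + c + 2) (N - l))) * (-1) ^ l / fact l"
    define t where "t i = poch (- real l) i * poch (real l + a + c + 1) i * poch (- real p) i
        * poch (real p + a + b + 1) i / fact i
        * poch (a + 1 + real i) (l - i) * poch (V + real i) (l - i)
        * poch (- real N + real i) (l - i)" for i
    have T: "Z * t i = (if i \<le> p then g i * (-1) ^ i * B i l else 0)" if i: "i \<le> l" for i
    proof (cases "i \<le> p")
      case True
      have e1: "poch (- real l) i = (-1) ^ i * fact l / fact (l - i)"
        by (rule pochhammer_neg_of_nat [OF i])
      have e2: "poch (- real p) i = (-1) ^ i * fact p / fact (p - i)"
        by (rule pochhammer_neg_of_nat [OF True])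
      have e3: "poch (- real N + real i) (l - i) = (-1) ^ (l - i) * fact (N - i) / fact (N - l)"
        using pochhammer_neg_of_nat [of "l - i" "N - i"] i l by (simp add: of_nat_diff)
      have e4: "poch (a + 1) p = poch (a + 1) i * poch (a + real i + 1) (p - i)"
        using pochhammer_product [of i p "a + 1"] True by (simp add: add_ac)
      have e5: "poch (a + 1) l = poch (a + 1) i * poch (a + 1 + real i) (l - i)"
        using pochhammer_product [of i l "a + 1"] i by (simp add: add_ac)
      have e6: "poch (real l + a + c + 1) l
          = poch (real l + a + c + 1) i * poch (real l + a + c + 1 + real i) (l - i)"
        using pochhammer_product [of i l "real l + a + c + 1"] i by simp
      have e7: "(-1 :: real) ^ l = (-1) ^ i * (-1) ^ (l - i)" using i by (simp flip: power_add)
      have n1: "poch (a + 1) i \<noteq> 0" by (rule pochhammer_nonzero) (use a in simp)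
      have n2: "poch (a + 1 + real i) (l - i) \<noteq> 0" by (rule pochhammer_nonzero) (use a in simp)
      have n3: "poch (real l + a + c + 1) i \<noteq> 0"
        using pochhammer_diagonal_nonzero [of "a + c + 1" l] a c unfolding e6 [unfolded add.assoc]
            by (simp add: add.assoc e6 [unfolded add.assoc])
      show ?thesis
        unfolding Z_def t_def g_def B_def V_def [symmetric] e1 e2 e3 e4 e5 e6 e7
        using True n1 n2 n3 by (simp add: minus_one_power_cancel mult_ac)
    next
      case False
      then show ?thesis by (simp add: t_def pochhammer_neg_of_nat_eq_0)
    qed
    have n4: "poch (c + 1) l \<noteq> 0" by (rule pochhammer_nonzero) (use c in simp)
    have "swap_coeff_last k p l a b c * ((-1) ^ l * poch (c + 1) l / fact l)
        = K * (Z * (\<Sum>i\<le>l. t i))"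
      unfolding swap_coeff_last_def Let_def N_def [symmetric] terminating_4F3_def V_def [symmetric] t_def
          [symmetric] K_def Z_def
      using n4 by (simp add: mult_ac)
    also have "Z * (\<Sum>i\<le>l. t i) = (\<Sum>i\<le>l. if i \<le> p then g i * (-1) ^ i * B i l else 0)"
      unfolding sum_distrib_left by (intro sum.cong refl T) simp
    finally show ?thesis .
  qed
  show "hjac k (a + b + 2 * real p + 1) c (u + w) v * hjac p a b w u
     = (\<Sum>l\<le>k + p. swap_coeff_last k p l a b c * (hjac (k + p - l) (a + c + 2 * real l + 1) b (v + w) u
         * hjac l a c w v))"
  proof (rule swap_identity_from_face [OF a b c], rule disjI1, intro allI)
    fix u w
    define H where "H l = hjac (N - l) (a + c + 2 * real l + 1) b w u" for l
    have exp: "(w + u) ^ (N - i) * w ^ i = (\<Sum>l\<in>{i..N}. B i l * (w ^ l * H l))" if i: "i \<le> p" for i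
    proof -
      have iN: "i \<le> N" using i by (simp add: N_def)
      have "(w + u) ^ (N - i) * w ^ i = (\<Sum>j\<le>N - i. fact (N - i) / fact j * poch (real (N - i) + (a + c + 2
          * real i + 1) + b + 1) j
      / (poch ((a + c + 2 * real i + 1) + real j) j * poch ((a + c + 2 * real i + 1) + 2 * real j
          + 1) (N - i - j))
      * w ^ j * hjac (N - i - j) ((a + c + 2 * real i + 1) + 2 * real j) b w u * w ^ i)"
        unfolding sum_distrib_right [symmetric]
        by (subst power_eq_sum_hjac_shifted [of "a + c + 2 * real i + 1" w u "N - i" b]) (use a c in simp_all)
      also have "\<dots> = (\<Sum>l\<in>{i..N}. B i l * (w ^ l * H l))"
      proof (rule sum.reindex_bij_witness [where i = "\<lambda>l. l - i" and j = "\<lambda>j. j + i"])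
        fix j assume "j \<in> {..N - i}"
        then have j: "j + i \<le> N" using iN by auto
        have q: "real (N - i) + (a + c + 2 * real i + 1) + b + 1 = real N + a + b + c + 2 + real i"
          "(a + c + 2 * real i + 1) + real j = real (j + i) + a + c + 1 + real i"
          "(a + c + 2 * real i + 1) + 2 * real j + 1 = 2 * real (j + i) + a + c + 2"
          "(a + c + 2 * real i + 1) + 2 * real j = a + c + 2 * real (j + i) + 1"
          "j + i - i = j" "N - i - j = N - (j + i)"
          using iN by (simp_all add: of_nat_diff)
        show "B i (j + i) * (w ^ (j + i) * H (j + i)) = fact (N - i) / fact j * poch (real (N - i) + (a
            + c + 2 * real i + 1) + b + 1) j
      / (poch ((a + c + 2 * real i + 1) + real j) j * poch ((a + c + 2 * real i + 1) + 2 * real j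
          + 1) (N - i - j))
      * w ^ j * hjac (N - i - j) ((a + c + 2 * real i + 1) + 2 * real j) b w u * w ^ i"
          unfolding q B_def H_def by (simp add: power_add add_ac mult_ac)
      qed (use iN in auto)
      finally show ?thesis .
    qed
    have "hjac k (a + b + 2 * real p + 1) c (u + w) 0 * hjac p a b w u
        = K * (\<Sum>i\<le>p. g i * (-1) ^ i * ((w + u) ^ (N - i) * w ^ i))"
    proof -
      have "(u + w) ^ k * hjac p a b w u = (\<Sum>i\<le>p. g i * (-1) ^ i * ((w + u) ^ (N - i) * w ^ i))"
        unfolding hjac_sum_form sum_distrib_left
      proof (intro sum.cong refl)
        fix i assume "i \<in> {..p}"
        then have "N - i = k + (p - i)" by (simp add: N_def)
        then have "(w + u) ^ (N - i) = (u + w) ^ k * (w + u) ^ (p - i)"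
          by (simp add: power_add add.commute)
        then show "(u + w) ^ k * (poch (real p + a + b + 1) i * poch (a + real i + 1) (p - i)
           / (fact i * fact (p - i)) * (- w) ^ i * (w + u) ^ (p - i))
           = g i * (-1) ^ i * ((w + u) ^ (N - i) * w ^ i)"
          unfolding g_def power_minus [of w i] by (simp add: mult_ac)
      qed
      then show ?thesis unfolding hjac_at_t_zero K_def by (simp add: mult_ac)
    qed
    also have "(\<Sum>i\<le>p. g i * (-1) ^ i * ((w + u) ^ (N - i) * w ^ i))
        = (\<Sum>i\<le>p. \<Sum>l\<in>{i..N}. g i * (-1) ^ i * B i l * (w ^ l * H l))"
      by (intro sum.cong refl) (simp only: exp sum_distrib_left mult.assoc atMost_iff)
    also have "\<dots> = (\<Sum>i\<le>N. \<Sum>l\<le>N. if i \<le> p \<and> i \<le> l then g i * (-1) ^ i * B i l * (w ^ l * H l) else 0)"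
    proof (rule sum.mono_neutral_cong_left)
      fix i assume "i \<in> {..p}"
      then show "(\<Sum>l\<in>{i..N}. g i * (-1) ^ i * B i l * (w ^ l * H l)) = (\<Sum>l\<le>N. if i \<le> p \<and> i \<le> l then g i
          * (-1) ^ i * B i l * (w ^ l * H l) else 0)"
        by (intro sum.mono_neutral_cong_left) auto
    qed (auto simp: N_def)
    also have "\<dots> = (\<Sum>l\<le>N. \<Sum>i\<le>N. if i \<le> p \<and> i \<le> l then g i * (-1) ^ i * B i l * (w ^ l * H l) else 0)"
      by (rule sum.swap)
    also have "\<dots> = (\<Sum>l\<le>N. (\<Sum>i\<le>l. if i \<le> p then g i * (-1) ^ i * B i l else 0) * (w ^ l * H l))"
      unfolding sum_distrib_right by (intro sum.cong refl sum.mono_neutral_cong_right) auto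
    also have "K * \<dots> = (\<Sum>l\<le>N. (swap_coeff_last k p l a b c * ((-1) ^ l * poch (c + 1) l / fact l))
        * (w ^ l * H l))"
      unfolding sum_distrib_left by (intro sum.cong refl) (simp only: coeff atMost_iff mult.assoc)
    also have "\<dots> = (\<Sum>l\<le>k + p. swap_coeff_last k p l a b c *
         (hjac (k + p - l) (a + c + 2 * real l + 1) b (0 + w) u * hjac l a c w 0))"
      unfolding N_def H_def hjac_at_t_zero by (intro sum.cong refl) (simp add: mult_ac)
    finally show "hjac k (a + b + 2 * real p + 1) c (u + w) 0 * hjac p a b w u =
          (\<Sum>l\<le>k + p. swap_coeff_last k p l a b c *
         (hjac (k + p - l) (a + c + 2 * real l + 1) b (0 + w) u * hjac l a c w 0))" .
  qed
qed

text \<open>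
On the face \<open>u = 0\<close> the form \<open>hjac k \<alpha> c w v * w\<^sup>p\<close> is a combination of \<open>w\<^bsup>p+i\<^esup> (w + v)\<^bsup>k-i\<^esup>\<close>, and
\<open>power_eq_sum_hjac\<close> applies to \<open>w\<^bsup>p+i\<^esup>\<close>. The sum is reversed by \<open>i = k - r\<close> so that it terminates
at \<open>min k (k + p - l)\<close>.
\<close>

lemma swap_identity_first: "swap_identity swap_coeff_first"
  unfolding swap_identity_def
proof (intro allI impI)
  fix k p :: nat and a b c u v w :: real
  assume a: "a > -1" and b: "b > -1" and c: "c > -1"
  define N where "N = k + p"
  define \<alpha> where "\<alpha> = a + b + 2 * real p + 1"
  \<comment> \<open>\<open>g\<close> expands \<open>hjac k \<alpha> c w v\<close> in powers of \<open>w\<close>, \<open>B r\<close> expands \<open>w\<^bsup>N-r\<^esup>\<close> in the face forms.\<close>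
  define g where "g i = poch (real k + \<alpha> + c + 1) i * poch (\<alpha> + real i + 1) (k - i) / (fact i
      * fact (k - i))" for i
  define B where "B r l = (-1) ^ l * fact (N - r) * poch (a + 1) (N - r)
      / (fact (N - r - l) * poch (a + 1) l * poch (a + c + 1 + real l) l
          * poch (a + c + 2 * real l + 2) (N - r - l))" for r l
  define K where "K = (-1) ^ p * poch (b + 1) p / fact p"
  have coeff: "swap_coeff_first k p l a b c * ((-1) ^ (N - l) * poch (b + 1) (N - l) / fact (N - l))
      = K * (\<Sum>r\<le>k. if r \<le> N - l then g (k - r) * (-1) ^ (k - r) * B r l else 0)" if l: "l \<le> N" for l
  proof -
    define m where "m = N - l"
    have lm: "N = l + m" using l by (simp add: m_def)
    define V where "V = - 2 * real N - a - b - c - 1"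
    define Z where "Z = (-1) ^ l * poch (a + 1) p * fact p / (poch (a + 1) l * fact k * fact m
        * poch (real l + a + c + 1) l
           * poch (2 * real l + a + c + 2) m)"
    define t where "t r = poch (- real k) r * poch (- (real N + real p + a + b + 1)) r * poch (- real m) r
        * poch (- (real l + real N + a + c + 1)) r / fact r
        * poch (V + real r) (k - r) * poch (- a - real N + real r) (k - r)
        * poch (- real N + real r) (k - r)" for r
    have T: "Z * t r = (if r \<le> m then g (k - r) * (-1) ^ (k - r) * B r l else 0)" if r: "r \<le> k" for r
    proof (cases "r \<le> m")
      case True
      define j where "j = m - r"
      have m: "m = r + j" using True by (simp add: j_def)
      define q where "q = k - r"
      have k: "k = r + q" using r by (simp add: q_def)
      have lj: "l + j = q + p" using lm m k by (simp add: N_def)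
      have Nr: "N - r = q + p" "q + p - l = j" using k m lm by (auto simp: N_def)
      have rl: "real l + real j = real q + real p" using lj by (metis of_nat_add)
      have rN: "real N = real r + real q + real p" by (simp add: N_def k)
      have e1: "poch (- real k) r = (-1) ^ r * fact k / fact q"
        using pochhammer_neg_of_nat [OF r] by (simp add: q_def)
      have e2: "poch (- (real N + real p + a + b + 1)) r = (-1) ^ r * poch (\<alpha> + real q + 1) r"
        by (subst pochhammer_minus) (simp add: rN \<alpha>_def algebra_simps)
      have e3: "poch (- real m) r = (-1) ^ r * fact m / fact j"
        using pochhammer_neg_of_nat [OF True] by (simp add: j_def)
      have e4: "poch (- (real l + real N + a + c + 1)) r = (-1) ^ r * poch (a + c + 2 * real l + 2 + real j) r"
      proof -
        have "real l + real N + a + c + 1 - real r + 1 = a + c + 2 * real l + 2 + real j"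
          using rl rN by simp
        then show ?thesis by (simp only: pochhammer_minus)
      qed
      have e5: "poch (V + real r) q = (-1) ^ q * poch (real k + \<alpha> + c + 1) q"
      proof -
        have "V + real r = - (2 * real N + a + b + c + 1 - real r)" by (simp add: V_def)
        moreover have "2 * real N + a + b + c + 1 - real r - real q + 1 = real k + \<alpha> + c + 1"
          by (simp add: rN \<alpha>_def k)
        ultimately show ?thesis by (simp only: pochhammer_minus)
      qed
      have e6: "poch (- a - real N + real r) q = (-1) ^ q * poch (a + 1 + real p) q"
      proof -
        have "- a - real N + real r = - (a + real q + real p)" by (simp add: rN)
        moreover have "a + real q + real p - real q + 1 = a + 1 + real p" by simp
        ultimately show ?thesis by (simp only: pochhammer_minus)
      qed
      have e7: "poch (- real N + real r) q = (-1) ^ q * fact (q + p) / fact p"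
      proof -
        have "- real N + real r = - real (q + p)" by (simp add: rN)
        then show ?thesis using pochhammer_neg_of_nat [of q "q + p"] by simp
      qed
      have e8: "poch (a + 1) (q + p) = poch (a + 1) p * poch (a + 1 + real p) q"
        using pochhammer_product [of p "q + p" "a + 1"] by (simp add: add_ac)
      have e9: "poch (a + c + 2 * real l + 2) m
          = poch (a + c + 2 * real l + 2) j * poch (a + c + 2 * real l + 2 + real j) r"
        using pochhammer_product [of j m "a + c + 2 * real l + 2"] m by simp
      have c1: "real l + a + c + 1 = a + c + 1 + real l" "2 * real l + a + c + 2 = a + c + 2 * real l + 2"
          by simp_all
      have n: "poch (a + c + 2 * real l + 2 + real j) r \<noteq> 0" by (rule pochhammer_nonzero) (use a c in simp)
      have kq: "k - (k - r) = r" "k - r = q" "k - q = r" using k by auto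
      show ?thesis
        unfolding Z_def t_def g_def B_def kq Nr e1 e2 e3 e4 e5 e6 e7 e8 c1 e9
        using True n by (simp add: minus_one_power_cancel mult_ac)
    next
      case False
      then show ?thesis by (simp add: t_def pochhammer_neg_of_nat_eq_0)
    qed
    have n4: "poch (b + 1) m \<noteq> 0" by (rule pochhammer_nonzero) (use b in simp)
    have sg: "(-1 :: real) ^ k * (-1) ^ m = (-1) ^ p * (-1) ^ l"
    proof -
      have "even (k + m) = even (p + l)" using lm by (auto simp: N_def) (metis even_add)+
      then have "(-1 :: real) ^ (k + m) = (-1) ^ (p + l)" by (auto simp: minus_one_power_iff)
      then show ?thesis by (simp add: power_add)
    qed
    have "swap_coeff_first k p l a b c * ((-1) ^ m * poch (b + 1) m / fact m)
        = ((-1) ^ k * (-1) ^ m) * (poch (b + 1) p * poch (a + 1) p / (poch (a + 1) l * fact k * fact m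
            * poch (real l + a + c + 1) l
           * poch (2 * real l + a + c + 2) m) * (\<Sum>r\<le>k. t r))"
      unfolding swap_coeff_first_def Let_def N_def [symmetric] m_def [symmetric] terminating_4F3_def V_def
          [symmetric] t_def [symmetric]
      using n4 by (simp add: mult_ac)
    also have "\<dots> = K * (Z * (\<Sum>r\<le>k. t r))"
      unfolding sg K_def Z_def by simp
    also have "Z * (\<Sum>r\<le>k. t r) = (\<Sum>r\<le>k. if r \<le> m then g (k - r) * (-1) ^ (k - r) * B r l else 0)"
      unfolding sum_distrib_left by (intro sum.cong refl T) simp
    finally show ?thesis unfolding m_def .
  qed
  show "hjac k (a + b + 2 * real p + 1) c (u + w) v * hjac p a b w u
     = (\<Sum>l\<le>k + p. swap_coeff_first k p l a b c * (hjac (k + p - l) (a + c + 2 * real l + 1) b (v + w) u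
         * hjac l a c w v))"
  proof (rule swap_identity_from_face [OF a b c], rule disjI2, intro allI)
    fix v w
    define H where "H l = hjac l a c w v" for l
    have exp: "w ^ (N - r) * (w + v) ^ r = (\<Sum>l\<in>{..N - r}. B r l * ((v + w) ^ (N - l) * H l))"
        if r: "r \<le> k" for r
    proof -
      have "w ^ (N - r) * (w + v) ^ r = (\<Sum>l\<le>N - r. B r l * (w + v) ^ (N - r - l) * hjac l a c w v * (w
          + v) ^ r)"
        unfolding sum_distrib_right [symmetric] B_def
        by (subst power_eq_sum_hjac [OF a c, of w "N - r" v]) simp
      also have "\<dots> = (\<Sum>l\<in>{..N - r}. B r l * ((v + w) ^ (N - l) * H l))"
      proof (intro sum.cong refl)
        fix l assume "l \<in> {..N - r}"
        then have "N - l = (N - r - l) + r" using r by (simp add: N_def)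
        then show "B r l * (w + v) ^ (N - r - l) * hjac l a c w v * (w + v) ^ r
            = B r l * ((v + w) ^ (N - l) * H l)"
          by (simp add: H_def power_add add.commute mult_ac)
      qed
      finally show ?thesis .
    qed
    have "hjac k (a + b + 2 * real p + 1) c (0 + w) v * hjac p a b w 0
        = K * (\<Sum>r\<le>k. g (k - r) * (-1) ^ (k - r) * (w ^ (N - r) * (w + v) ^ r))"
    proof -
      have "hjac k \<alpha> c w v * w ^ p = (\<Sum>i\<le>k. g i * (-1) ^ i * (w ^ (p + i) * (w + v) ^ (k - i)))"
        unfolding hjac_sum_form sum_distrib_right
        by (intro sum.cong refl) (simp add: g_def power_minus [of w] power_add mult_ac)
      also have "\<dots> = (\<Sum>r\<le>k. g (k - r) * (-1) ^ (k - r) * (w ^ (N - r) * (w + v) ^ r))"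
        by (rule sum.reindex_bij_witness [where i = "\<lambda>i. k - i" and j
            = "\<lambda>i. k - i"]) (auto simp: N_def add.commute)
      finally show ?thesis unfolding hjac_at_t_zero K_def \<alpha>_def by (simp add: mult_ac)
    qed
    also have "(\<Sum>r\<le>k. g (k - r) * (-1) ^ (k - r) * (w ^ (N - r) * (w + v) ^ r))
        = (\<Sum>r\<le>k. \<Sum>l\<in>{..N - r}. g (k - r) * (-1) ^ (k - r) * B r l * ((v + w) ^ (N - l) * H l))"
      by (intro sum.cong refl) (simp add: exp sum_distrib_left mult_ac)
    also have "\<dots> = (\<Sum>r\<le>k. \<Sum>l\<le>N. if r \<le> N - l then g (k - r) * (-1) ^ (k - r) * B r l * ((v + w) ^ (N - l)
        * H l) else 0)"
      by (intro sum.cong refl sum.mono_neutral_cong_left) (auto simp: N_def)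
    also have "\<dots> = (\<Sum>l\<le>N. \<Sum>r\<le>k. if r \<le> N - l then g (k - r) * (-1) ^ (k - r) * B r l * ((v + w) ^ (N - l)
        * H l) else 0)"
      by (rule sum.swap)
    also have "\<dots> = (\<Sum>l\<le>N. (\<Sum>r\<le>k. if r \<le> N - l then g (k - r) * (-1) ^ (k - r) * B r l else 0) * ((v
        + w) ^ (N - l) * H l))"
      unfolding sum_distrib_right by (intro sum.cong refl) auto
    also have "K * \<dots> = (\<Sum>l\<le>N. (swap_coeff_first k p l a b c * ((-1) ^ (N - l) * poch (b + 1) (N - l)
        / fact (N - l))) * ((v + w) ^ (N - l) * H l))"
      unfolding sum_distrib_left by (intro sum.cong refl) (simp only: coeff atMost_iff mult.assoc)
    also have "\<dots> = (\<Sum>l\<le>k + p. swap_coeff_first k p l a b c *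
         (hjac (k + p - l) (a + c + 2 * real l + 1) b (v + w) 0 * hjac l a c w v))"
      unfolding N_def H_def hjac_at_t_zero by (intro sum.cong refl) (simp add: mult_ac)
    finally show "hjac k (a + b + 2 * real p + 1) c (0 + w) v * hjac p a b w 0 =
          (\<Sum>l\<le>k + p. swap_coeff_first k p l a b c *
         (hjac (k + p - l) (a + c + 2 * real l + 1) b (v + w) 0 * hjac l a c w v))" .
  qed
qed

section \<open>Jacobi polynomials on the unit interval\<close>

text \<open>
The value \<open>0\<close> outside the open interval lets the stick-breaking integrals below run over the
whole line.
\<close>

definition beta_weight :: "real \<Rightarrow> real \<Rightarrow> real \<Rightarrow> real" where
  "beta_weight a k t = indicator {0<..<1} t * (t powr k * (1 - t) powr a)"

lemma beta_weight_measurable [measurable]: "beta_weight a k \<in> borel_measurable borel"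
  unfolding beta_weight_def by measurable

lemma beta_weight_integral_monomial:
  assumes a: "a > -1" and k: "k > -1"
  shows "has_bochner_integral lborel (\<lambda>t. (1 - t) ^ i * t ^ j * beta_weight a k t)
           (Beta (k + 1 + real j) (a + 1 + real i))"
proof -
  define f where "f t = t powr (k + 1 + real j - 1) * (1 - t) powr (a + 1 + real i - 1)" for t :: real
  have eq: "(1 - t) ^ i * t ^ j * beta_weight a k t = indicator {0<..<1} t * f t" for t
  proof (cases "t \<in> {0<..<1}")
    case True
    then show ?thesis
      by (simp add: beta_weight_def f_def powr_add powr_realpow mult_ac)
  qed (simp add: beta_weight_def)
  have "(f has_integral Beta (k + 1 + real j) (a + 1 + real i)) {0<..<1}"
    unfolding f_def has_integral_Icc_iff_Ioo [symmetric]
    by (rule has_integral_Beta_real) (use a k in auto)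
  then have "integral\<^sup>N lborel (\<lambda>t. ennreal (indicator {0<..<1} t * f t))
      = ennreal (Beta (k + 1 + real j) (a + 1 + real i))"
    using nn_integral_has_integral_lebesgue [of "{0<..<1}" f] by (simp add: f_def)
  moreover have "Beta (k + 1 + real j) (a + 1 + real i) \<ge> 0"
    unfolding Beta_def using a k by (intro divide_nonneg_pos mult_nonneg_nonneg less_imp_le Gamma_real_pos) auto
  ultimately have "has_bochner_integral lborel (\<lambda>t. indicator {0<..<1} t * f t) (Beta (k + 1 + real j) (a
      + 1 + real i))"
    by (intro has_bochner_integral_nn_integral) (auto simp: f_def)
  then show ?thesis by (simp only: eq)
qed

lemma Gamma_add_nat: "z > 0 \<Longrightarrow> Gamma (z + real n) = Gamma z * poch z n" for z :: real
proof -
  assume z: "z > 0"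
  then have "z \<notin> \<int>\<^sub>\<le>\<^sub>0" by (auto simp: nonpos_Ints_def)
  then show "Gamma (z + real n) = Gamma z * poch z n"
    using pochhammer_Gamma [of z n] Gamma_real_pos [OF z] by simp
qed

text \<open>
Each term is a Beta integral, and the Gamma factors combine so that only the \<open>n\<close>-th difference of
a polynomial of degree \<open>q\<close> is left.
\<close>

lemma hjac_moment:
  assumes a: "a > -1" and k: "k > -1" and q: "q \<le> n"
  shows "has_bochner_integral lborel (\<lambda>t. hjac n a k (1 - t) t * (1 - t) ^ q * beta_weight a k t)
     (if q = n then (-1) ^ n * Gamma (k + 1 + real n) * Gamma (a + 1 + real n) / Gamma (a + k + 2 + 2
         * real n) else 0)"
proof -
  define G where "G = Gamma (k + 1 + real n) * Gamma (a + 1 + real n) / (fact n * Gamma (a + k + 2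
      + real n + real q))"
  have "has_bochner_integral lborel
     (\<lambda>t. \<Sum>s\<le>n. hjac_coeff n a k s * ((1 - t) ^ (s + q) * t ^ (n - s) * beta_weight a k t))
     (\<Sum>s\<le>n. hjac_coeff n a k s * Beta (k + 1 + real (n - s)) (a + 1 + real (s + q)))"
    by (intro has_bochner_integral_sum has_bochner_integral_mult_right beta_weight_integral_monomial a k)
  also have "(\<lambda>t. \<Sum>s\<le>n. hjac_coeff n a k s * ((1 - t) ^ (s + q) * t ^ (n - s) * beta_weight a k t))
      = (\<lambda>t. hjac n a k (1 - t) t * (1 - t) ^ q * beta_weight a k t)"
    unfolding hjac_def hjac_coeff_def
    by (rule ext) (simp add: sum_distrib_right sum_distrib_left power_add mult_ac)
  also have "(\<Sum>s\<le>n. hjac_coeff n a k s * Beta (k + 1 + real (n - s)) (a + 1 + real (s + q)))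
      = (\<Sum>s\<le>n. G * ((-1) ^ s * real (n choose s) * poch (a + 1 + real s) q))"
  proof (intro sum.cong refl)
    fix s assume "s \<in> {..n}"
    then have s: "s \<le> n" by simp
    have "Gamma (k + 1 + real n) = Gamma (k + 1 + real (n - s)) * poch (k + 1 + real (n - s)) s"
    proof -
      have "Gamma (k + 1 + real n) = Gamma (k + 1 + real (n - s) + real s)" using s by (simp add: add_ac)
      also have "\<dots> = Gamma (k + 1 + real (n - s)) * poch (k + 1 + real (n - s)) s"
        by (rule Gamma_add_nat) (use k in simp)
      finally show ?thesis .
    qed
    moreover have "Gamma (a + 1 + real n) = Gamma (a + 1 + real s) * poch (a + 1 + real s) (n - s)"
    proof -
      have "Gamma (a + 1 + real n) = Gamma (a + 1 + real s + real (n - s))" using s by (simp add: add_ac)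
      also have "\<dots> = Gamma (a + 1 + real s) * poch (a + 1 + real s) (n - s)"
        by (rule Gamma_add_nat) (use a in simp)
      finally show ?thesis .
    qed
    moreover have "Gamma (a + 1 + real (s + q)) = Gamma (a + 1 + real s) * poch (a + 1 + real s) q"
      using Gamma_add_nat [of "a + 1 + real s" q] a by (simp add: add_ac)
    moreover have "real (n choose s) = fact n / (fact s * fact (n - s))"
      using s by (subst binomial_fact) auto
    moreover have e: "k + 1 + real (n - s) + (a + 1 + real (s + q)) = a + k + 2 + real n + real q"
      using s by (simp add: of_nat_diff)
    ultimately show "hjac_coeff n a k s * Beta (k + 1 + real (n - s)) (a + 1 + real (s + q))
      = G * ((-1) ^ s * real (n choose s) * poch (a + 1 + real s) q)"
      unfolding hjac_coeff_def Beta_def G_def e by (simp add: mult_ac)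
  qed
  also have "\<dots> = G * (if q = n then (-1) ^ n * fact n else 0)"
    unfolding sum_distrib_left [symmetric] using alternating_binomial_pochhammer_sum [OF q, of "a + 1"] by simp
  also have "\<dots> = (if q = n then (-1) ^ n * Gamma (k + 1 + real n) * Gamma (a + 1 + real n) / Gamma (a + k
      + 2 + 2 * real n) else 0)"
  proof (cases "q = n")
    case True
    have e: "a + k + 2 + real n + real n = a + k + 2 + 2 * real n" by simp
    show ?thesis unfolding G_def True e by simp
  qed simp
  finally show ?thesis .
qed

text \<open>
Expand the factor of lower degree in powers of \<open>1 - t\<close>; only its leading coefficient survives.
\<close>

lemma hjac_orthogonal_le:
  assumes a: "a > -1" and k: "k > -1" and m: "m \<le> n"
  shows "has_bochner_integral lborel (\<lambda>t. hjac n a k (1 - t) t * hjac m a k (1 - t) t * beta_weight a k t)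
     (if m = n then poch (real n + a + k + 1) n * Gamma (k + 1 + real n) * Gamma (a + 1 + real n)
         / (fact n * Gamma (a + k + 2 + 2 * real n)) else 0)"
proof -
  define g where "g q = poch (real m + a + k + 1) q * poch (a + real q + 1) (m - q)
        / (fact q * fact (m - q)) * (-1) ^ q" for q
  define I where "I q = (if q = n then (-1) ^ n * Gamma (k + 1 + real n) * Gamma (a + 1 + real n)
      / Gamma (a + k + 2 + 2 * real n) else 0)" for q
  have "has_bochner_integral lborel
     (\<lambda>t. \<Sum>q\<le>m. g q * (hjac n a k (1 - t) t * (1 - t) ^ q * beta_weight a k t)) (\<Sum>q\<le>m. g q * I q)"
    unfolding I_def
    by (intro has_bochner_integral_sum has_bochner_integral_mult_right hjac_moment a k) (use m in auto)
  also have "(\<lambda>t. \<Sum>q\<le>m. g q * (hjac n a k (1 - t) t * (1 - t) ^ q * beta_weight a k t))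
    = (\<lambda>t. hjac n a k (1 - t) t * hjac m a k (1 - t) t * beta_weight a k t)"
  proof
    fix t
    have "hjac m a k (1 - t) t = (\<Sum>q\<le>m. g q * (1 - t) ^ q)"
      unfolding hjac_sum_form g_def power_minus [of "1 - t"] by (simp add: mult_ac)
    then show "(\<Sum>q\<le>m. g q * (hjac n a k (1 - t) t * (1 - t) ^ q * beta_weight a k t))
      = hjac n a k (1 - t) t * hjac m a k (1 - t) t * beta_weight a k t"
      by (simp add: sum_distrib_right sum_distrib_left mult_ac)
  qed
  also have "(\<Sum>q\<le>m. g q * I q) = (if m = n then g n * I n else 0)"
  proof (cases "m = n")
    case True
    have "(\<Sum>q\<le>m. g q * I q) = (\<Sum>q\<in>{n}. g q * I q)"
      by (rule sum.mono_neutral_right) (auto simp: True I_def)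
    then show ?thesis using True by simp
  next
    case False
    then show ?thesis using m by (auto simp: I_def intro!: sum.neutral)
  qed
  also have "\<dots> = (if m = n then poch (real n + a + k + 1) n * Gamma (k + 1 + real n) * Gamma (a + 1 + real n)
         / (fact n * Gamma (a + k + 2 + 2 * real n)) else 0)"
    by (auto simp: g_def I_def simp flip: power_mult_distrib)
  finally show ?thesis .
qed

lemma hjac_orthogonal:
  assumes a: "a > -1" and k: "k > -1"
  shows "(\<integral>t. hjac n a k (1 - t) t * hjac m a k (1 - t) t * beta_weight a k t \<partial>lborel)
     = (if m = n then poch (real n + a + k + 1) n * Gamma (k + 1 + real n) * Gamma (a + 1 + real n)
         / (fact n * Gamma (a + k + 2 + 2 * real n)) else 0)"
proof (cases "m \<le> n")
  case True
  then show ?thesis using hjac_orthogonal_le [OF a k True] by (intro has_bochner_integral_integral_eq)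
next
  case False
  then have n: "n \<le> m" by simp
  have "has_bochner_integral lborel (\<lambda>t. hjac n a k (1 - t) t * hjac m a k (1 - t) t * beta_weight a k t) 0"
    using hjac_orthogonal_le [OF a k n] False by (simp add: mult_ac)
  then show ?thesis using False by (simp add: has_bochner_integral_integral_eq)
qed

lemma hjac_product_integrable:
  assumes a: "a > -1" and k: "k > -1"
  shows "integrable lborel (\<lambda>t. hjac n \<alpha> \<beta> (1 - t) t * hjac m \<alpha>' \<beta>' (1 - t) t * beta_weight a k t)"
proof -
  have "integrable lborel (\<lambda>t. \<Sum>s\<le>n. \<Sum>r\<le>m. hjac_coeff n \<alpha> \<beta> s * hjac_coeff m \<alpha>' \<beta>' r
      * ((1 - t) ^ (s + r) * t ^ ((n - s) + (m - r)) * beta_weight a k t))"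
    by (intro Bochner_Integration.integrable_sum integrable_mult_right has_bochner_integral_integrable)
      (use beta_weight_integral_monomial [OF a k] in \<open>blast intro: integrable.intros\<close>)
  also have "(\<lambda>t. \<Sum>s\<le>n. \<Sum>r\<le>m. hjac_coeff n \<alpha> \<beta> s * hjac_coeff m \<alpha>' \<beta>' r
      * ((1 - t) ^ (s + r) * t ^ ((n - s) + (m - r)) * beta_weight a k t))
      = (\<lambda>t. hjac n \<alpha> \<beta> (1 - t) t * hjac m \<alpha>' \<beta>' (1 - t) t * beta_weight a k t)"
    unfolding hjac_def hjac_coeff_def [symmetric] sum_product
    unfolding sum_distrib_right by (rule ext) (simp only: power_add mult_ac)
  finally show ?thesis .
qed

section \<open>Stick-breaking integration over the simplex\<close>

text \<open>
The length of stick left before the \<open>j\<close>-th break.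
\<close>

definition rest :: "(nat \<Rightarrow> real) \<Rightarrow> nat \<Rightarrow> real" where
  "rest x j = 1 - (\<Sum>i=1..<j. x i)"

lemma rest_1 [simp]: "rest x (Suc 0) = 1"
  by (simp add: rest_def)

lemma rest_Suc: "j \<ge> 1 \<Longrightarrow> rest x (Suc j) = rest x j - x j"
  by (simp add: rest_def)

lemma rest_upd: "j \<le> i \<Longrightarrow> rest (x(i := y)) j = rest x j"
  unfolding rest_def by (intro arg_cong2 [where f = "(-)"] sum.cong) auto

text \<open>
The density in \<open>x\<close> obtained when the break ratios \<open>t\<^sub>j = x\<^sub>j / (1 - x\<^sub>1 - \<dots> - x\<^bsub>j-1\<^esub>)\<close> are
independent with densities \<open>f\<^sub>j\<close>. The quotients by \<open>rest x j\<close> are the Jacobian.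
\<close>

definition stick :: "(nat \<Rightarrow> real \<Rightarrow> real) \<Rightarrow> nat \<Rightarrow> (nat \<Rightarrow> real) \<Rightarrow> real" where
  "stick f d x = (\<Prod>j=1..d. if rest x j > 0 then f j (x j / rest x j) / rest x j else 0)"

lemma stick_Suc:
  "stick f (Suc d) x = stick f d x * (if rest x (Suc d) > 0 then f (Suc d) (x (Suc d) / rest x (Suc d))
      / rest x (Suc d) else 0)"
  by (simp add: stick_def)

lemma stick_upd: "d < i \<Longrightarrow> stick f d (x(i := y)) = stick f d x"
  unfolding stick_def by (intro prod.cong refl) (simp add: rest_upd)

lemma rest_measurable:
  assumes "j \<le> Suc d"
  shows "(\<lambda>x. rest x j) \<in> borel_measurable (Pi\<^sub>M {1..d} (\<lambda>_. lborel))"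
  unfolding rest_def
  by (intro borel_measurable_diff borel_measurable_const borel_measurable_sum)
    (use assms in \<open>auto intro!: measurable_component_singleton [where M = "\<lambda>_. lborel", simplified]\<close>)

lemma stick_measurable:
  assumes f: "\<And>j. f j \<in> borel_measurable borel"
  shows "stick f d \<in> borel_measurable (Pi\<^sub>M {1..d} (\<lambda>_. lborel))"
  unfolding stick_def
proof (intro borel_measurable_prod)
  fix j assume j: "j \<in> {1..d}"
  have [measurable]: "(\<lambda>x. rest x j) \<in> borel_measurable (Pi\<^sub>M {1..d} (\<lambda>_. lborel))"
    using j by (intro rest_measurable) auto
  have [measurable]: "(\<lambda>x. x j :: real) \<in> borel_measurable (Pi\<^sub>M {1..d} (\<lambda>_. lborel))"
    using measurable_component_singleton [OF j, of "\<lambda>_. lborel :: real measure"] by simp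
  note f [measurable]
  show "(\<lambda>x. if rest x j > 0 then f j (x j / rest x j) / rest x j else 0) \<in> borel_measurable (Pi\<^sub>M {1..d}
      (\<lambda>_. lborel))"
    by measurable
qed

text \<open>
If every \<open>f\<^sub>j\<close> lives on the open unit interval, the product lives on the interior of the simplex.
\<close>

lemma stick_nonzero:
  assumes zero: "\<And>j t. t \<notin> {0<..<1} \<Longrightarrow> f j t = 0" and nz: "stick f d x \<noteq> 0"
  shows "\<forall>j\<in>{1..d}. rest x j > 0 \<and> 0 < x j \<and> x j < rest x j" "rest x (Suc d) > 0"
proof -
  have *: "rest x j > 0 \<and> 0 < x j \<and> x j < rest x j" if "j \<in> {1..d}" for j
  proof -
    have "(if rest x j > 0 then f j (x j / rest x j) / rest x j else 0) \<noteq> 0"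
      using nz that by (auto simp: stick_def)
    then have r: "rest x j > 0" and "f j (x j / rest x j) \<noteq> 0" by (auto split: if_splits)
    with zero have "x j / rest x j \<in> {0<..<1}" by blast
    with r show ?thesis by (auto simp: field_simps)
  qed
  then show "\<forall>j\<in>{1..d}. rest x j > 0 \<and> 0 < x j \<and> x j < rest x j" by blast
  show "rest x (Suc d) > 0"
    using * [of d] by (cases "d = 0") (auto simp: rest_Suc)
qed

interpretation lborel_product: product_sigma_finite "\<lambda>_::nat. lborel :: real measure"
  by standard

text \<open>
Integrate the last variable first; it enters only the last factor.
\<close>

lemma stick_nn_integral:
  assumes f: "\<And>j. f j \<in> borel_measurable borel"
    and zero: "\<And>j t. t \<notin> {0<..<1} \<Longrightarrow> f j t = 0"
  shows "(\<integral>\<^sup>+x. ennreal \<bar>stick f d x\<bar> \<partial>Pi\<^sub>M {1..d} (\<lambda>_. lborel)) = (\<Prod>j=1..d. \<integral>\<^sup>+t. ennreal \<bar>f j t\<bar> \<partial>lborel)"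
proof (induction d)
  case 0
  then show ?case by (simp add: stick_def PiM_empty)
next
  case (Suc d)
  note f [measurable]
  have ins: "{1..Suc d} = insert (Suc d) {1..d}" by auto
  have [measurable]: "stick f (Suc d) \<in> borel_measurable (Pi\<^sub>M (insert (Suc d) {1..d}) (\<lambda>_. lborel))"
    using stick_measurable [of f "Suc d", OF f] by (simp only: ins)
  have [measurable]: "stick f d \<in> borel_measurable (Pi\<^sub>M {1..d} (\<lambda>_. lborel))"
    by (rule stick_measurable [OF f])
  have meas: "(\<lambda>x. ennreal \<bar>stick f (Suc d) x\<bar>) \<in> borel_measurable (Pi\<^sub>M (insert (Suc d) {1..d}) (\<lambda>_. lborel))"
    by measurable
  have "(\<integral>\<^sup>+x. ennreal \<bar>stick f (Suc d) x\<bar> \<partial>Pi\<^sub>M {1..Suc d} (\<lambda>_. lborel))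
      = (\<integral>\<^sup>+x. (\<integral>\<^sup>+y. ennreal \<bar>stick f (Suc d) (x(Suc d := y))\<bar> \<partial>lborel) \<partial>Pi\<^sub>M {1..d} (\<lambda>_. lborel))"
    unfolding ins by (rule lborel_product.product_nn_integral_insert [OF _ _ meas]) auto
  also have "\<dots> = (\<integral>\<^sup>+x. ennreal \<bar>stick f d x\<bar> * (\<integral>\<^sup>+t. ennreal \<bar>f (Suc d) t\<bar> \<partial>lborel) \<partial>Pi\<^sub>M {1..d} (\<lambda>_.
      lborel))"
  proof (rule nn_integral_cong)
    fix x :: "nat \<Rightarrow> real"
    show "(\<integral>\<^sup>+y. ennreal \<bar>stick f (Suc d) (x(Suc d := y))\<bar> \<partial>lborel)
        = ennreal \<bar>stick f d x\<bar> * (\<integral>\<^sup>+t. ennreal \<bar>f (Suc d) t\<bar> \<partial>lborel)"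
    proof (cases "stick f d x = 0")
      case True
      then show ?thesis by (simp add: stick_Suc stick_upd)
    next
      case False
      define s where "s = rest x (Suc d)"
      have s: "s > 0" unfolding s_def by (rule stick_nonzero(2) [OF zero False])
      have "(\<integral>\<^sup>+y. ennreal \<bar>stick f (Suc d) (x(Suc d := y))\<bar> \<partial>lborel)
          = (\<integral>\<^sup>+y. ennreal \<bar>stick f d x\<bar> * ennreal \<bar>f (Suc d) (y / s) / s\<bar> \<partial>lborel)"
      proof (rule nn_integral_cong)
        fix y
        have "stick f (Suc d) (x(Suc d := y)) = stick f d x * (f (Suc d) (y / s) / s)"
          using s by (simp add: stick_Suc stick_upd rest_upd s_def)
        then show "ennreal \<bar>stick f (Suc d) (x(Suc d := y))\<bar>
            = ennreal \<bar>stick f d x\<bar> * ennreal \<bar>f (Suc d) (y / s) / s\<bar>"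
          by (simp only: abs_mult ennreal_mult [OF abs_ge_zero abs_ge_zero])
      qed
      also have "\<dots> = ennreal \<bar>stick f d x\<bar> * (\<integral>\<^sup>+y. ennreal \<bar>f (Suc d) (y / s) / s\<bar> \<partial>lborel)"
        by (intro nn_integral_cmult) measurable
      also have "(\<integral>\<^sup>+y. ennreal \<bar>f (Suc d) (y / s) / s\<bar> \<partial>lborel)
          = ennreal \<bar>s\<bar> * (\<integral>\<^sup>+y. ennreal \<bar>f (Suc d) ((0 + s * y) / s) / s\<bar> \<partial>lborel)"
        by (rule nn_integral_real_affine) (use s in auto)
      also have "\<dots> = (\<integral>\<^sup>+y. ennreal \<bar>s\<bar> * ennreal \<bar>f (Suc d) ((0 + s * y) / s) / s\<bar> \<partial>lborel)"
        by (rule nn_integral_cmult [symmetric]) measurable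
      also have "\<dots> = (\<integral>\<^sup>+t. ennreal \<bar>f (Suc d) t\<bar> \<partial>lborel)"
      proof (rule nn_integral_cong)
        fix t
        have "\<bar>s\<bar> * \<bar>f (Suc d) ((0 + s * t) / s) / s\<bar> = \<bar>f (Suc d) t\<bar>"
          using s by simp
        then show "ennreal \<bar>s\<bar> * ennreal \<bar>f (Suc d) ((0 + s * t) / s) / s\<bar> = ennreal \<bar>f (Suc d) t\<bar>"
          by (metis abs_ge_zero ennreal_mult)
      qed
      finally show ?thesis .
    qed
  qed
  also have "\<dots> = (\<integral>\<^sup>+x. ennreal \<bar>stick f d x\<bar> \<partial>Pi\<^sub>M {1..d} (\<lambda>_. lborel)) * (\<integral>\<^sup>+t. ennreal \<bar>f (Suc d) t\<bar>
      \<partial>lborel)"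
    by (rule nn_integral_multc) measurable
  finally show ?case using Suc by simp
qed

lemma stick_integrable:
  assumes f: "\<And>j. f j \<in> borel_measurable borel"
    and zero: "\<And>j t. t \<notin> {0<..<1} \<Longrightarrow> f j t = 0"
    and int: "\<And>j. j \<in> {1..d} \<Longrightarrow> integrable lborel (f j)"
  shows "integrable (Pi\<^sub>M {1..d} (\<lambda>_. lborel)) (stick f d)"
proof (rule integrableI_bounded)
  show "stick f d \<in> borel_measurable (Pi\<^sub>M {1..d} (\<lambda>_. lborel))"
    by (rule stick_measurable [OF f])
  have fin: "(\<integral>\<^sup>+t. ennreal \<bar>f j t\<bar> \<partial>lborel) < \<infinity>" if "j \<in> {1..d}" for j
    using int [OF that] by (simp add: integrable_iff_bounded)
  have "(\<Prod>j\<in>S. \<integral>\<^sup>+t. ennreal \<bar>f j t\<bar> \<partial>lborel) < \<infinity>" if "finite S" "S \<subseteq> {1..d}" for S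
    using that by (induction S rule: finite_induct) (use fin in \<open>auto simp: ennreal_mult_less_top\<close>)
  then have "(\<Prod>j=1..d. \<integral>\<^sup>+t. ennreal \<bar>f j t\<bar> \<partial>lborel) < \<infinity>"
    by simp
  then show "(\<integral>\<^sup>+x. ennreal (norm (stick f d x)) \<partial>Pi\<^sub>M {1..d} (\<lambda>_. lborel)) < \<infinity>"
    using stick_nn_integral [of f d, OF f zero] by simp
qed

lemma stick_integral:
  assumes f: "\<And>j. f j \<in> borel_measurable borel"
    and zero: "\<And>j t. t \<notin> {0<..<1} \<Longrightarrow> f j t = 0"
    and int: "\<And>j. j \<in> {1..d} \<Longrightarrow> integrable lborel (f j)"
  shows "integral\<^sup>L (Pi\<^sub>M {1..d} (\<lambda>_. lborel)) (stick f d) = (\<Prod>j=1..d. \<integral>t. f j t \<partial>lborel)"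
  using int
proof (induction d)
  case 0
  then show ?case by (simp add: stick_def PiM_empty lebesgue_integral_count_space_finite)
next
  case (Suc d)
  have ins: "{1..Suc d} = insert (Suc d) {1..d}" by auto
  have "integrable (Pi\<^sub>M (insert (Suc d) {1..d}) (\<lambda>_. lborel)) (stick f (Suc d))"
    using stick_integrable [of f "Suc d", OF f zero Suc.prems] unfolding ins by simp
  then have "integral\<^sup>L (Pi\<^sub>M {1..Suc d} (\<lambda>_. lborel)) (stick f (Suc d))
      = (\<integral>x. (\<integral>y. stick f (Suc d) (x(Suc d := y)) \<partial>lborel) \<partial>Pi\<^sub>M {1..d} (\<lambda>_. lborel))"
    unfolding ins
    by (intro lborel_product.product_integral_insert) auto
  also have "\<dots> = (\<integral>x. stick f d x * (\<integral>t. f (Suc d) t \<partial>lborel) \<partial>Pi\<^sub>M {1..d} (\<lambda>_. lborel))"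
  proof (rule Bochner_Integration.integral_cong [OF refl])
    fix x :: "nat \<Rightarrow> real"
    show "(\<integral>y. stick f (Suc d) (x(Suc d := y)) \<partial>lborel) = stick f d x * (\<integral>t. f (Suc d) t \<partial>lborel)"
    proof (cases "stick f d x = 0")
      case True
      then show ?thesis by (simp add: stick_Suc stick_upd)
    next
      case False
      define s where "s = rest x (Suc d)"
      have s: "s > 0" unfolding s_def by (rule stick_nonzero(2) [OF zero False])
      have "(\<integral>y. stick f (Suc d) (x(Suc d := y)) \<partial>lborel) = (\<integral>y. stick f d x * (f (Suc d) (y / s) / s) \<partial>lborel)"
        using s by (simp add: stick_Suc stick_upd rest_upd s_def)
      also have "\<dots> = stick f d x * (\<integral>y. f (Suc d) (y / s) / s \<partial>lborel)"
        by simp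
      also have "(\<integral>y. f (Suc d) (y / s) / s \<partial>lborel) = \<bar>s\<bar> *\<^sub>R (\<integral>y. f (Suc d) ((0 + s * y) / s) / s \<partial>lborel)"
        by (rule lborel_integral_real_affine) (use s in simp)
      also have "\<dots> = (\<integral>t. f (Suc d) t \<partial>lborel)"
        using s by simp
      finally show ?thesis .
    qed
  qed
  also have "\<dots> = integral\<^sup>L (Pi\<^sub>M {1..d} (\<lambda>_. lborel)) (stick f d) * (\<integral>t. f (Suc d) t \<partial>lborel)"
    by simp
  finally show ?case using Suc by simp
qed

section \<open>Orthogonality and norms on the simplex\<close>

lemma finite_multi_idx [simp]: "finite (multi_idx d n)"
proof (rule finite_subset)
  show "multi_idx d n \<subseteq> {f. \<forall>i. (i \<in> {1..d} \<longrightarrow> f i \<in> {..n}) \<and> (i \<notin> {1..d} \<longrightarrow> f i = 0)}"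
  proof (rule subsetI)
    fix f assume f: "f \<in> multi_idx d n"
    have "f i \<le> n" if "i \<in> {1..d}" for i
      using member_le_sum [of i "{1..d}" f] that f by (auto simp: multi_idx_def)
    then show "f \<in> {f. \<forall>i. (i \<in> {1..d} \<longrightarrow> f i \<in> {..n}) \<and> (i \<notin> {1..d} \<longrightarrow> f i = 0)}"
      using f by (auto simp: multi_idx_def)
  qed
  show "finite {f. \<forall>i. (i \<in> {1..d} \<longrightarrow> f i \<in> {..n}) \<and> (i \<notin> {1..d} \<longrightarrow> f i = 0)}"
    by (rule finite_set_of_finite_funs) auto
qed

text \<open>
This recursion is behind every telescoping product below: \<open>a\<^bsub>j-1\<^esub>\<close> is the outer parameter that an
exchange produces from \<open>a\<^sub>j\<close>.
\<close>

lemma simplex_jacobi_param_rec: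
  assumes "j < d"
  shows "jparam d \<kappa> \<nu> j
       = jparam d \<kappa> \<nu> (Suc j) + \<kappa> (Suc j) + 2 * real (\<nu> (Suc j)) + 1"
proof -
  have "(\<Sum>i=j+1..d+1. \<kappa> i) = \<kappa> (Suc j) + (\<Sum>i=Suc j+1..d+1. \<kappa> i)"
    using assms by (subst sum.atLeast_Suc_atMost) auto
  moreover have "(\<Sum>i=j+1..d. \<nu> i) = \<nu> (Suc j) + (\<Sum>i=Suc j+1..d. \<nu> i)"
    using assms by (subst sum.atLeast_Suc_atMost) auto
  moreover have "real (d - j) = real (d - Suc j) + 1" using assms by (simp add: of_nat_diff)
  ultimately show ?thesis unfolding simplex_jacobi_param_def by simp
qed

lemma simplex_jacobi_param_pred:
  assumes "j \<in> {1..d}"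
  shows "jparam d \<kappa> \<nu> (j - 1)
       = jparam d \<kappa> \<nu> j + \<kappa> j + 2 * real (\<nu> j) + 1"
  using assms by (cases j) (simp_all add: simplex_jacobi_param_rec)

lemma simplex_jacobi_param_last: "jparam d \<kappa> \<nu> d = \<kappa> (d + 1)"
  by (simp add: simplex_jacobi_param_def)

lemma simplex_jacobi_param_first:
  "jparam d \<kappa> \<nu> 0 = (\<Sum>i=1..d+1. \<kappa> i) + 2 * real (\<Sum>i=1..d. \<nu> i) + real d"
  by (simp add: simplex_jacobi_param_def)

lemma simplex_jacobi_param_gt:
  assumes k: "integrable_exponents d \<kappa>" and "j \<le> d"
  shows "jparam d \<kappa> \<nu> j > -1"
  using assms(2)
proof (induction rule: inc_induct)
  case base
  then show ?case using k by (simp add: simplex_jacobi_param_last)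
next
  case (step j)
  then have "\<kappa> (Suc j) > -1" using k by auto
  then show ?case using step by (simp add: simplex_jacobi_param_rec)
qed

lemma rest_ge_last:
  assumes "\<forall>i\<in>{1..d}. 0 \<le> x i" "j \<le> Suc d"
  shows "rest x (Suc d) \<le> rest x j"
  unfolding rest_def using assms by (intro diff_left_mono sum_mono2) auto

lemma unit_simplex_iff_rest:
  "x \<in> unit_simplex d \<longleftrightarrow> x \<in> {1..d} \<rightarrow>\<^sub>E UNIV \<and> (\<forall>i\<in>{1..d}. 0 \<le> x i) \<and> rest x (Suc d) \<ge> 0"
  by (auto simp: unit_simplex_def rest_def atLeastLessThanSuc_atLeastAtMost)

lemma simplex_jacobi_eq_hjac:
  assumes x: "x \<in> unit_simplex d"
  shows "simplex_jacobi d \<kappa> \<nu> x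
       = (\<Prod>j=1..d. hjac (\<nu> j) (jparam d \<kappa> \<nu> j) (\<kappa> j) (rest x (Suc j)) (x j))"
  unfolding simplex_jacobi_def rest_def [symmetric]
proof (intro prod.cong refl)
  fix j assume j: "j \<in> {1..d}"
  have x0: "\<forall>i\<in>{1..d}. 0 \<le> x i" and r: "rest x (Suc d) \<ge> 0"
    using x by (auto simp: unit_simplex_iff_rest)
  have "{1..j} \<subseteq> {1..d}" using j by auto
  then have "rest x (Suc j) \<ge> 0"
    using rest_ge_last [OF x0, of "Suc j"] j r by simp
  then have "0 \<le> x j" "x j \<le> rest x j" using j x0 by (auto simp: rest_Suc)
  then have "0 < rest x j \<or> x j = 0 \<and> rest x j = 0" by linarith
  then show "rest x j ^ \<nu> j * jacobi (\<nu> j) (jparam d \<kappa> \<nu> j) (\<kappa> j) (2 * x j / rest x j - 1)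
      = hjac (\<nu> j) (jparam d \<kappa> \<nu> j) (\<kappa> j) (rest x (Suc j)) (x j)"
    using j by (simp add: jacobi_factor_eq_hjac rest_Suc)
qed

lemma prod_ratio_telescope_from:
  fixes F :: "nat \<Rightarrow> real"
  assumes "\<And>j. m \<le> j \<Longrightarrow> j \<le> d \<Longrightarrow> F j \<noteq> 0" "m \<le> d"
  shows "(\<Prod>j=Suc m..d. F j / F (j - 1)) = F d / F m"
  using assms(2,1)
proof (induction rule: dec_induct)
  case base
  then show ?case by simp
next
  case (step k)
  then show ?case by simp
qed

lemma prod_ratio_telescope:
  fixes F :: "nat \<Rightarrow> real"
  assumes "\<And>j. j \<le> d \<Longrightarrow> F j \<noteq> 0"
  shows "(\<Prod>j=1..d. F j / F (j - 1)) = F d / F 0"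
  using prod_ratio_telescope_from [of 0 d F] assms by simp

text \<open>
The exponent of \<open>1 - t\<^sub>j\<close> in the inner product of \<open>P\<^sub>\<mu>\<close> and \<open>P\<^bsub>\<mu>'\<^esub>\<close>: half of \<open>2|\<mu>\<^bsup>j+1\<^esup>|\<close> comes from
either factor.
\<close>

definition mixed_param :: "nat \<Rightarrow> (nat \<Rightarrow> real) \<Rightarrow> (nat \<Rightarrow> nat) \<Rightarrow> (nat \<Rightarrow> nat) \<Rightarrow> nat \<Rightarrow> real" where
  "mixed_param d \<kappa> \<mu> \<mu>' j = (jparam d \<kappa> \<mu> j + jparam d \<kappa> \<mu>' j) / 2"

definition stick_factor :: "nat \<Rightarrow> (nat \<Rightarrow> real) \<Rightarrow> (nat \<Rightarrow> nat) \<Rightarrow> (nat \<Rightarrow> nat) \<Rightarrow> nat \<Rightarrow> real \<Rightarrow> real" where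
  "stick_factor d \<kappa> \<mu> \<mu>' j t =
     hjac (\<mu> j) (jparam d \<kappa> \<mu> j) (\<kappa> j) (1 - t) t
   * hjac (\<mu>' j) (jparam d \<kappa> \<mu>' j) (\<kappa> j) (1 - t) t
   * beta_weight (mixed_param d \<kappa> \<mu> \<mu>' j) (\<kappa> j) t"

lemma hjac_measurable: "(\<lambda>t. hjac n a k (1 - t) t) \<in> borel_measurable borel"
  unfolding hjac_def by measurable

lemma stick_factor_measurable: "stick_factor d \<kappa> \<mu> \<mu>' j \<in> borel_measurable borel"
  unfolding stick_factor_def by (intro borel_measurable_times hjac_measurable beta_weight_measurable)

lemma stick_factor_zero: "t \<notin> {0<..<1} \<Longrightarrow> stick_factor d \<kappa> \<mu> \<mu>' j t = 0"
  by (simp add: stick_factor_def beta_weight_def)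

lemma stick_factor_interior:
  assumes r: "r > 0" and x: "0 < x" "x < r"
  shows "r ^ (\<mu> j + \<mu>' j) * r powr (\<kappa> j + 1) * r powr mixed_param d \<kappa> \<mu> \<mu>' j * (stick_factor d \<kappa> \<mu> \<mu>' j (x
      / r) / r)
       = hjac (\<mu> j) (jparam d \<kappa> \<mu> j) (\<kappa> j) (r - x) x
         * hjac (\<mu>' j) (jparam d \<kappa> \<mu>' j) (\<kappa> j) (r - x) x
         * x powr \<kappa> j * (r - x) powr mixed_param d \<kappa> \<mu> \<mu>' j"
proof -
  define t where "t = x / r"
  define E where "E = mixed_param d \<kappa> \<mu> \<mu>' j"
  have t: "0 < t" "t < 1" and xt: "x = r * t" "r - x = r * (1 - t)" using r x by (auto simp: t_def field_simps)
  have "(r - x) powr E = r powr E * (1 - t) powr E"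
    unfolding xt(2) using r t by (simp only: powr_mult less_imp_le diff_gt_0_iff_gt)
  moreover have "x powr \<kappa> j = r powr \<kappa> j * t powr \<kappa> j"
    unfolding xt(1) using r t by (simp only: powr_mult less_imp_le)
  moreover have "hjac m a k (r - x) x = r ^ m * hjac m a k (1 - t) t" for m a k
    unfolding xt(2) unfolding xt(1) by (rule hjac_scale)
  moreover have "r powr (\<kappa> j + 1) = r powr \<kappa> j * r" using r by (simp add: powr_add)
  ultimately show ?thesis
    unfolding stick_factor_def t_def [symmetric] E_def [symmetric] beta_weight_def
    using r t by (simp add: power_add mult_ac)
qed

text \<open>
The equation holds at every point, also on the boundary, because \<open>0 powr a = 0\<close> makes the weight
vanish there. In the interior the powers of the remaining lengths telescope.
\<close>

lemma simplex_integrand_eq_stick: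
  assumes d: "d \<ge> 1" and x: "x \<in> {1..d} \<rightarrow>\<^sub>E UNIV"
  shows "indicator (unit_simplex d) x *\<^sub>R (simplex_jacobi d \<kappa> \<mu> x * simplex_jacobi d \<kappa> \<mu>' x
      * simplex_weight d \<kappa> x)
       = stick (stick_factor d \<kappa> \<mu> \<mu>') d x"
proof (cases "(\<forall>j\<in>{1..d}. 0 < x j) \<and> rest x (Suc d) > 0")
  case True
  then have x0: "\<forall>i\<in>{1..d}. 0 < x i" "\<forall>i\<in>{1..d}. 0 \<le> x i" and rd: "rest x (Suc d) > 0"
    by auto
  have xs: "x \<in> unit_simplex d" using x x0 rd by (auto simp: unit_simplex_iff_rest)
  define E where "E = mixed_param d \<kappa> \<mu> \<mu>'"
  have E: "E (j - 1) = E j + \<kappa> j + real (\<mu> j + \<mu>' j) + 1" if "j \<in> {1..d}" for j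
    unfolding E_def mixed_param_def simplex_jacobi_param_pred [OF that] by simp
  have Ed: "E d = \<kappa> (d + 1)" by (simp add: E_def mixed_param_def simplex_jacobi_param_last)
  have r: "rest x j > 0" if "j \<le> Suc d" for j
    using rest_ge_last [OF x0(2) that] rd by linarith
  \<comment> \<open>\<open>F 0 = 1\<close> because the whole stick has length \<open>1\<close>.\<close>
  define F where "F j = rest x (Suc j) powr E j" for j
  have F: "F j > 0" if "j \<le> d" for j using r [of "Suc j"] that by (simp add: F_def)
  have tel: "(\<Prod>j=1..d. F j / F (j - 1)) = rest x (Suc d) powr \<kappa> (d + 1)"
  proof -
    have "(\<Prod>j=1..d. F j / F (j - 1)) = F d / F 0"
      by (rule prod_ratio_telescope) (use F in \<open>auto dest: less_imp_neq [THEN not_sym]\<close>)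
    then show ?thesis by (simp add: F_def Ed)
  qed
  have fac: "hjac (\<mu> j) (jparam d \<kappa> \<mu> j) (\<kappa> j) (rest x (Suc j)) (x j)
         * hjac (\<mu>' j) (jparam d \<kappa> \<mu>' j) (\<kappa> j) (rest x (Suc j)) (x j) * x j powr \<kappa> j * (F j / F (j - 1))
       = (if rest x j > 0 then stick_factor d \<kappa> \<mu> \<mu>' j (x j / rest x j) / rest x j else 0)"
    if j: "j \<in> {1..d}" for j
  proof -
    have rj: "rest x j > 0" using r j by simp
    have rs: "rest x (Suc j) = rest x j - x j" using j by (simp add: rest_Suc)
    have xj: "0 < x j" "x j < rest x j" using x0 j r [of "Suc j"] rs by auto
    have Fp: "F (j - 1) = rest x j ^ (\<mu> j + \<mu>' j) * rest x j powr (\<kappa> j + 1) * rest x j powr E j"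
    proof -
      have "F (j - 1) = rest x j powr (real (\<mu> j + \<mu>' j) + (\<kappa> j + 1) + E j)"
        using j E [OF j] by (simp add: F_def add_ac)
      then show ?thesis using rj by (simp only: powr_add powr_realpow)
    qed
    have "F (j - 1) > 0" by (rule F) (use j in auto)
    then have nz: "F (j - 1) \<noteq> 0" by simp
    have "F (j - 1) * (stick_factor d \<kappa> \<mu> \<mu>' j (x j / rest x j) / rest x j)
       = hjac (\<mu> j) (jparam d \<kappa> \<mu> j) (\<kappa> j) (rest x (Suc j)) (x j)
         * hjac (\<mu>' j) (jparam d \<kappa> \<mu>' j) (\<kappa> j) (rest x (Suc j)) (x j) * x j powr \<kappa> j * F j"
    proof -
      have Fj: "F j = (rest x j - x j) powr E j" by (simp add: F_def rs)
      show ?thesis unfolding Fp Fj rs E_def by (rule stick_factor_interior [OF rj xj])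
    qed
    then have "stick_factor d \<kappa> \<mu> \<mu>' j (x j / rest x j) / rest x j
       = hjac (\<mu> j) (jparam d \<kappa> \<mu> j) (\<kappa> j) (rest x (Suc j)) (x j)
         * hjac (\<mu>' j) (jparam d \<kappa> \<mu>' j) (\<kappa> j) (rest x (Suc j)) (x j) * x j powr \<kappa> j * F j / F (j - 1)"
      using nz by (metis nonzero_mult_div_cancel_left)
    then show ?thesis using rj by (simp only: times_divide_eq_right if_True)
  qed
  have "simplex_jacobi d \<kappa> \<mu> x * simplex_jacobi d \<kappa> \<mu>' x * simplex_weight d \<kappa> x
      = (\<Prod>j=1..d. hjac (\<mu> j) (jparam d \<kappa> \<mu> j) (\<kappa> j) (rest x (Suc j)) (x j)
         * hjac (\<mu>' j) (jparam d \<kappa> \<mu>' j) (\<kappa> j) (rest x (Suc j)) (x j) * x j powr \<kappa> j * (F j / F (j - 1)))"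
    unfolding simplex_jacobi_eq_hjac [OF xs] prod.distrib tel
    by (simp add: simplex_weight_def rest_def atLeastLessThanSuc_atLeastAtMost mult_ac)
  also have "\<dots> = stick (stick_factor d \<kappa> \<mu> \<mu>') d x"
    unfolding stick_def by (intro prod.cong refl fac)
  finally show ?thesis using xs by simp
next
  case False
  have "stick (stick_factor d \<kappa> \<mu> \<mu>') d x = 0"
  proof (rule ccontr)
    assume nz: "stick (stick_factor d \<kappa> \<mu> \<mu>') d x \<noteq> 0"
    from stick_nonzero [of "stick_factor d \<kappa> \<mu> \<mu>'", OF stick_factor_zero nz] False show False by auto
  qed
  moreover have "simplex_weight d \<kappa> x = 0" if "x \<in> unit_simplex d"
  proof -
    from that False consider j where "j \<in> {1..d}" "x j = 0" | "rest x (Suc d) = 0"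
      unfolding unit_simplex_iff_rest by force
    then show ?thesis
    proof cases
      case 1
      then have "(\<Prod>i=1..d. x i powr \<kappa> i) = 0" by (intro prod_zero) auto
      then show ?thesis by (simp add: simplex_weight_def)
    next
      case 2
      then show ?thesis by (simp add: simplex_weight_def rest_def atLeastLessThanSuc_atLeastAtMost)
    qed
  qed
  ultimately show ?thesis by (auto simp: indicator_def)
qed

lemma stick_factor_integrable:
  assumes k: "integrable_exponents d \<kappa>" and j: "j \<in> {1..d}"
  shows "integrable lborel (stick_factor d \<kappa> \<mu> \<mu>' j)"
proof -
  have "mixed_param d \<kappa> \<mu> \<mu>' j > -1"
    using simplex_jacobi_param_gt [OF k, of j \<mu>] simplex_jacobi_param_gt [OF k, of j \<mu>'] j
    by (simp add: mixed_param_def)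
  then show ?thesis unfolding stick_factor_def
    using k j by (intro hjac_product_integrable) auto
qed

definition simplex_integrand :: "nat \<Rightarrow> (nat \<Rightarrow> real) \<Rightarrow> (nat \<Rightarrow> nat) \<Rightarrow> (nat \<Rightarrow> nat) \<Rightarrow> (nat \<Rightarrow> real) \<Rightarrow> real" where
  "simplex_integrand d \<kappa> \<mu> \<mu>' x =
     indicator (unit_simplex d) x *\<^sub>R (simplex_jacobi d \<kappa> \<mu> x * simplex_jacobi d \<kappa> \<mu>' x * simplex_weight d \<kappa> x)"

lemma simplex_integrand_stick:
  assumes d: "d \<ge> 1" and x: "x \<in> space (Pi\<^sub>M {1..d} (\<lambda>_. lborel))"
  shows "simplex_integrand d \<kappa> \<mu> \<mu>' x = stick (stick_factor d \<kappa> \<mu> \<mu>') d x"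
proof -
  have "x \<in> {1..d} \<rightarrow>\<^sub>E UNIV" using x by (simp add: space_PiM)
  then show ?thesis unfolding simplex_integrand_def by (rule simplex_integrand_eq_stick [OF d])
qed

lemma simplex_integrand_integrable:
  assumes d: "d \<ge> 1" and k: "integrable_exponents d \<kappa>"
  shows "integrable (Pi\<^sub>M {1..d} (\<lambda>_. lborel)) (simplex_integrand d \<kappa> \<mu> \<mu>')"
proof -
  have "integrable (Pi\<^sub>M {1..d} (\<lambda>_. lborel)) (stick (stick_factor d \<kappa> \<mu> \<mu>') d)"
    by (rule stick_integrable [OF stick_factor_measurable stick_factor_zero stick_factor_integrable [OF k]])
  then show ?thesis
    by (rule iffD2 [OF Bochner_Integration.integrable_cong, OF refl, rotated])
      (rule simplex_integrand_stick [OF d])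
qed

lemma simplex_integrand_integral:
  assumes d: "d \<ge> 1" and k: "integrable_exponents d \<kappa>"
  shows "integral\<^sup>L (Pi\<^sub>M {1..d} (\<lambda>_. lborel)) (simplex_integrand d \<kappa> \<mu> \<mu>')
       = (\<Prod>j=1..d. \<integral>t. stick_factor d \<kappa> \<mu> \<mu>' j t \<partial>lborel)"
proof -
  have "integral\<^sup>L (Pi\<^sub>M {1..d} (\<lambda>_. lborel)) (simplex_integrand d \<kappa> \<mu> \<mu>')
      = integral\<^sup>L (Pi\<^sub>M {1..d} (\<lambda>_. lborel)) (stick (stick_factor d \<kappa> \<mu> \<mu>') d)"
    by (rule Bochner_Integration.integral_cong [OF refl simplex_integrand_stick [OF d]])
  also have "\<dots> = (\<Prod>j=1..d. \<integral>t. stick_factor d \<kappa> \<mu> \<mu>' j t \<partial>lborel)"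
    by (rule stick_integral [OF stick_factor_measurable stick_factor_zero stick_factor_integrable [OF k]])
  finally show ?thesis .
qed

text \<open>
At the last place \<open>j\<close> where the indices differ, both Jacobi polynomials have the same parameters
but different degrees, so the \<open>j\<close>-th one-dimensional integral is \<open>0\<close>.
\<close>

lemma simplex_integrand_orthogonal:
  assumes d: "d \<ge> 1" and k: "integrable_exponents d \<kappa>"
    and m: "\<mu> \<in> multi_idx d n" "\<mu>' \<in> multi_idx d n" and ne: "\<mu> \<noteq> \<mu>'"
  shows "integral\<^sup>L (Pi\<^sub>M {1..d} (\<lambda>_. lborel)) (simplex_integrand d \<kappa> \<mu> \<mu>') = 0"
proof -
  define S where "S = {j \<in> {1..d}. \<mu> j \<noteq> \<mu>' j}"
  have "finite S" by (simp add: S_def)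
  moreover have "S \<noteq> {}"
  proof
    assume "S = {}"
    then have "\<mu> j = \<mu>' j" for j using m by (cases "j \<in> {1..d}") (auto simp: S_def multi_idx_def)
    then show False using ne by blast
  qed
  ultimately have "Max S \<in> S" and max: "\<And>i. i \<in> S \<Longrightarrow> i \<le> Max S" by auto
  define j where "j = Max S"
  have j: "j \<in> {1..d}" "\<mu> j \<noteq> \<mu>' j" using \<open>Max S \<in> S\<close> by (auto simp: S_def j_def)
  have tail: "\<mu> i = \<mu>' i" if "i \<in> {j + 1..d}" for i
    using max [of i] that by (fastforce simp: S_def j_def)
  have par: "jparam d \<kappa> \<mu>' j = jparam d \<kappa> \<mu> j"
    using tail by (simp add: simplex_jacobi_param_def)
  have "(\<integral>t. stick_factor d \<kappa> \<mu> \<mu>' j t \<partial>lborel) = 0"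
    unfolding stick_factor_def mixed_param_def par
    using hjac_orthogonal [of "jparam d \<kappa> \<mu> j" "\<kappa> j" "\<mu> j" "\<mu>' j"]
      simplex_jacobi_param_gt [OF k, of j \<mu>] j k by simp
  then show ?thesis
    unfolding simplex_integrand_integral [OF d k] using j by (intro prod_zero) auto
qed

definition hjac_norm_factor :: "nat \<Rightarrow> (nat \<Rightarrow> real) \<Rightarrow> (nat \<Rightarrow> nat) \<Rightarrow> nat \<Rightarrow> real" where
  "hjac_norm_factor d \<kappa> \<mu> j =
     (let a = jparam d \<kappa> \<mu> j in
       poch (a + 1) (\<mu> j) * poch (\<kappa> j + 1) (\<mu> j)
       * poch (real (\<mu> j) + a + \<kappa> j + 1) (\<mu> j) / fact (\<mu> j))"

lemma hjac_norm_factor_pos: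
  assumes k: "integrable_exponents d \<kappa>" and j: "j \<in> {1..d}"
  shows "hjac_norm_factor d \<kappa> \<mu> j > 0"
proof -
  have a: "jparam d \<kappa> \<mu> j > -1" "\<kappa> j > -1"
    using simplex_jacobi_param_gt [OF k] k j by auto
  have p: "poch (real (\<mu> j) + jparam d \<kappa> \<mu> j + \<kappa> j + 1) (\<mu> j) > 0"
    using pochhammer_diagonal_pos [of "jparam d \<kappa> \<mu> j + \<kappa> j + 1" "\<mu> j"] a by (simp only: add.assoc)
  show ?thesis unfolding hjac_norm_factor_def Let_def
    using a by (intro divide_pos_pos mult_pos_pos p pochhammer_pos) auto
qed

definition simplex_norm_const :: "nat \<Rightarrow> (nat \<Rightarrow> real) \<Rightarrow> nat \<Rightarrow> real" where
  "simplex_norm_const d \<kappa> n =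
     Gamma ((\<Sum>i=1..d+1. \<kappa> i) + real d + 1) / Gamma ((\<Sum>i=1..d+1. \<kappa> i) + 2 * real n + real d + 1)"

lemma simplex_param_sum_gt:
  assumes k: "integrable_exponents d \<kappa>"
  shows "(\<Sum>i=1..d+1. \<kappa> i) + real d + 1 > 0"
  using simplex_jacobi_param_gt [OF k, of 0 "\<lambda>_. 0"] by (simp add: simplex_jacobi_param_first)

lemma simplex_norm_const_pos:
  assumes k: "integrable_exponents d \<kappa>"
  shows "simplex_norm_const d \<kappa> n > 0"
  unfolding simplex_norm_const_def using simplex_param_sum_gt [OF k]
  by (intro divide_pos_pos Gamma_real_pos) auto

text \<open>
The Gamma factors of neighbouring one-dimensional norms cancel in pairs since
\<open>2 \<mu>\<^sub>j + a\<^sub>j + \<kappa>\<^sub>j + 1 = a\<^bsub>j-1\<^esub>\<close>. The constant depends on \<open>\<mu>\<close> only through \<open>|\<mu>|\<close>.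
\<close>

lemma jacobi_norm_sq_eq:
  assumes d: "d \<ge> 1" and k: "integrable_exponents d \<kappa>" and m: "\<mu> \<in> multi_idx d n"
  shows "jacobi_norm_sq d \<kappa> \<mu> = simplex_norm_const d \<kappa> n * (\<Prod>j=1..d. hjac_norm_factor d \<kappa> \<mu> j)"
proof -
  define a where "a = jparam d \<kappa> \<mu>"
  define F where "F j = Gamma (a j + 1)" for j
  have a: "a j > -1" if "j \<le> d" for j using simplex_jacobi_param_gt [OF k that] by (simp add: a_def)
  have F: "F j > 0" if "j \<le> d" for j using a [OF that] by (simp add: F_def Gamma_real_pos)
  have "(\<integral>t. stick_factor d \<kappa> \<mu> \<mu> j t \<partial>lborel) = hjac_norm_factor d \<kappa> \<mu> j * Gamma (\<kappa> j + 1) * (F j / F (j - 1))"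
    if j: "j \<in> {1..d}" for j
  proof -
    have aj: "a j > -1" "\<kappa> j > -1" using a k j by auto
    have e: "a j + \<kappa> j + 2 + 2 * real (\<mu> j) = a (j - 1) + 1"
      unfolding a_def simplex_jacobi_param_pred [OF j] by simp
    have "(\<integral>t. stick_factor d \<kappa> \<mu> \<mu> j t \<partial>lborel)
        = poch (real (\<mu> j) + a j + \<kappa> j + 1) (\<mu> j) * Gamma (\<kappa> j + 1 + real (\<mu> j)) * Gamma (a j + 1 + real (\<mu> j))
         / (fact (\<mu> j) * Gamma (a j + \<kappa> j + 2 + 2 * real (\<mu> j)))"
      using hjac_orthogonal [OF aj, of "\<mu> j" "\<mu> j"] by (simp add: stick_factor_def mixed_param_def a_def)
    also have "\<dots> = hjac_norm_factor d \<kappa> \<mu> j * Gamma (\<kappa> j + 1) * (F j / F (j - 1))"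
      unfolding e using aj by (simp add: Gamma_add_nat hjac_norm_factor_def Let_def F_def a_def [symmetric])
    finally show ?thesis .
  qed
  then have "integral\<^sup>L (Pi\<^sub>M {1..d} (\<lambda>_. lborel)) (simplex_integrand d \<kappa> \<mu> \<mu>)
      = (\<Prod>j=1..d. hjac_norm_factor d \<kappa> \<mu> j * Gamma (\<kappa> j + 1) * (F j / F (j - 1)))"
    unfolding simplex_integrand_integral [OF d k] by (intro prod.cong refl)
  also have "\<dots> = (\<Prod>j=1..d. hjac_norm_factor d \<kappa> \<mu> j) * (\<Prod>j=1..d. Gamma (\<kappa> j + 1)) * (F d / F 0)"
  proof -
    have "(\<Prod>j=1..d. F j / F (j - 1)) = F d / F 0"
      by (rule prod_ratio_telescope) (use F less_imp_neq [THEN not_sym] in blast)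
    then show ?thesis by (simp only: prod.distrib)
  qed
  finally have I: "integral\<^sup>L (Pi\<^sub>M {1..d} (\<lambda>_. lborel)) (simplex_integrand d \<kappa> \<mu> \<mu>)
      = (\<Prod>j=1..d. hjac_norm_factor d \<kappa> \<mu> j) * (\<Prod>j=1..d. Gamma (\<kappa> j + 1)) * (F d / F 0)" .
  have F0: "F 0 = Gamma ((\<Sum>i=1..d+1. \<kappa> i) + 2 * real n + real d + 1)"
    using m by (simp add: F_def a_def simplex_jacobi_param_first multi_idx_def)
  have "F d = Gamma (\<kappa> (d + 1) + 1)" by (simp add: F_def a_def simplex_jacobi_param_last)
  then have P: "(\<Prod>i=1..d+1. Gamma (\<kappa> i + 1)) = (\<Prod>j=1..d. Gamma (\<kappa> j + 1)) * F d" by simp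
  have Pnz: "(\<Prod>i=1..d+1. Gamma (\<kappa> i + 1)) > 0"
  proof (intro prod_pos Gamma_real_pos)
    fix i assume "i \<in> {1..d+1}"
    with k have "\<kappa> i > -1" by blast
    then show "0 < \<kappa> i + 1" by linarith
  qed
  have "jacobi_norm_sq d \<kappa> \<mu> = Gamma ((\<Sum>i=1..d+1. \<kappa> i) + real d + 1) / (\<Prod>i=1..d+1. Gamma (\<kappa> i + 1)) *
     integral\<^sup>L (Pi\<^sub>M {1..d} (\<lambda>_. lborel)) (simplex_integrand d \<kappa> \<mu> \<mu>)"
    unfolding jacobi_norm_sq_def simplex_inner_def set_lebesgue_integral_def simplex_integrand_def ..
  also have "\<dots> = simplex_norm_const d \<kappa> n * (\<Prod>j=1..d. hjac_norm_factor d \<kappa> \<mu> j)"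
  proof -
    have "G / (A * B) * (Q * A * (B / C)) = G / C * Q" if "A * B > 0" for A B C G Q :: real
      using that by (auto simp: zero_less_mult_iff)
    then show ?thesis using Pnz unfolding P I simplex_norm_const_def F0 by blast
  qed
  finally show ?thesis .
qed

lemma jacobi_norm_sq_pos:
  assumes d: "d \<ge> 1" and k: "integrable_exponents d \<kappa>" and m: "\<mu> \<in> multi_idx d n"
  shows "jacobi_norm_sq d \<kappa> \<mu> > 0"
  unfolding jacobi_norm_sq_eq [OF d k m]
  by (intro mult_pos_pos simplex_norm_const_pos [OF k] prod_pos hjac_norm_factor_pos [OF k])

lemma simplex_inner_cong:
  assumes "\<And>x. x \<in> unit_simplex d \<Longrightarrow> f x = f' x" "\<And>x. x \<in> unit_simplex d \<Longrightarrow> g x = g' x"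
  shows "simplex_inner d \<kappa> f g = simplex_inner d \<kappa> f' g'"
proof -
  have "(\<lambda>x. indicator (unit_simplex d) x *\<^sub>R (f x * g x * simplex_weight d \<kappa> x))
      = (\<lambda>x. indicator (unit_simplex d) x *\<^sub>R (f' x * g' x * simplex_weight d \<kappa> x))"
    using assms by (auto simp: indicator_def)
  then show ?thesis unfolding simplex_inner_def set_lebesgue_integral_def by simp
qed

lemma simplex_inner_expansion:
  assumes d: "d \<ge> 1" and k: "integrable_exponents d \<kappa>"
  shows "simplex_inner d \<kappa> (\<lambda>x. \<Sum>\<mu>\<in>multi_idx d n. c \<mu> * simplex_jacobi d \<kappa> \<mu> x)
           (\<lambda>x. \<Sum>\<mu>\<in>multi_idx d n. c' \<mu> * simplex_jacobi d \<kappa> \<mu> x)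
       = (\<Sum>\<mu>\<in>multi_idx d n. c \<mu> * c' \<mu> * jacobi_norm_sq d \<kappa> \<mu>)"
proof -
  define M where "M = multi_idx d n"
  define P where "P = Pi\<^sub>M {1..d} (\<lambda>_. lborel :: real measure)"
  have int: "integrable P (simplex_integrand d \<kappa> \<mu> \<mu>')" for \<mu> \<mu>'
    unfolding P_def by (rule simplex_integrand_integrable [OF d k])
  define G where "G = Gamma ((\<Sum>i=1..d+1. \<kappa> i) + real d + 1) / (\<Prod>i=1..d+1. Gamma (\<kappa> i + 1))"
  define I where "I \<mu> \<mu>' = integral\<^sup>L P (simplex_integrand d \<kappa> \<mu> \<mu>')" for \<mu> \<mu>'
  have "simplex_inner d \<kappa> (\<lambda>x. \<Sum>\<mu>\<in>M. c \<mu> * simplex_jacobi d \<kappa> \<mu> x) (\<lambda>x. \<Sum>\<mu>\<in>M. c' \<mu> * simplex_jacobi d \<kappa> \<mu> x)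
      = G * (\<integral>x. (\<Sum>\<mu>\<in>M. \<Sum>\<mu>'\<in>M. c \<mu> * c' \<mu>' * simplex_integrand d \<kappa> \<mu> \<mu>' x) \<partial>P)"
  proof -
    have "indicator (unit_simplex d) x *\<^sub>R ((\<Sum>\<mu>\<in>M. c \<mu> * simplex_jacobi d \<kappa> \<mu> x) * (\<Sum>\<mu>\<in>M. c' \<mu>
        * simplex_jacobi d \<kappa> \<mu> x) * simplex_weight d \<kappa> x)
       = (\<Sum>\<mu>\<in>M. \<Sum>\<mu>'\<in>M. c \<mu> * c' \<mu>' * simplex_integrand d \<kappa> \<mu> \<mu>' x)" for x
      unfolding simplex_integrand_def sum_product
      unfolding sum_distrib_left sum_distrib_right scaleR_sum_right
      by (intro sum.cong refl) simp
    then show ?thesis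
      unfolding simplex_inner_def set_lebesgue_integral_def G_def P_def by simp
  qed
  also have "(\<integral>x. (\<Sum>\<mu>\<in>M. \<Sum>\<mu>'\<in>M. c \<mu> * c' \<mu>' * simplex_integrand d \<kappa> \<mu> \<mu>' x) \<partial>P)
      = (\<Sum>\<mu>\<in>M. \<Sum>\<mu>'\<in>M. c \<mu> * c' \<mu>' * I \<mu> \<mu>')"
    unfolding I_def
    by (simp add: Bochner_Integration.integral_sum Bochner_Integration.integrable_sum int)
  also have "\<dots> = (\<Sum>\<mu>\<in>M. c \<mu> * c' \<mu> * I \<mu> \<mu>)"
  proof (intro sum.cong refl)
    fix \<mu> assume "\<mu> \<in> M"
    then have "(\<Sum>\<mu>'\<in>M. c \<mu> * c' \<mu>' * I \<mu> \<mu>') = (\<Sum>\<mu>'\<in>{\<mu>}. c \<mu> * c' \<mu>' * I \<mu> \<mu>')"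
      unfolding I_def P_def M_def using simplex_integrand_orthogonal [OF d k]
      by (intro sum.mono_neutral_right ballI finite_multi_idx) (blast, metis DiffE insertI1 mult_zero_right)
    then show "(\<Sum>\<mu>'\<in>M. c \<mu> * c' \<mu>' * I \<mu> \<mu>') = c \<mu> * c' \<mu> * I \<mu> \<mu>" by simp
  qed
  also have "G * \<dots> = (\<Sum>\<mu>\<in>M. c \<mu> * c' \<mu> * jacobi_norm_sq d \<kappa> \<mu>)"
    unfolding jacobi_norm_sq_def simplex_inner_def set_lebesgue_integral_def simplex_integrand_def
        [symmetric] G_def [symmetric] I_def P_def [symmetric]
      sum_distrib_left by (intro sum.cong refl) (simp only: mult_ac)
  finally show ?thesis by (simp add: M_def)
qed

lemma simplex_jacobi_independent:
  assumes d: "d \<ge> 1" and k: "integrable_exponents d \<kappa>"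
    and z: "\<And>x. x \<in> unit_simplex d \<Longrightarrow> (\<Sum>\<mu>\<in>multi_idx d n. c \<mu> * simplex_jacobi d \<kappa> \<mu> x) = 0"
    and m: "\<mu> \<in> multi_idx d n"
  shows "c \<mu> = 0"
proof -
  have "(\<Sum>\<mu>\<in>multi_idx d n. c \<mu> * c \<mu> * jacobi_norm_sq d \<kappa> \<mu>) = simplex_inner d \<kappa> (\<lambda>x. 0) (\<lambda>x. 0)"
    unfolding simplex_inner_expansion [OF d k, symmetric] by (rule simplex_inner_cong) (use z in auto)
  then have "(\<Sum>\<mu>\<in>multi_idx d n. c \<mu> * c \<mu> * jacobi_norm_sq d \<kappa> \<mu>) = 0"
    by (simp add: simplex_inner_def)
  then have "c \<mu> * c \<mu> * jacobi_norm_sq d \<kappa> \<mu> = 0"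
    using m less_imp_le [OF jacobi_norm_sq_pos [OF d k]]
    by (subst (asm) sum_nonneg_eq_0_iff) (blast intro: mult_nonneg_nonneg zero_le_square finite_multi_idx)+
  then show ?thesis using jacobi_norm_sq_pos [OF d k m] by simp
qed

text \<open>
Orthogonality makes the basis linearly independent, so any expansion on the simplex is the one
chosen in the definition of the coefficients.
\<close>

lemma conn_coeff_eqI:
  assumes d: "d \<ge> 1" and k: "integrable_exponents d \<kappa>" and n: "(\<Sum>i=1..d. \<nu> i) = n"
    and c0: "\<And>\<mu>. \<mu> \<notin> multi_idx d n \<Longrightarrow> c \<mu> = 0"
    and c: "\<And>x. x \<in> unit_simplex d \<Longrightarrow> simplex_jacobi d (\<kappa> \<circ> \<tau>) \<nu> (perm_point d \<tau> x)
        = (\<Sum>\<mu>\<in>multi_idx d n. c \<mu> * simplex_jacobi d \<kappa> \<mu> x)"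
  shows "conn_coeff d \<tau> \<kappa> \<nu> = c"
  unfolding conn_coeff_def n
proof (rule the_equality)
  show "(\<forall>\<mu>. \<mu> \<notin> multi_idx d n \<longrightarrow> c \<mu> = 0) \<and> (\<forall>x\<in>unit_simplex d.
       simplex_jacobi d (\<kappa> \<circ> \<tau>) \<nu> (perm_point d \<tau> x) = (\<Sum>\<mu>\<in>multi_idx d n. c \<mu> * simplex_jacobi d \<kappa> \<mu> x))"
    using c0 c by blast
  fix c' assume c': "(\<forall>\<mu>. \<mu> \<notin> multi_idx d n \<longrightarrow> c' \<mu> = 0) \<and> (\<forall>x\<in>unit_simplex d.
       simplex_jacobi d (\<kappa> \<circ> \<tau>) \<nu> (perm_point d \<tau> x) = (\<Sum>\<mu>\<in>multi_idx d n. c' \<mu> * simplex_jacobi d \<kappa> \<mu> x))"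
  show "c' = c"
  proof
    fix \<mu>
    show "c' \<mu> = c \<mu>"
    proof (cases "\<mu> \<in> multi_idx d n")
      case True
      have "c' \<mu> - c \<mu> = 0"
      proof (rule simplex_jacobi_independent [OF d k _ True, of "\<lambda>\<mu>. c' \<mu> - c \<mu>"])
        fix x assume "x \<in> unit_simplex d"
        then show "(\<Sum>\<mu>\<in>multi_idx d n. (c' \<mu> - c \<mu>) * simplex_jacobi d \<kappa> \<mu> x) = 0"
          using c c' by (simp add: left_diff_distrib sum_subtractf)
      qed
      then show ?thesis by simp
    next
      case False
      then show ?thesis using c0 c' by simp
    qed
  qed
qed

section \<open>Permuting the variables\<close>

text \<open>
Both measures give a box the product of its side lengths.
\<close>

lemma PiM_lborel_permute:
  assumes t: "\<tau> permutes I" and fin: "finite (I :: nat set)"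
  shows "distr (Pi\<^sub>M I (\<lambda>_. lborel)) (Pi\<^sub>M I (\<lambda>_. lborel)) (\<lambda>x. \<lambda>i\<in>I. x (\<tau> i))
      = Pi\<^sub>M I (\<lambda>_. lborel :: real measure)"
proof (rule lborel_product.PiM_eqI [OF fin])
  have meas: "(\<lambda>x. \<lambda>i\<in>I. x (\<tau> i)) \<in> measurable (Pi\<^sub>M I (\<lambda>_. lborel)) (Pi\<^sub>M I (\<lambda>_. lborel :: real measure))"
    by (rule measurable_restrict) (use permutes_in_image [OF t] in \<open>auto intro: measurable_component_singleton\<close>)
  fix A :: "nat \<Rightarrow> real set" assume A: "\<And>i. i \<in> I \<Longrightarrow> A i \<in> sets lborel"
  have inv: "inv \<tau> permutes I" using t by (rule permutes_inv)
  have vim: "(\<lambda>x. \<lambda>i\<in>I. x (\<tau> i)) -` Pi\<^sub>E I A \<inter> space (Pi\<^sub>M I (\<lambda>_. lborel)) = Pi\<^sub>E I (\<lambda>i. A (inv \<tau> i))"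
  proof (intro set_eqI iffI)
    fix x assume x: "x \<in> (\<lambda>x. \<lambda>i\<in>I. x (\<tau> i)) -` Pi\<^sub>E I A \<inter> space (Pi\<^sub>M I (\<lambda>_. lborel))"
    then have x1: "x (\<tau> i) \<in> A i" if "i \<in> I" for i using that by (auto simp: PiE_iff)
    have "x i \<in> A (inv \<tau> i)" if "i \<in> I" for i
      using x1 [of "inv \<tau> i"] permutes_in_image [OF inv] that permutes_inverses(1) [OF t] by simp
    then show "x \<in> Pi\<^sub>E I (\<lambda>i. A (inv \<tau> i))" using x by (auto simp: space_PiM PiE_iff)
  next
    fix x assume x: "x \<in> Pi\<^sub>E I (\<lambda>i. A (inv \<tau> i))"
    have "x (\<tau> i) \<in> A i" if "i \<in> I" for i
      using PiE_mem [OF x, of "\<tau> i"] permutes_in_image [OF t] that permutes_inverses(2) [OF t] by simp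
    then show "x \<in> (\<lambda>x. \<lambda>i\<in>I. x (\<tau> i)) -` Pi\<^sub>E I A \<inter> space (Pi\<^sub>M I (\<lambda>_. lborel))"
      using x by (auto simp: space_PiM PiE_iff)
  qed
  have "emeasure (distr (Pi\<^sub>M I (\<lambda>_. lborel)) (Pi\<^sub>M I (\<lambda>_. lborel)) (\<lambda>x. \<lambda>i\<in>I. x (\<tau> i))) (Pi\<^sub>E I A)
      = emeasure (Pi\<^sub>M I (\<lambda>_. lborel)) (Pi\<^sub>E I (\<lambda>i. A (inv \<tau> i)))"
    by (subst emeasure_distr [OF meas]) (use A fin in \<open>auto intro!: sets_PiM_I_finite simp: vim\<close>)
  also have "\<dots> = (\<Prod>i\<in>I. emeasure lborel (A (inv \<tau> i)))"
    by (rule lborel_product.emeasure_PiM [OF fin]) (use A permutes_in_image [OF inv] in simp)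
  also have "\<dots> = (\<Prod>i\<in>I. emeasure lborel (A i))"
    using prod.permute [OF inv, of "\<lambda>i. emeasure lborel (A i)"] by (simp add: o_def)
  finally show "emeasure (distr (Pi\<^sub>M I (\<lambda>_. lborel)) (Pi\<^sub>M I (\<lambda>_. lborel)) (\<lambda>x. \<lambda>i\<in>I. x (\<tau> i))) (Pi\<^sub>E I A)
      = (\<Prod>i\<in>I. emeasure lborel (A i))" .
qed simp

lemma perm_point_eq:
  assumes t: "\<tau> permutes {1..d}"
  shows "perm_point d \<tau> x = (\<lambda>i\<in>{1..d}. x (\<tau> i))"
  unfolding perm_point_def
proof (rule restrict_ext)
  fix i assume "i \<in> {1..d}"
  then have "\<tau> i \<in> {1..d}" by (simp only: permutes_in_image [OF t])
  then have "\<tau> i \<noteq> d + 1" by auto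
  then show "(x(d + 1 := 1 - (\<Sum>k=1..d. x k))) (\<tau> i) = x (\<tau> i)" by simp
qed

lemma sum_perm_point:
  assumes t: "\<tau> permutes {1..d}"
  shows "(\<Sum>i=1..d. perm_point d \<tau> x i) = (\<Sum>i=1..d. x i)"
  using sum.permute [OF t, of x] by (simp add: perm_point_eq [OF t])

lemma perm_point_in_simplex:
  assumes t: "\<tau> permutes {1..d}" and x: "x \<in> {1..d} \<rightarrow>\<^sub>E UNIV"
  shows "perm_point d \<tau> x \<in> unit_simplex d \<longleftrightarrow> x \<in> unit_simplex d"
proof -
  have "(\<forall>i\<in>{1..d}. 0 \<le> perm_point d \<tau> x i) \<longleftrightarrow> (\<forall>i\<in>\<tau> ` {1..d}. 0 \<le> x i)"
    by (simp add: perm_point_eq [OF t])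
  also have "\<tau> ` {1..d} = {1..d}" by (rule permutes_image [OF t])
  finally have "(\<forall>i\<in>{1..d}. 0 \<le> perm_point d \<tau> x i) \<longleftrightarrow> (\<forall>i\<in>{1..d}. 0 \<le> x i)" .
  moreover have "perm_point d \<tau> x \<in> {1..d} \<rightarrow>\<^sub>E UNIV" by (simp add: perm_point_def)
  ultimately show ?thesis using x unfolding unit_simplex_def mem_Collect_eq sum_perm_point [OF t] by blast
qed

lemma simplex_weight_permute:
  assumes t: "\<tau> permutes {1..d}"
  shows "simplex_weight d (\<kappa> \<circ> \<tau>) (perm_point d \<tau> x) = simplex_weight d \<kappa> x"
proof -
  have "\<tau> (d + 1) = d + 1" using t by (simp add: permutes_def)
  moreover have "(\<Prod>i=1..d. perm_point d \<tau> x i powr (\<kappa> \<circ> \<tau>) i) = (\<Prod>i=1..d. x i powr \<kappa> i)"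
    using prod.permute [OF t, of "\<lambda>i. x i powr \<kappa> i"] by (simp add: perm_point_eq [OF t] o_def)
  ultimately show ?thesis by (simp only: simplex_weight_def sum_perm_point [OF t] o_apply)
qed

text \<open>
The permutation fixes \<open>d + 1\<close>, so it only permutes coordinates of the simplex, and the weight and
the normalizing constant are symmetric.
\<close>

lemma simplex_inner_permute:
  assumes d: "d \<ge> 1" and k: "integrable_exponents d \<kappa>" and t: "\<tau> permutes {1..d}"
  shows "simplex_inner d \<kappa> (\<lambda>x. simplex_jacobi d (\<kappa> \<circ> \<tau>) \<mu> (perm_point d \<tau> x))
            (\<lambda>x. simplex_jacobi d (\<kappa> \<circ> \<tau>) \<mu>' (perm_point d \<tau> x))
       = simplex_inner d (\<kappa> \<circ> \<tau>) (simplex_jacobi d (\<kappa> \<circ> \<tau>) \<mu>) (simplex_jacobi d (\<kappa> \<circ> \<tau>) \<mu>')"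
proof -
  let ?M = "Pi\<^sub>M {1..d} (\<lambda>_. lborel :: real measure)"
  have t': "\<tau> permutes {1..d+1}" by (rule permutes_subset [OF t]) auto
  have kt: "integrable_exponents d (\<kappa> \<circ> \<tau>)" using k permutes_in_image [OF t'] by simp
  have s: "(\<Sum>i=1..d+1. (\<kappa> \<circ> \<tau>) i) = (\<Sum>i=1..d+1. \<kappa> i)"
    using sum.permute [OF t', of \<kappa>] by simp
  have p: "(\<Prod>i=1..d+1. Gamma ((\<kappa> \<circ> \<tau>) i + 1)) = (\<Prod>i=1..d+1. Gamma (\<kappa> i + 1))"
    using prod.permute [OF t', of "\<lambda>i. Gamma (\<kappa> i + 1)"] by (simp add: o_def)
  have meas: "(\<lambda>x. \<lambda>i\<in>{1..d}. x (\<tau> i)) \<in> measurable ?M ?M"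
    by (rule measurable_restrict) (use permutes_in_image [OF t] in \<open>auto intro: measurable_component_singleton\<close>)
  have "integral\<^sup>L ?M (simplex_integrand d (\<kappa> \<circ> \<tau>) \<mu> \<mu>')
      = integral\<^sup>L (distr ?M ?M (\<lambda>x. \<lambda>i\<in>{1..d}. x (\<tau> i))) (simplex_integrand d (\<kappa> \<circ> \<tau>) \<mu> \<mu>')"
    by (simp only: PiM_lborel_permute [OF t finite_atLeastAtMost])
  also have "\<dots> = (\<integral>x. simplex_integrand d (\<kappa> \<circ> \<tau>) \<mu> \<mu>' (\<lambda>i\<in>{1..d}. x (\<tau> i)) \<partial>?M)"
    by (rule integral_distr [OF meas]) (rule borel_measurable_integrable [OF simplex_integrand_integrable
        [OF d kt]])
  also have "\<dots> = (\<integral>x. indicator (unit_simplex d) x *\<^sub>R (simplex_jacobi d (\<kappa> \<circ> \<tau>) \<mu> (perm_point d \<tau> x)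
       * simplex_jacobi d (\<kappa> \<circ> \<tau>) \<mu>' (perm_point d \<tau> x) * simplex_weight d \<kappa> x) \<partial>?M)"
  proof (rule Bochner_Integration.integral_cong [OF refl])
    fix x assume "x \<in> space ?M"
    then have x: "x \<in> {1..d} \<rightarrow>\<^sub>E UNIV" by (simp add: space_PiM)
    show "simplex_integrand d (\<kappa> \<circ> \<tau>) \<mu> \<mu>' (\<lambda>i\<in>{1..d}. x (\<tau> i))
       = indicator (unit_simplex d) x *\<^sub>R (simplex_jacobi d (\<kappa> \<circ> \<tau>) \<mu> (perm_point d \<tau> x)
       * simplex_jacobi d (\<kappa> \<circ> \<tau>) \<mu>' (perm_point d \<tau> x) * simplex_weight d \<kappa> x)"
      unfolding simplex_integrand_def perm_point_eq [OF t, symmetric] simplex_weight_permute [OF t]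
      using perm_point_in_simplex [OF t x] by (simp add: indicator_def)
  qed
  finally show ?thesis
    unfolding simplex_inner_def set_lebesgue_integral_def s p simplex_integrand_def by simp
qed

section \<open>Connection coefficients of the cycle\<close>

definition tail_sum :: "nat \<Rightarrow> (nat \<Rightarrow> nat) \<Rightarrow> nat \<Rightarrow> nat" where
  "tail_sum d f j = (\<Sum>i=j..d. f i)"

lemma tail_sum_rec: "j \<le> d \<Longrightarrow> tail_sum d f j = f j + tail_sum d f (Suc j)"
  unfolding tail_sum_def by (rule sum.atLeast_Suc_atMost)

lemma tail_sum_beyond [simp]: "d < j \<Longrightarrow> tail_sum d f j = 0"
  by (simp add: tail_sum_def)

lemma tail_sum_cong: "(\<And>i. j \<le> i \<Longrightarrow> i \<le> d \<Longrightarrow> f i = g i) \<Longrightarrow> tail_sum d f j = tail_sum d g j"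
  unfolding tail_sum_def by (rule sum.cong) auto

lemma simplex_jacobi_param_tail:
  "jparam d \<kappa> \<nu> j = (\<Sum>i=j+1..d+1. \<kappa> i) + 2 * real (tail_sum d \<nu> (Suc j)) + real (d - j)"
  by (simp add: simplex_jacobi_param_def tail_sum_def)

definition cyc :: "nat \<Rightarrow> nat \<Rightarrow> nat" where
  "cyc d = cycle_of_list [1..<d+1]"

lemma cyc_permutes: "cyc d permutes {1..d}"
  using cycle_permutes [of "[1..<d+1]"]
  by (simp add: cyc_def atLeastLessThanSuc_atLeastAtMost del: upt_Suc)

lemma cyc_eq:
  assumes "i \<in> {1..d}"
  shows "cyc d i = (if i = d then 1 else Suc i)"
proof -
  let ?cs = "[1..<d+1]"
  have "map (cyc d) ?cs = rotate 1 ?cs"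
    using cyclic_rotation [of ?cs 1] by (simp add: cyc_def del: upt_Suc)
  then have "map (cyc d) ?cs ! (i - 1) = rotate 1 ?cs ! (i - 1)" by simp
  moreover have "map (cyc d) ?cs ! (i - 1) = cyc d i"
    using assms by (subst nth_map) (auto simp del: upt_Suc)
  moreover have "rotate 1 ?cs ! (i - 1) = ?cs ! ((1 + (i - 1)) mod length ?cs)"
    by (rule nth_rotate) (use assms in \<open>auto simp del: upt_Suc\<close>)
  moreover have "?cs ! ((1 + (i - 1)) mod length ?cs) = (if i = d then 1 else Suc i)"
    using assms by (auto simp del: upt_Suc)
  ultimately show ?thesis by simp
qed

lemma cyc_last: "cyc d (d + 1) = d + 1"
  using cyc_permutes [of d] by (simp add: permutes_def)

lemma perm_point_cyc:
  "i \<in> {1..d} \<Longrightarrow> perm_point d (cyc d) x i = x (if i = d then 1 else Suc i)"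
  by (simp add: perm_point_eq [OF cyc_permutes] cyc_eq)

text \<open>
The degree that the variable \<open>x\<^sub>1\<close> carries when it stands at place \<open>j\<close>: the tail of degree
\<open>|\<nu>\<^sup>j|\<close> has then given up the degrees \<open>\<mu>\<^bsub>j+1\<^esub>, \<dots>, \<mu>\<^sub>d\<close>.
\<close>

definition excess :: "nat \<Rightarrow> (nat \<Rightarrow> nat) \<Rightarrow> (nat \<Rightarrow> nat) \<Rightarrow> nat \<Rightarrow> nat" where
  "excess d \<nu> \<mu> j = tail_sum d \<nu> j - tail_sum d \<mu> (Suc j)"

text \<open>
The tails \<open>(\<mu>\<^bsub>j+1\<^esub>, \<dots>, \<mu>\<^sub>d)\<close>, filled up with zeros, for which \<open>x\<^sub>1\<close> never carries a negative degree.
\<close>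

definition tail_domain :: "nat \<Rightarrow> (nat \<Rightarrow> nat) \<Rightarrow> nat \<Rightarrow> (nat \<Rightarrow> nat) set" where
  "tail_domain d \<nu> j = {\<mu>. (\<forall>i. i \<notin> {Suc j..d} \<longrightarrow> \<mu> i = 0) \<and>
      (\<forall>i\<in>{Suc j..d}. tail_sum d \<mu> i \<le> tail_sum d \<nu> (i - 1))}"

lemma tail_domain_le:
  assumes "\<mu> \<in> tail_domain d \<nu> j"
  shows "tail_sum d \<mu> (Suc j) \<le> tail_sum d \<nu> j"
proof (cases "Suc j \<le> d")
  case True
  then have "Suc j \<in> {Suc j..d}" by simp
  then have "tail_sum d \<mu> (Suc j) \<le> tail_sum d \<nu> (Suc j - 1)"
    using assms unfolding tail_domain_def by blast
  then show ?thesis by simp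
qed simp

definition swap_product ::
    "(nat \<Rightarrow> nat \<Rightarrow> nat \<Rightarrow> real \<Rightarrow> real \<Rightarrow> real \<Rightarrow> real) \<Rightarrow> nat \<Rightarrow> (nat \<Rightarrow> real) \<Rightarrow> (nat \<Rightarrow> nat) \<Rightarrow> (nat \<Rightarrow> nat) \<Rightarrow> nat
        \<Rightarrow> real" where
  "swap_product C d \<kappa> \<nu> \<mu> j =
     (\<Prod>i=Suc j..d. C (\<nu> (i - 1)) (excess d \<nu> \<mu> i) (\<mu> i) (jparam d \<kappa> \<mu> i) (\<kappa> 1) (\<kappa> i))"

lemma simplex_jacobi_param_cong:
  "(\<And>i. j < i \<Longrightarrow> i \<le> d \<Longrightarrow> \<mu> i = \<mu>' i) \<Longrightarrow> jparam d \<kappa> \<mu> j = jparam d \<kappa> \<mu>' j"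
  unfolding simplex_jacobi_param_tail by (subst tail_sum_cong [of "Suc j" d \<mu> \<mu>']) auto

text \<open>
Behind place \<open>j\<close> the permuted exponents are \<open>\<kappa>\<^bsub>j+2\<^esub>, \<dots>, \<kappa>\<^sub>d, \<kappa>\<^sub>1, \<kappa>\<^bsub>d+1\<^esub>\<close>.
\<close>

lemma simplex_jacobi_param_cyc:
  assumes "1 \<le> j" "j < d"
  shows "jparam d (\<kappa> \<circ> cyc d) \<nu> j
       = \<kappa> 1 + (\<Sum>i=j+2..d+1. \<kappa> i) + 2 * real (tail_sum d \<nu> (Suc j)) + real (d - j)"
proof -
  have "(\<Sum>i=j+1..d+1. (\<kappa> \<circ> cyc d) i) = (\<Sum>i=j+1..d. \<kappa> (cyc d i)) + \<kappa> (d + 1)"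
    using assms cyc_last [of d] by simp
  also have "(\<Sum>i=j+1..d. \<kappa> (cyc d i)) = (\<Sum>i=j+1..d-1. \<kappa> (Suc i)) + \<kappa> 1"
  proof -
    obtain e where e: "d = Suc e" using assms by (cases d) auto
    have "(\<Sum>i=j+1..d. \<kappa> (cyc d i)) = (\<Sum>i=j+1..e. \<kappa> (cyc d i)) + \<kappa> (cyc d d)"
      using assms e by simp
    also have "(\<Sum>i=j+1..e. \<kappa> (cyc d i)) = (\<Sum>i=j+1..e. \<kappa> (Suc i))"
      by (intro sum.cong refl) (use e in \<open>auto simp: cyc_eq\<close>)
    also have "cyc d d = 1" using cyc_eq [of d d] assms by simp
    finally show ?thesis using e by simp
  qed
  also have "(\<Sum>i=j+1..d-1. \<kappa> (Suc i)) = (\<Sum>i=j+2..d. \<kappa> i)"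
    using assms sum.shift_bounds_cl_Suc_ivl [of \<kappa> "j + 1" "d - 1"] by simp
  finally have "(\<Sum>i=j+1..d+1. (\<kappa> \<circ> cyc d) i) = \<kappa> 1 + (\<Sum>i=j+2..d+1. \<kappa> i)"
    using assms by simp
  then show ?thesis by (simp add: simplex_jacobi_param_tail)
qed

lemma rest_perm_point_cyc:
  assumes "1 \<le> j" "j \<le> d"
  shows "rest (perm_point d (cyc d) x) (Suc j) = (if j = d then rest x (Suc d) else rest x (Suc (Suc j)) + x 1)"
proof (cases "j = d")
  case True
  have "(\<Sum>i=1..<Suc d. perm_point d (cyc d) x i) = (\<Sum>i=1..<Suc d. x i)"
    using sum_perm_point [OF cyc_permutes, of d x] by (simp add: atLeastLessThanSuc_atLeastAtMost)
  then show ?thesis using True unfolding rest_def by simp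
next
  case False
  have "(\<Sum>i=1..<Suc j. perm_point d (cyc d) x i) = (\<Sum>i=1..<Suc j. x (Suc i))"
    using assms False by (intro sum.cong refl) (auto simp: perm_point_cyc)
  also have "\<dots> = (\<Sum>i=Suc 1..<Suc (Suc j). x i)"
    using sum.shift_bounds_Suc_ivl [of x 1 "Suc j"] by simp
  also have "\<dots> = (\<Sum>i=1..<Suc (Suc j). x i) - x 1"
    using assms by (subst (2) sum.atLeast_Suc_lessThan) auto
  finally show ?thesis using False by (simp add: rest_def)
qed

text \<open>
The situation after \<open>x\<^sub>1\<close> has moved from the last place to place \<open>j\<close>. The next exchange, with the
variable \<open>x\<^bsub>j+1\<^esub>\<close> of the factor before it, takes \<open>u = x\<^sub>1\<close>, \<open>v = x\<^bsub>j+1\<^esub>\<close>, and for \<open>w\<close> the sum of all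
later variables.
\<close>

lemma cyc_expansion_step:
  fixes x :: "nat \<Rightarrow> real"
  assumes C: "swap_identity C" and k: "integrable_exponents d \<kappa>" and j: "1 \<le> j" "j \<le> d"
  shows "(\<Prod>i=j..d. hjac (\<nu> i) (jparam d (\<kappa> \<circ> cyc d) \<nu> i) ((\<kappa> \<circ> cyc d) i)
            (rest (perm_point d (cyc d) x) (Suc i)) (perm_point d (cyc d) x i))
       = (\<Sum>\<mu>\<in>tail_domain d \<nu> j. swap_product C d \<kappa> \<nu> \<mu> j *
            (hjac (excess d \<nu> \<mu> j) (jparam d \<kappa> \<mu> j) (\<kappa> 1) (rest x (Suc j)) (x 1)
             * (\<Prod>i=Suc j..d. hjac (\<mu> i) (jparam d \<kappa> \<mu> i) (\<kappa> i) (rest x (Suc i)) (x i))))"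
  using j(2,1)
proof (induction rule: inc_induct)
  case base
  have dd: "d \<in> {1..d}" using base by simp
  have pp: "perm_point d (cyc d) x d = x 1"
    using dd by (simp add: perm_point_cyc)
  have td: "tail_domain d \<nu> d = {\<lambda>_. 0}" by (auto simp: tail_domain_def)
  have kd: "(\<kappa> \<circ> cyc d) d = \<kappa> 1" "(\<kappa> \<circ> cyc d) (d + 1) = \<kappa> (d + 1)"
    using cyc_eq [OF dd] cyc_last [of d] by simp_all
  show ?case
    unfolding td using base kd
    by (simp add: pp rest_perm_point_cyc simplex_jacobi_param_last swap_product_def excess_def
        tail_sum_def del: o_apply)
next
  case (step j)
  let ?A = "jparam d \<kappa>"
  define H where "H \<mu> i = hjac (\<mu> i) (?A \<mu> i) (\<kappa> i) (rest x (Suc i)) (x i)" for \<mu> i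
  have jd: "j \<in> {1..d}" "Suc j \<le> d" using step.prems step.hyps by auto
  define f where "f i = hjac (\<nu> i) (jparam d (\<kappa> \<circ> cyc d) \<nu> i) ((\<kappa> \<circ> cyc d) i)
            (rest (perm_point d (cyc d) x) (Suc i)) (perm_point d (cyc d) x i)" for i
  have IH: "(\<Prod>i=Suc j..d. f i) = (\<Sum>\<mu>\<in>tail_domain d \<nu> (Suc j). swap_product C d \<kappa> \<nu> \<mu> (Suc j) *
            (hjac (excess d \<nu> \<mu> (Suc j)) (?A \<mu> (Suc j)) (\<kappa> 1) (rest x (Suc (Suc j))) (x 1)
             * (\<Prod>i=Suc (Suc j)..d. H \<mu> i)))"
    unfolding f_def H_def by (rule step.IH) simp
  have kj: "(\<kappa> \<circ> cyc d) j = \<kappa> (Suc j)" "perm_point d (cyc d) x j = x (Suc j)"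
    using jd by (simp_all add: cyc_eq perm_point_cyc)
  have xj: "rest (perm_point d (cyc d) x) (Suc j) = x 1 + rest x (Suc (Suc j))"
    using rest_perm_point_cyc [of j d x] jd by simp
  have rj: "x (Suc j) + rest x (Suc (Suc j)) = rest x (Suc j)" by (simp add: rest_Suc)
  have summand: "f j * (swap_product C d \<kappa> \<nu> \<mu> (Suc j) *
            (hjac (excess d \<nu> \<mu> (Suc j)) (?A \<mu> (Suc j)) (\<kappa> 1) (rest x (Suc (Suc j))) (x 1)
             * (\<Prod>i=Suc (Suc j)..d. H \<mu> i)))
      = (\<Sum>l\<le>\<nu> j + excess d \<nu> \<mu> (Suc j). swap_product C d \<kappa> \<nu> (\<mu>(Suc j := l)) j *
            (hjac (excess d \<nu> (\<mu>(Suc j := l)) j) (?A (\<mu>(Suc j := l)) j) (\<kappa> 1) (rest x (Suc j)) (x 1)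
             * (\<Prod>i=Suc j..d. H (\<mu>(Suc j := l)) i)))"
    if m: "\<mu> \<in> tail_domain d \<nu> (Suc j)" for \<mu>
  proof -
    have le: "tail_sum d \<mu> (Suc (Suc j)) \<le> tail_sum d \<nu> (Suc j)"
      by (rule tail_domain_le [OF m])
    define p where "p = excess d \<nu> \<mu> (Suc j)"
    have p: "real p = real (tail_sum d \<nu> (Suc j)) - real (tail_sum d \<mu> (Suc (Suc j)))"
      using le by (simp add: p_def excess_def of_nat_diff)
    define a where "a = ?A \<mu> (Suc j)"
    have "jparam d (\<kappa> \<circ> cyc d) \<nu> j = a + \<kappa> 1 + 2 * real p + 1"
      using jd p by (subst simplex_jacobi_param_cyc) (auto simp: a_def simplex_jacobi_param_tail of_nat_diff)
    then have fj: "f j = hjac (\<nu> j) (a + \<kappa> 1 + 2 * real p + 1) (\<kappa> (Suc j)) (x 1 + rest x (Suc (Suc j))) (x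
        (Suc j))"
      unfolding f_def kj xj by simp
    have gt: "a > -1" "\<kappa> 1 > -1" "\<kappa> (Suc j) > -1"
      using simplex_jacobi_param_gt [OF k, of "Suc j" \<mu>] jd k by (auto simp: a_def)
    have sw: "f j * hjac p a (\<kappa> 1) (rest x (Suc (Suc j))) (x 1)
        = (\<Sum>l\<le>\<nu> j + p. C (\<nu> j) p l a (\<kappa> 1) (\<kappa> (Suc j)) *
            (hjac (\<nu> j + p - l) (a + \<kappa> (Suc j) + 2 * real l + 1) (\<kappa> 1) (rest x (Suc j)) (x 1)
             * hjac l a (\<kappa> (Suc j)) (rest x (Suc (Suc j))) (x (Suc j))))"
      unfolding fj rj [symmetric] using C gt unfolding swap_identity_def by blast
    have "f j * (swap_product C d \<kappa> \<nu> \<mu> (Suc j) *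
            (hjac p a (\<kappa> 1) (rest x (Suc (Suc j))) (x 1) * (\<Prod>i=Suc (Suc j)..d. H \<mu> i)))
        = (f j * hjac p a (\<kappa> 1) (rest x (Suc (Suc j))) (x 1)) *
            (swap_product C d \<kappa> \<nu> \<mu> (Suc j) * (\<Prod>i=Suc (Suc j)..d. H \<mu> i))"
      by simp
    also have "\<dots> = (\<Sum>l\<le>\<nu> j + p. swap_product C d \<kappa> \<nu> (\<mu>(Suc j := l)) j *
            (hjac (excess d \<nu> (\<mu>(Suc j := l)) j) (?A (\<mu>(Suc j := l)) j) (\<kappa> 1) (rest x (Suc j)) (x 1)
             * (\<Prod>i=Suc j..d. H (\<mu>(Suc j := l)) i)))"
      unfolding sw sum_distrib_right
    proof (intro sum.cong refl)
      fix l
      define \<mu>' where "\<mu>' = \<mu>(Suc j := l)"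
      have A: "?A \<mu>' i = ?A \<mu> i" if "Suc j \<le> i" for i
        by (rule simplex_jacobi_param_cong) (use that in \<open>auto simp: \<mu>'_def\<close>)
      have Aj: "?A \<mu>' j = a + \<kappa> (Suc j) + 2 * real l + 1"
        using jd A [of "Suc j"] by (simp add: simplex_jacobi_param_rec a_def \<mu>'_def)
      have T: "tail_sum d \<mu>' i = tail_sum d \<mu> i" if "Suc j < i" for i
        by (rule tail_sum_cong) (use that in \<open>auto simp: \<mu>'_def\<close>)
      have E: "excess d \<nu> \<mu>' i = excess d \<nu> \<mu> i" if "Suc j \<le> i" for i
        using that by (simp add: excess_def T)
      have Ej: "excess d \<nu> \<mu>' j = \<nu> j + p - l"
        using jd le T [of "Suc (Suc j)"]
        by (simp add: excess_def p_def tail_sum_rec [of j d \<nu>] tail_sum_rec [of "Suc j" d \<mu>']) (simp add: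
            \<mu>'_def)
      have "(\<Prod>i=Suc (Suc j)..d. H \<mu>' i) = (\<Prod>i=Suc (Suc j)..d. H \<mu> i)"
        by (intro prod.cong refl) (auto simp: H_def A, auto simp: \<mu>'_def)
      then have Hp: "(\<Prod>i=Suc j..d. H \<mu>' i) = hjac l a (\<kappa> (Suc j)) (rest x (Suc (Suc j))) (x (Suc j))
          * (\<Prod>i=Suc (Suc j)..d. H \<mu> i)"
        using jd A [of "Suc j"] by (subst prod.atLeast_Suc_atMost) (auto simp: H_def a_def, simp add: \<mu>'_def)
      have "swap_product C d \<kappa> \<nu> \<mu>' (Suc j) = swap_product C d \<kappa> \<nu> \<mu> (Suc j)"
        unfolding swap_product_def by (intro prod.cong refl) (auto simp: A E, auto simp: \<mu>'_def)
      then have Sp: "swap_product C d \<kappa> \<nu> \<mu>' j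
          = C (\<nu> j) p l a (\<kappa> 1) (\<kappa> (Suc j)) * swap_product C d \<kappa> \<nu> \<mu> (Suc j)"
        using jd A [of "Suc j"] E [of "Suc j"] unfolding swap_product_def
        by (subst prod.atLeast_Suc_atMost) (auto simp: a_def p_def, simp add: \<mu>'_def)
      show "C (\<nu> j) p l a (\<kappa> 1) (\<kappa> (Suc j)) *
            (hjac (\<nu> j + p - l) (a + \<kappa> (Suc j) + 2 * real l + 1) (\<kappa> 1) (rest x (Suc j)) (x 1)
             * hjac l a (\<kappa> (Suc j)) (rest x (Suc (Suc j))) (x (Suc j))) *
            (swap_product C d \<kappa> \<nu> \<mu> (Suc j) * (\<Prod>i=Suc (Suc j)..d. H \<mu> i))
         = swap_product C d \<kappa> \<nu> (\<mu>(Suc j := l)) j *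
            (hjac (excess d \<nu> (\<mu>(Suc j := l)) j) (?A (\<mu>(Suc j := l)) j) (\<kappa> 1) (rest x (Suc j)) (x 1)
             * (\<Prod>i=Suc j..d. H (\<mu>(Suc j := l)) i))"
        unfolding \<mu>'_def [symmetric] Sp Hp Aj Ej by (simp only: mult_ac)
    qed
    finally show ?thesis unfolding p_def a_def .
  qed
  have fin: "finite (tail_domain d \<nu> i)" for i
  proof (rule finite_subset)
    show "tail_domain d \<nu> i \<subseteq> {f. \<forall>k. (k \<in> {Suc i..d} \<longrightarrow> f k \<in> {..tail_sum d \<nu> 0}) \<and> (k \<notin> {Suc i..d} \<longrightarrow> f k = 0)}"
    proof (rule subsetI)
      fix \<mu> assume m: "\<mu> \<in> tail_domain d \<nu> i"
      have "\<mu> k \<le> tail_sum d \<nu> 0" if "k \<in> {Suc i..d}" for k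
      proof -
        have "\<mu> k \<le> tail_sum d \<mu> k" using that by (simp add: tail_sum_rec)
        also have "\<dots> \<le> tail_sum d \<nu> (k - 1)" using m that by (auto simp: tail_domain_def)
        also have "\<dots> \<le> tail_sum d \<nu> 0" unfolding tail_sum_def by (rule sum_mono2) auto
        finally show ?thesis .
      qed
      then show "\<mu> \<in> {f. \<forall>k. (k \<in> {Suc i..d} \<longrightarrow> f k \<in> {..tail_sum d \<nu> 0}) \<and> (k \<notin> {Suc i..d} \<longrightarrow> f k = 0)}"
        using m by (auto simp: tail_domain_def)
    qed
    show "finite {f. \<forall>k. (k \<in> {Suc i..d} \<longrightarrow> f k \<in> {..tail_sum d \<nu> 0}) \<and> (k \<notin> {Suc i..d} \<longrightarrow> f k = 0)}"
      by (rule finite_set_of_finite_funs) auto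
  qed
  define Q where "Q \<mu> = swap_product C d \<kappa> \<nu> \<mu> j *
            (hjac (excess d \<nu> \<mu> j) (?A \<mu> j) (\<kappa> 1) (rest x (Suc j)) (x 1) * (\<Prod>i=Suc j..d. H \<mu> i))" for \<mu>
  have "(\<Prod>i=j..d. f i) = f j * (\<Prod>i=Suc j..d. f i)"
    using jd by (subst prod.atLeast_Suc_atMost) auto
  also have "\<dots> = (\<Sum>\<mu>\<in>tail_domain d \<nu> (Suc j). \<Sum>l\<le>\<nu> j + excess d \<nu> \<mu> (Suc j). Q (\<mu>(Suc j := l)))"
    unfolding IH sum_distrib_left Q_def by (intro sum.cong refl summand)
  also have "\<dots> = (\<Sum>(\<mu>, l)\<in>(SIGMA \<mu>:tail_domain d \<nu> (Suc j). {..\<nu> j + excess d \<nu> \<mu> (Suc j)}). Q (\<mu>(Suc j := l)))"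
    by (rule sum.Sigma) (use fin in auto)
  \<comment> \<open>The summation index of the exchange becomes the entry \<open>\<mu>\<^bsub>j+1\<^esub>\<close> of the new tail.\<close>
  also have "\<dots> = (\<Sum>\<mu>\<in>tail_domain d \<nu> j. Q \<mu>)"
  proof (rule sum.reindex_bij_witness [where i = "\<lambda>\<mu>. (\<mu>(Suc j := 0), \<mu> (Suc j))" and j
      = "\<lambda>(\<mu>, l). \<mu>(Suc j := l)"])
    fix a assume "a \<in> (SIGMA \<mu>:tail_domain d \<nu> (Suc j). {..\<nu> j + excess d \<nu> \<mu> (Suc j)})"
    then obtain \<mu> l where a: "a = (\<mu>, l)" and m: "\<mu> \<in> tail_domain d \<nu> (Suc j)" and l: "l \<le> \<nu> j
        + excess d \<nu> \<mu> (Suc j)"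
      by auto
    have "\<mu> (Suc j) = 0" using m by (auto simp: tail_domain_def)
    then show "(((case a of (\<mu>, l) \<Rightarrow> \<mu>(Suc j := l))(Suc j := 0)), (case a of (\<mu>, l) \<Rightarrow> \<mu>(Suc j := l)) (Suc
        j)) = a"
      using a by (simp add: fun_upd_idem)
    define \<mu>' where "\<mu>' = \<mu>(Suc j := l)"
    have T: "tail_sum d \<mu>' i = tail_sum d \<mu> i" if "Suc j < i" for i
      by (rule tail_sum_cong) (use that in \<open>auto simp: \<mu>'_def\<close>)
    have le: "tail_sum d \<mu> (Suc (Suc j)) \<le> tail_sum d \<nu> (Suc j)"
      by (rule tail_domain_le [OF m])
    have "tail_sum d \<mu>' (Suc j) \<le> tail_sum d \<nu> j"
      using l le jd T [of "Suc (Suc j)"]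
      by (simp add: excess_def tail_sum_rec [of j d \<nu>] tail_sum_rec [of "Suc j" d \<mu>']) (simp add: \<mu>'_def)
    then have "tail_sum d \<mu>' i \<le> tail_sum d \<nu> (i - 1)" if "i \<in> {Suc j..d}" for i
      using m that T [of i] by (cases "i = Suc j") (auto simp: tail_domain_def)
    moreover have "\<mu>' i = 0" if "i \<notin> {Suc j..d}" for i
      using m that jd by (auto simp: tail_domain_def \<mu>'_def)
    ultimately have "\<mu>' \<in> tail_domain d \<nu> j"
      by (simp add: tail_domain_def)
    then show "(case a of (\<mu>, l) \<Rightarrow> \<mu>(Suc j := l)) \<in> tail_domain d \<nu> j"
      using a by (simp add: \<mu>'_def)
    show "Q (case a of (\<mu>, l) \<Rightarrow> \<mu>(Suc j := l)) = (case a of (\<mu>, l) \<Rightarrow> Q (\<mu>(Suc j := l)))"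
      using a by simp
  next
    fix \<mu>' assume m: "\<mu>' \<in> tail_domain d \<nu> j"
    define \<mu> where "\<mu> = \<mu>'(Suc j := 0)"
    have T: "tail_sum d \<mu> i = tail_sum d \<mu>' i" if "Suc j < i" for i
      by (rule tail_sum_cong) (use that in \<open>auto simp: \<mu>_def\<close>)
    have "\<mu> \<in> tail_domain d \<nu> (Suc j)"
      using m T unfolding tail_domain_def by (auto simp: \<mu>_def)
    moreover have "\<mu>' (Suc j) \<le> \<nu> j + excess d \<nu> \<mu> (Suc j)"
    proof -
      have "tail_sum d \<mu>' (Suc j) \<le> tail_sum d \<nu> j" by (rule tail_domain_le [OF m])
      then show ?thesis
        using jd T [of "Suc (Suc j)"]
        by (simp add: excess_def tail_sum_rec [of j d \<nu>] tail_sum_rec [of "Suc j" d \<mu>'])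
    qed
    ultimately show "(\<mu>'(Suc j := 0), \<mu>' (Suc j)) \<in> (SIGMA \<mu>:tail_domain d \<nu> (Suc j). {..\<nu> j
        + excess d \<nu> \<mu> (Suc j)})"
      by (simp add: \<mu>_def)
    show "(case (\<mu>'(Suc j := 0), \<mu>' (Suc j)) of (\<mu>, l) \<Rightarrow> \<mu>(Suc j := l)) = \<mu>'" by simp
  qed
  finally show ?case unfolding f_def Q_def H_def .
qed

definition admissible :: "nat \<Rightarrow> (nat \<Rightarrow> nat) \<Rightarrow> (nat \<Rightarrow> nat) \<Rightarrow> bool" where
  "admissible d \<nu> \<mu> \<longleftrightarrow> (\<forall>i\<in>{2..d}. tail_sum d \<mu> i \<le> tail_sum d \<nu> (i - 1))"

text \<open>
When \<open>x\<^sub>1\<close> has reached the first place, its degree is \<open>\<mu>\<^sub>1\<close>, which \<open>|\<mu>| = n\<close> determines from the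
other entries.
\<close>

lemma simplex_jacobi_cyc_expansion:
  assumes C: "swap_identity C" and k: "integrable_exponents d \<kappa>" and d: "d \<ge> 1"
    and n: "\<nu> \<in> multi_idx d n" and x: "x \<in> unit_simplex d"
  shows "simplex_jacobi d (\<kappa> \<circ> cyc d) \<nu> (perm_point d (cyc d) x)
       = (\<Sum>\<mu>\<in>multi_idx d n. (if admissible d \<nu> \<mu> then swap_product C d \<kappa> \<nu> \<mu> 1 else 0)
           * simplex_jacobi d \<kappa> \<mu> x)"
proof -
    have sn: "(\<Sum>i=1..d. \<nu> i) = n" using n by (simp add: multi_idx_def)
    let ?A = "jparam d \<kappa>"
    have px: "perm_point d (cyc d) x \<in> unit_simplex d"
      using x perm_point_in_simplex [OF cyc_permutes, of x d] by (auto simp: unit_simplex_def)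
    define H where "H \<mu> i = hjac (\<mu> i) (?A \<mu> i) (\<kappa> i) (rest x (Suc i)) (x i)" for \<mu> i
    define S where "S = {\<mu> \<in> multi_idx d n. admissible d \<nu> \<mu>}"
    have "simplex_jacobi d (\<kappa> \<circ> cyc d) \<nu> (perm_point d (cyc d) x)
       = (\<Sum>\<mu>\<in>tail_domain d \<nu> 1. swap_product C d \<kappa> \<nu> \<mu> 1 *
            (hjac (excess d \<nu> \<mu> 1) (?A \<mu> 1) (\<kappa> 1) (rest x (Suc 1)) (x 1) * (\<Prod>i=Suc 1..d. H \<mu> i)))"
      unfolding simplex_jacobi_eq_hjac [OF px] H_def by (rule cyc_expansion_step [OF C k]) (use d in auto)
    also have "\<dots> = (\<Sum>\<mu>\<in>S. swap_product C d \<kappa> \<nu> \<mu> 1 * (\<Prod>i=1..d. H \<mu> i))"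
    proof (rule sum.reindex_bij_witness [where i = "\<lambda>\<mu>. \<mu>(1 := 0)" and j = "\<lambda>\<mu>. \<mu>(1 := excess d \<nu> \<mu> 1)"])
      fix \<mu> assume m: "\<mu> \<in> tail_domain d \<nu> 1"
      define \<mu>' where "\<mu>' = \<mu>(1 := excess d \<nu> \<mu> 1)"
      have m0: "\<mu> 1 = 0" "\<mu> 0 = 0" using m by (auto simp: tail_domain_def)
      then show "(\<mu>(1 := excess d \<nu> \<mu> 1))(1 := 0) = \<mu>" by (simp add: fun_upd_idem)
      have T: "tail_sum d \<mu>' i = tail_sum d \<mu> i" if "1 < i" for i
        by (rule tail_sum_cong) (use that in \<open>auto simp: \<mu>'_def\<close>)
      have le: "tail_sum d \<mu> 2 \<le> tail_sum d \<nu> 1"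
        using tail_domain_le [OF m] by (simp add: numeral_2_eq_2)
      have "tail_sum d \<mu>' 1 = n"
        using le sn d T [of 2] by (subst tail_sum_rec)
          (auto simp: \<mu>'_def excess_def numeral_2_eq_2, simp add: tail_sum_def)
      then have mi: "\<mu>' \<in> multi_idx d n"
        using m d by (auto simp: multi_idx_def tail_domain_def tail_sum_def \<mu>'_def)
      moreover have "admissible d \<nu> \<mu>'"
        using m T by (auto simp: admissible_def tail_domain_def)
      ultimately show "\<mu>(1 := excess d \<nu> \<mu> 1) \<in> S" by (simp add: S_def \<mu>'_def)
      have A: "?A \<mu>' i = ?A \<mu> i" if "1 \<le> i" for i
        by (rule simplex_jacobi_param_cong) (use that in \<open>auto simp: \<mu>'_def\<close>)
      have E: "excess d \<nu> \<mu>' i = excess d \<nu> \<mu> i" if "1 \<le> i" for i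
        using that by (simp add: excess_def T)
      have sp: "swap_product C d \<kappa> \<nu> \<mu>' 1 = swap_product C d \<kappa> \<nu> \<mu> 1"
        unfolding swap_product_def by (intro prod.cong refl) (auto simp: A E, auto simp: \<mu>'_def)
      have "(\<Prod>i=Suc 1..d. H \<mu>' i) = (\<Prod>i=Suc 1..d. H \<mu> i)"
        by (intro prod.cong refl) (auto simp: H_def A, auto simp: \<mu>'_def)
      then have "(\<Prod>i=1..d. H \<mu>' i) = hjac (excess d \<nu> \<mu> 1) (?A \<mu> 1) (\<kappa> 1) (rest x (Suc 1)) (x 1)
          * (\<Prod>i=Suc 1..d. H \<mu> i)"
        using d A [of 1] by (subst prod.atLeast_Suc_atMost) (auto simp: H_def, simp add: \<mu>'_def)
      then show "swap_product C d \<kappa> \<nu> (\<mu>(1 := excess d \<nu> \<mu> 1)) 1 * (\<Prod>i=1..d. H (\<mu>(1 := excess d \<nu> \<mu> 1)) i)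
         = swap_product C d \<kappa> \<nu> \<mu> 1 * (hjac (excess d \<nu> \<mu> 1) (?A \<mu> 1) (\<kappa> 1) (rest x (Suc 1)) (x 1)
             * (\<Prod>i=Suc 1..d. H \<mu> i))"
        unfolding \<mu>'_def [symmetric] sp by simp
    next
      fix \<mu>' assume "\<mu>' \<in> S"
      then have mi: "\<mu>' \<in> multi_idx d n" and ad: "admissible d \<nu> \<mu>'" by (auto simp: S_def)
      define \<mu> where "\<mu> = \<mu>'(1 := 0)"
      have T: "tail_sum d \<mu> i = tail_sum d \<mu>' i" if "1 < i" for i
        by (rule tail_sum_cong) (use that in \<open>auto simp: \<mu>_def\<close>)
      have "\<mu> i = 0" if "i \<notin> {Suc 1..d}" for i
        using mi that by (cases "i = 1") (auto simp: multi_idx_def \<mu>_def)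
      then show "\<mu>'(1 := 0) \<in> tail_domain d \<nu> 1"
        using ad T unfolding tail_domain_def admissible_def by (auto simp: \<mu>_def)
      have "tail_sum d \<mu>' 1 = n" "tail_sum d \<nu> 1 = n" using mi sn by (auto simp: multi_idx_def tail_sum_def)
      then have "excess d \<nu> \<mu> 1 = \<mu>' 1"
        using d T [of 2] tail_sum_rec [of 1 d \<mu>'] by (simp add: excess_def numeral_2_eq_2)
      then show "(\<mu>'(1 := 0))(1 := excess d \<nu> (\<mu>'(1 := 0)) 1) = \<mu>'" by (simp add: \<mu>_def)
    qed
    also have "\<dots> = (\<Sum>\<mu>\<in>multi_idx d n. (if admissible d \<nu> \<mu> then swap_product C d \<kappa> \<nu> \<mu> 1 else 0)
        * simplex_jacobi d \<kappa> \<mu> x)"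
      unfolding simplex_jacobi_eq_hjac [OF x] H_def
      by (rule sum.mono_neutral_cong_left) (auto simp: S_def)
    finally show ?thesis .
qed

lemma conn_coeff_cyc:
  assumes C: "swap_identity C" and k: "integrable_exponents d \<kappa>" and d: "d \<ge> 1"
    and n: "\<nu> \<in> multi_idx d n" and m: "\<mu> \<in> multi_idx d n"
  shows "conn_coeff d (cyc d) \<kappa> \<nu> \<mu> = (if admissible d \<nu> \<mu> then swap_product C d \<kappa> \<nu> \<mu> 1 else 0)"
proof -
  define c where "c \<mu> = (if \<mu> \<in> multi_idx d n then
      if admissible d \<nu> \<mu> then swap_product C d \<kappa> \<nu> \<mu> 1 else 0 else 0)" for \<mu>
  have "conn_coeff d (cyc d) \<kappa> \<nu> = c"
  proof (rule conn_coeff_eqI [OF d k])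
    show "(\<Sum>i=1..d. \<nu> i) = n" using n by (simp add: multi_idx_def)
    show "c \<mu> = 0" if "\<mu> \<notin> multi_idx d n" for \<mu> using that by (simp add: c_def)
    fix x assume x: "x \<in> unit_simplex d"
    show "simplex_jacobi d (\<kappa> \<circ> cyc d) \<nu> (perm_point d (cyc d) x)
        = (\<Sum>\<mu>\<in>multi_idx d n. c \<mu> * simplex_jacobi d \<kappa> \<mu> x)"
      unfolding simplex_jacobi_cyc_expansion [OF C k d n x] by (intro sum.cong refl) (simp add: c_def)
  qed
  then show ?thesis using m by (simp add: c_def)
qed

lemma conn_coeff_cyc_expansion:
  assumes k: "integrable_exponents d \<kappa>" and d: "d \<ge> 1" and n: "\<nu> \<in> multi_idx d n" and x: "x \<in> unit_simplex d"
  shows "simplex_jacobi d (\<kappa> \<circ> cyc d) \<nu> (perm_point d (cyc d) x)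
       = (\<Sum>\<mu>\<in>multi_idx d n. conn_coeff d (cyc d) \<kappa> \<nu> \<mu> * simplex_jacobi d \<kappa> \<mu> x)"
  unfolding simplex_jacobi_cyc_expansion [OF swap_identity_first k d n x]
  by (intro sum.cong refl) (simp only: conn_coeff_cyc [OF swap_identity_first k d n])

section \<open>Orthogonality of the normalized coefficients\<close>

text \<open>
By Bessel's inequality, applied to a coordinate vector and the orthonormal rows, no column is
longer than \<open>1\<close>. The squared lengths of the columns add up to the number of rows, which is the
number of columns, so all of them are \<open>1\<close>.
\<close>

lemma orthonormal_rows_imp_columns:
  fixes U :: "'a \<Rightarrow> 'a \<Rightarrow> real"
  assumes fin: "finite M"
    and rows: "\<And>i j. i \<in> M \<Longrightarrow> j \<in> M \<Longrightarrow> (\<Sum>k\<in>M. U i k * U j k) = (if i = j then 1 else 0)"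
    and k: "k \<in> M"
  shows "(\<Sum>i\<in>M. (U i k)\<^sup>2) = 1"
proof -
  define q where "q k = (\<Sum>i\<in>M. (U i k)\<^sup>2)" for k
  have le: "q k \<le> 1" if k: "k \<in> M" for k
  proof -
    \<comment> \<open>the squared distance of the \<open>k\<close>-th coordinate vector from the span of the rows\<close>
    have "0 \<le> (\<Sum>m\<in>M. ((if m = k then 1 else 0) - (\<Sum>i\<in>M. U i k * U i m))\<^sup>2)"
      by (rule sum_nonneg) simp
    also have "\<dots> = (\<Sum>m\<in>M. (if m = k then 1 else 0) - 2 * ((if m = k then 1 else 0) * (\<Sum>i\<in>M. U i k * U i m))
        + (\<Sum>i\<in>M. U i k * U i m) * (\<Sum>j\<in>M. U j k * U j m))"
      by (intro sum.cong refl) (simp add: power2_eq_square algebra_simps)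
    also have "\<dots> = (\<Sum>m\<in>M. if m = k then 1 else 0) - 2 * (\<Sum>m\<in>M. (if m = k then 1 else 0) * (\<Sum>i\<in>M. U i k * U i m))
        + (\<Sum>m\<in>M. (\<Sum>i\<in>M. U i k * U i m) * (\<Sum>j\<in>M. U j k * U j m))"
      by (simp only: sum.distrib sum_subtractf sum_distrib_left)
    also have "(\<Sum>m\<in>M. if m = k then 1 else 0) = (1 :: real)"
      using fin k by simp
    also have "(\<Sum>m\<in>M. (if m = k then 1 else 0) * (\<Sum>i\<in>M. U i k * U i m)) = q k"
    proof -
      have "(\<Sum>m\<in>M. (if m = k then 1 else 0) * (\<Sum>i\<in>M. U i k * U i m)) = (\<Sum>m\<in>M. if m
          = k then \<Sum>i\<in>M. U i k * U i m else 0)"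
        by (intro sum.cong refl) simp
      then show ?thesis using fin k by (simp add: q_def power2_eq_square)
    qed
    also have "(\<Sum>m\<in>M. (\<Sum>i\<in>M. U i k * U i m) * (\<Sum>j\<in>M. U j k * U j m))
        = (\<Sum>i\<in>M. \<Sum>j\<in>M. U i k * U j k * (\<Sum>m\<in>M. U i m * U j m))"
    proof -
      have "(\<Sum>m\<in>M. (\<Sum>i\<in>M. U i k * U i m) * (\<Sum>j\<in>M. U j k * U j m))
          = (\<Sum>m\<in>M. \<Sum>i\<in>M. \<Sum>j\<in>M. U i k * U j k * (U i m * U j m))"
        unfolding sum_product by (intro sum.cong refl) simp
      also have "\<dots> = (\<Sum>i\<in>M. \<Sum>m\<in>M. \<Sum>j\<in>M. U i k * U j k * (U i m * U j m))"
        by (rule sum.swap)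
      also have "\<dots> = (\<Sum>i\<in>M. \<Sum>j\<in>M. \<Sum>m\<in>M. U i k * U j k * (U i m * U j m))"
        by (intro sum.cong refl sum.swap)
      finally show ?thesis by (simp only: sum_distrib_left)
    qed
    also have "\<dots> = (\<Sum>i\<in>M. \<Sum>j\<in>M. if j = i then (U i k)\<^sup>2 else 0)"
      by (intro sum.cong refl) (simp add: rows power2_eq_square)
    also have "\<dots> = q k" using fin by (simp add: q_def)
    finally show ?thesis by simp
  qed
  have "(\<Sum>k\<in>M. q k) = (\<Sum>i\<in>M. \<Sum>k\<in>M. U i k * U i k)"
    unfolding q_def power2_eq_square by (rule sum.swap)
  also have "\<dots> = (\<Sum>i\<in>M. 1)" by (intro sum.cong refl) (simp add: rows)
  finally have "(\<Sum>k\<in>M. 1 - q k) = 0" by (simp add: sum_subtractf)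
  then have "1 - q k = 0"
    using le k fin by (subst (asm) sum_nonneg_eq_0_iff) auto
  then show ?thesis by (simp add: q_def)
qed

lemma simplex_inner_orthogonal:
  assumes d: "d \<ge> 1" and k: "integrable_exponents d \<kappa>"
    and m: "\<mu> \<in> multi_idx d n" "\<mu>' \<in> multi_idx d n"
  shows "simplex_inner d \<kappa> (simplex_jacobi d \<kappa> \<mu>) (simplex_jacobi d \<kappa> \<mu>')
       = (if \<mu> = \<mu>' then jacobi_norm_sq d \<kappa> \<mu> else 0)"
proof (cases "\<mu> = \<mu>'")
  case True
  then show ?thesis by (simp add: jacobi_norm_sq_def)
next
  case False
  then show ?thesis using simplex_integrand_orthogonal [OF d k m False]
    unfolding simplex_inner_def set_lebesgue_integral_def simplex_integrand_def by simp
qed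

lemma permuted_params_gt:
  fixes d :: nat and \<kappa> :: "nat \<Rightarrow> real"
  assumes k: "integrable_exponents d \<kappa>" and t: "\<tau> permutes {1..d}"
  shows "integrable_exponents d (\<kappa> \<circ> \<tau>)"
proof
  fix i assume i: "i \<in> {1..d+1}"
  have "\<tau> permutes {1..d+1}" by (rule permutes_subset [OF t]) auto
  then have "\<tau> i \<in> {1..d+1}" using i by (simp only: permutes_in_image)
  then show "(\<kappa> \<circ> \<tau>) i > -1" using k by (simp del: One_nat_def)
qed

lemma conn_coeff_normalized_rows:
  assumes d: "d \<ge> 1" and k: "integrable_exponents d \<kappa>"
    and n: "\<nu> \<in> multi_idx d n" "\<nu>' \<in> multi_idx d n"
  shows "(\<Sum>\<mu>\<in>multi_idx d n. conn_coeff_normalized d (cyc d) \<kappa> \<nu> \<mu> * conn_coeff_normalized d (cyc d) \<kappa> \<nu>' \<mu>)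
       = (if \<nu> = \<nu>' then 1 else 0)"
proof -
  let ?M = "multi_idx d n" and ?\<tau> = "cyc d"
  define A where "A \<mu> = jacobi_norm_sq d \<kappa> \<mu>" for \<mu>
  define B where "B \<nu> = jacobi_norm_sq d (\<kappa> \<circ> ?\<tau>) \<nu>" for \<nu>
  have kt: "integrable_exponents d (\<kappa> \<circ> ?\<tau>)" by (rule permuted_params_gt [OF k cyc_permutes])
  have A: "A \<mu> > 0" if "\<mu> \<in> ?M" for \<mu> unfolding A_def by (rule jacobi_norm_sq_pos [OF d k that])
  have B: "B \<nu> > 0" if "\<nu> \<in> ?M" for \<nu> unfolding B_def by (rule jacobi_norm_sq_pos [OF d kt that])
  let ?c = "\<lambda>\<nu> \<mu>. conn_coeff d ?\<tau> \<kappa> \<nu> \<mu>"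
  have "(\<Sum>\<mu>\<in>?M. ?c \<nu> \<mu> * ?c \<nu>' \<mu> * A \<mu>)
      = simplex_inner d \<kappa> (\<lambda>x. \<Sum>\<mu>\<in>?M. ?c \<nu> \<mu> * simplex_jacobi d \<kappa> \<mu> x) (\<lambda>x. \<Sum>\<mu>\<in>?M. ?c \<nu>' \<mu>
          * simplex_jacobi d \<kappa> \<mu> x)"
    unfolding A_def simplex_inner_expansion [OF d k] ..
  also have "\<dots> = simplex_inner d \<kappa> (\<lambda>x. simplex_jacobi d (\<kappa> \<circ> ?\<tau>) \<nu> (perm_point d ?\<tau> x))
        (\<lambda>x. simplex_jacobi d (\<kappa> \<circ> ?\<tau>) \<nu>' (perm_point d ?\<tau> x))"
    by (rule simplex_inner_cong) (simp_all only: conn_coeff_cyc_expansion [OF k d n(1)]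
        conn_coeff_cyc_expansion [OF k d n(2)])
  also have "\<dots> = (if \<nu> = \<nu>' then B \<nu> else 0)"
    unfolding simplex_inner_permute [OF d k cyc_permutes] B_def by (rule simplex_inner_orthogonal [OF d kt n])
  finally have *: "(\<Sum>\<mu>\<in>?M. ?c \<nu> \<mu> * ?c \<nu>' \<mu> * A \<mu>) = (if \<nu> = \<nu>' then B \<nu> else 0)" .
  have "(\<Sum>\<mu>\<in>?M. conn_coeff_normalized d ?\<tau> \<kappa> \<nu> \<mu> * conn_coeff_normalized d ?\<tau> \<kappa> \<nu>' \<mu>)
      = (\<Sum>\<mu>\<in>?M. ?c \<nu> \<mu> * ?c \<nu>' \<mu> * A \<mu> / (sqrt (B \<nu>) * sqrt (B \<nu>')))"
  proof (intro sum.cong refl)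
    fix \<mu> assume "\<mu> \<in> ?M"
    then have s: "sqrt (A \<mu>) * sqrt (A \<mu>) = A \<mu>" using A by (simp add: less_imp_le)
    have e: "s / b * c * (s / b' * c') = c * c' * (s * s) / (b * b')" for s b b' c c' :: real
      by simp
    show "conn_coeff_normalized d ?\<tau> \<kappa> \<nu> \<mu> * conn_coeff_normalized d ?\<tau> \<kappa> \<nu>' \<mu>
        = ?c \<nu> \<mu> * ?c \<nu>' \<mu> * A \<mu> / (sqrt (B \<nu>) * sqrt (B \<nu>'))"
      unfolding conn_coeff_normalized_def A_def [symmetric] B_def [symmetric] real_sqrt_divide e s ..
  qed
  also have "\<dots> = (if \<nu> = \<nu>' then B \<nu> else 0) / (sqrt (B \<nu>) * sqrt (B \<nu>'))"
    by (simp only: sum_divide_distrib [symmetric] *)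
  also have "\<dots> = (if \<nu> = \<nu>' then 1 else 0)"
  proof -
    have "sqrt (B \<nu>) * sqrt (B \<nu>) = B \<nu>" "B \<nu> \<noteq> 0" using B [OF n(1)] by auto
    then show ?thesis by auto
  qed
  finally show ?thesis .
qed

lemma conn_coeff_normalized_columns:
  assumes d: "d \<ge> 1" and k: "integrable_exponents d \<kappa>" and m: "\<mu> \<in> multi_idx d n"
  shows "(\<Sum>\<nu>\<in>multi_idx d n. (conn_coeff_normalized d (cyc d) \<kappa> \<nu> \<mu>)\<^sup>2) = 1"
  by (rule orthonormal_rows_imp_columns [OF finite_multi_idx conn_coeff_normalized_rows [OF d k] m])

section \<open>Racah weights and their continuation to singular parameters\<close>

lemma finite_racah_lattice [simp]: "finite (racah_lattice p N)"
proof (rule finite_subset)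
  show "racah_lattice p N \<subseteq> {f. \<forall>i. (i \<in> {1..p} \<longrightarrow> f i \<in> {..N}) \<and> (i \<notin> {1..p} \<longrightarrow> f i = 0)}"
    by (auto simp: racah_lattice_def)
  show "finite {f :: nat \<Rightarrow> nat. \<forall>i. (i \<in> {1..p} \<longrightarrow> f i \<in> {..N}) \<and> (i \<notin> {1..p} \<longrightarrow> f i = 0)}"
    by (rule finite_set_of_finite_funs) auto
qed

lemma racah_ext_simps:
  "racah_ext p N x (Suc p) = N" "racah_ext p N x 0 = 0" "j \<in> {1..p} \<Longrightarrow> racah_ext p N x j = x j"
  by (auto simp: racah_ext_def)

lemma racah_ext_mono:
  assumes "x \<in> racah_lattice p N" "j \<le> p"
  shows "racah_ext p N x j \<le> racah_ext p N x (Suc j)"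
  using assms by (auto simp: racah_ext_def racah_lattice_def)

text \<open>
The weight divided by \<open>(\<beta>\<^bsub>p+1\<^esub>)\<^bsub>2N\<^esub>\<close>, with all common factors cancelled. The divisor is included
because \<open>\<beta>\<^bsub>p+1\<^esub> = 0\<close> can occur; the whole weight is then \<open>0\<close> although \<open>w / r\<^sup>2\<close> has a limit.
\<close>

definition racah_weight_reduced :: "nat \<Rightarrow> nat \<Rightarrow> (nat \<Rightarrow> nat) \<Rightarrow> (nat \<Rightarrow> real) \<Rightarrow> real" where
  "racah_weight_reduced p N x \<beta> =
     (let X = racah_ext p N x in
      \<Prod>j=0..p. poch (\<beta> (Suc j) - \<beta> j) (X (Suc j) - X j)
        / (fact (X (Suc j) - X j)
           * poch (\<beta> (Suc j) + real (X (Suc j)) + real (X j)) (X (Suc j) - X j)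
           * poch (\<beta> j + 2 * real (X j) + 1) (X (Suc j) - X j)))"

definition racah_nonsingular :: "nat \<Rightarrow> nat \<Rightarrow> (nat \<Rightarrow> real) \<Rightarrow> bool" where
  "racah_nonsingular p N \<beta> \<longleftrightarrow>
     (\<forall>x\<in>racah_lattice p N. \<forall>j\<in>{0..p}. let X = racah_ext p N x in
        poch (\<beta> (Suc j) + real (X (Suc j)) + real (X j)) (X (Suc j) - X j) \<noteq> 0 \<and>
        poch (\<beta> j + 2 * real (X j) + 1) (X (Suc j) - X j) \<noteq> 0)"

text \<open>
The part of the weight that involves \<open>\<beta>\<^sub>j\<close> alone, \<open>b = \<beta>\<^sub>j\<close>, for neighbouring entries
\<open>Y \<le> X \<le> Z\<close>. The half-integer symbols contribute \<open>(b + 2 X) / b\<close>, and both \<open>b\<close> and \<open>b + 2 X\<close> occur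
in the other symbols; \<open>X = 0\<close> forces \<open>Y = 0\<close>, where nothing has to cancel.
\<close>

lemma racah_weight_factor:
  fixes b :: real
  assumes "Y \<le> X" "X \<le> Z" and nz: "poch (b + 1) (Z + X) \<noteq> 0" "poch (b / 2) X \<noteq> 0"
  shows "poch b (X + Y) / poch (b + 1) (Z + X) * (poch ((b + 2) / 2) X / poch (b / 2) X)
       = 1 / (poch (b + real X + real Y) (X - Y) * poch (b + 2 * real X + 1) (Z - X))"
proof (cases X)
  case 0
  then show ?thesis using assms by simp
next
  case (Suc K)
  have b: "b \<noteq> 0" using nz(2) Suc by (auto simp: pochhammer_rec)
  have "b / 2 * poch (b / 2 + 1) X = poch (b / 2) X * (b / 2 + real X)"
    by (metis pochhammer_Suc pochhammer_rec)
  then have r: "poch ((b + 2) / 2) X / poch (b / 2) X = (b + 2 * real X) / b"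
  proof -
    assume e: "b / 2 * poch (b / 2 + 1) X = poch (b / 2) X * (b / 2 + real X)"
    have e1: "(b + 2) / 2 = b / 2 + 1" by simp
    have e2: "poch (b / 2 + 1) X = poch (b / 2) X * ((b / 2 + real X) / (b / 2))"
      using e b by (metis divide_eq_0_iff nonzero_mult_div_cancel_left times_divide_eq_right zero_neq_numeral)
    have e3: "(b / 2 + real X) / (b / 2) = (b + 2 * real X) / b"
      using b by (simp add: field_simps)
    show ?thesis unfolding e1 e2 e3 using nz(2) by simp
  qed
  define L where "L = K + Y"
  have L: "X + Y = Suc L" using Suc by (simp add: L_def)
  have p1: "poch b (X + Y) = b * poch (b + 1) L"
    unfolding L by (rule pochhammer_rec)
  have "Z + X = L + ((X - Y) + (Suc 0 + (Z - X)))" using assms L by simp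
  then have h0: "poch (b + 1) (Z + X) = poch (b + 1) L * (poch (b + 1 + real L) (X - Y)
      * (poch (b + 1 + real L + real (X - Y)) (Suc 0) * poch (b + 1 + real L + real (X - Y) + 1) (Z - X)))"
    by (simp only: pochhammer_product' of_nat_Suc of_nat_0 add_0 add_0_right)
  have h1: "b + 1 + real L = b + real X + real Y" using L by (metis add.assoc add.commute of_nat_Suc of_nat_add)
  have h2: "b + real X + real Y + real (X - Y) = b + 2 * real X" using assms by (simp add: of_nat_diff)
  have p2: "poch (b + 1) (Z + X) = poch (b + 1) L * (poch (b + real X + real Y) (X - Y)
      * ((b + 2 * real X) * poch (b + 2 * real X + 1) (Z - X)))"
    using h0 unfolding h1 h2 by (simp only: pochhammer_Suc pochhammer_0 of_nat_0 add_0_right mult_1)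
  have "poch (b + 1) L \<noteq> 0" "b + 2 * real X \<noteq> 0"
    using nz(1) unfolding p2 by auto
  then show ?thesis unfolding r p1 p2 using b by simp
qed

text \<open>
Collect the factors by the parameter \<open>\<beta>\<^sub>j\<close> that they contain instead of by the pair \<open>(j, j + 1)\<close>.
\<close>

lemma racah_weight_eq_reduced:
  assumes x: "x \<in> racah_lattice p N"
    and nz: "\<And>j. j \<in> {0..p} \<Longrightarrow> poch (\<beta> j + 1) (racah_ext p N x (j + 1) + racah_ext p N x j) \<noteq> 0"
      "\<And>j. j \<in> {1..p} \<Longrightarrow> poch (\<beta> j / 2) (x j) \<noteq> 0"
    and last: "poch (\<beta> (Suc p) + real N + real (racah_ext p N x p)) (N - racah_ext p N x p) \<noteq> 0"
  shows "racah_weight p N x \<beta> = poch (\<beta> (Suc p)) (2 * N) * racah_weight_reduced p N x \<beta>"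
proof -
  define X where "X = racah_ext p N x"
  have X: "X (Suc p) = N" "X 0 = 0" and Xj: "\<And>j. j \<in> {1..p} \<Longrightarrow> X j = x j"
    by (simp_all add: X_def racah_ext_simps)
  have mono: "X j \<le> X (Suc j)" if "j \<le> p" for j unfolding X_def by (rule racah_ext_mono [OF x that])
  define G where "G j = poch (\<beta> (Suc j) - \<beta> j) (X (Suc j) - X j) / fact (X (Suc j) - X j)" for j
  define S where "S j = X (Suc j) + X j" for j
  define B where "B j = poch (\<beta> j) (S (j - 1))" for j
  define C where "C j = poch (\<beta> j + 1) (S j)" for j
  define r where "r j = poch ((\<beta> j + 2) / 2) (X j) / poch (\<beta> j / 2) (X j)" for j
  define D1 where "D1 j = poch (\<beta> j + real (X j) + real (X (j - 1))) (X j - X (j - 1))" for j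
  define D2 where "D2 j = poch (\<beta> j + 2 * real (X j) + 1) (X (Suc j) - X j)" for j
  have phi: "B j / C j * r j = 1 / (D1 j * D2 j)" if j: "j \<in> {1..p}" for j
  proof -
    have "X (j - 1) \<le> X j" "X j \<le> X (Suc j)" using mono [of "j - 1"] mono [of j] j by auto
    moreover have "poch (\<beta> j + 1) (X (Suc j) + X j) \<noteq> 0" using nz(1) [of j] j by (simp add: X_def)
    moreover have "poch (\<beta> j / 2) (X j) \<noteq> 0" using nz(2) [of j] j Xj by simp
    ultimately show ?thesis
      using racah_weight_factor [of "X (j - 1)" "X j" "X (Suc j)" "\<beta> j"] j
      by (simp add: B_def C_def r_def D1_def D2_def S_def)
  qed
  have sh: "(\<Prod>j=0..p. f (Suc j)) = (\<Prod>j=1..p. f j) * f (Suc p)" for f :: "nat \<Rightarrow> real"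
    using prod.shift_bounds_cl_Suc_ivl [of f 0 p] by simp
  have sp: "(\<Prod>j=0..p. f j) = f 0 * (\<Prod>j=1..p. f j)" for f :: "nat \<Rightarrow> real"
    by (subst prod.atLeast_Suc_atMost) auto
  have "racah_weight p N x \<beta> = (\<Prod>j=0..p. G j * B (Suc j) / C j) * (\<Prod>j=1..p. r j)"
    unfolding racah_weight_def Let_def X_def [symmetric]
    by (intro arg_cong2 [where f = "(*)"] prod.cong refl)
      (auto simp: G_def B_def C_def S_def r_def Xj)
  also have "\<dots> = (\<Prod>j=0..p. G j) * (B (Suc p) / C 0) * (\<Prod>j=1..p. B j / C j * r j)"
    unfolding prod_dividef prod.distrib sh [of B] sp [of C] by simp
  also have "(\<Prod>j=1..p. B j / C j * r j) = (\<Prod>j=1..p. 1 / (D1 j * D2 j))"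
    by (intro prod.cong refl phi)
  also have "(\<Prod>j=0..p. G j) * (B (Suc p) / C 0) * (\<Prod>j=1..p. 1 / (D1 j * D2 j))
      = B (Suc p) * D1 (Suc p) * (\<Prod>j=0..p. G j / (D1 (Suc j) * D2 j))"
  proof -
    have "C 0 = D2 0" by (simp add: C_def D2_def S_def X)
    moreover have "D1 (Suc p) \<noteq> 0" using last by (simp add: D1_def X X_def [symmetric])
    ultimately show ?thesis
      unfolding prod_dividef prod.distrib sh [of D1] sp [of D2] by (simp add: mult_ac)
  qed
  also have "B (Suc p) * D1 (Suc p) = poch (\<beta> (Suc p)) (2 * N)"
  proof -
    have "X p \<le> N" using mono [of p] X by simp
    then have "poch (\<beta> (Suc p)) (2 * N) = poch (\<beta> (Suc p)) (N + X p)
        * poch (\<beta> (Suc p) + real (N + X p)) (N - X p)"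
      using pochhammer_product [of "N + X p" "2 * N" "\<beta> (Suc p)"] by simp
    then show ?thesis by (simp add: B_def D1_def S_def X add_ac)
  qed
  also have "(\<Prod>j=0..p. G j / (D1 (Suc j) * D2 j)) = racah_weight_reduced p N x \<beta>"
    unfolding racah_weight_reduced_def Let_def X_def [symmetric]
    by (intro prod.cong refl) (simp add: G_def D1_def D2_def)
  finally show ?thesis .
qed

definition racah_norm_reduced :: "nat \<Rightarrow> nat \<Rightarrow> (nat \<Rightarrow> nat) \<Rightarrow> (nat \<Rightarrow> real) \<Rightarrow> real" where
  "racah_norm_reduced p N \<nu> \<beta> = (\<Sum>y\<in>racah_lattice p N. racah_weight_reduced p N y \<beta> * (racah_poly p N \<nu> y \<beta>)\<^sup>2)"

text \<open>
The conditions of \<open>racah_regular\<close> on the weight; the one on the norm is treated separately.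
\<close>

definition racah_denoms_nz :: "nat \<Rightarrow> nat \<Rightarrow> (nat \<Rightarrow> real) \<Rightarrow> bool" where
  "racah_denoms_nz p N \<beta> \<longleftrightarrow> (\<forall>y\<in>racah_lattice p N.
            (\<forall>j\<in>{0..p}. poch (\<beta> j + 1)
               (racah_ext p N y (j + 1) + racah_ext p N y j) \<noteq> 0) \<and>
            (\<forall>j\<in>{1..p}. poch (\<beta> j / 2) (y j) \<noteq> 0))"

lemma racah_weight_eq:
  assumes "racah_denoms_nz p N \<beta>" "racah_nonsingular p N \<beta>" "x \<in> racah_lattice p N"
  shows "racah_weight p N x \<beta> = poch (\<beta> (Suc p)) (2 * N) * racah_weight_reduced p N x \<beta>"
proof (rule racah_weight_eq_reduced [OF assms(3)])
  have "p \<in> {0..p}" by simp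
  then have "let X = racah_ext p N x in
        poch (\<beta> (Suc p) + real (X (Suc p)) + real (X p)) (X (Suc p) - X p) \<noteq> 0"
    using assms(2,3) unfolding racah_nonsingular_def Let_def by blast
  then show "poch (\<beta> (Suc p) + real N + real (racah_ext p N x p)) (N - racah_ext p N x p) \<noteq> 0"
    by (simp add: racah_ext_simps Let_def)
qed (use assms in \<open>auto simp: racah_denoms_nz_def\<close>)

lemma racah_norm_eq:
  assumes "racah_denoms_nz p N \<beta>" "racah_nonsingular p N \<beta>"
  shows "racah_norm_sq p N \<nu> \<beta> = poch (\<beta> (Suc p)) (2 * N) * racah_norm_reduced p N \<nu> \<beta>"
  unfolding racah_norm_sq_def racah_norm_reduced_def sum_distrib_left
  by (intro sum.cong refl) (simp add: racah_weight_eq [OF assms])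

lemma racah_quotient_eq:
  assumes "\<beta> \<in> racah_regular p N \<nu>" "racah_nonsingular p N \<beta>" "x \<in> racah_lattice p N"
  shows "racah_weight p N x \<beta> / racah_norm_sq p N \<nu> \<beta>
      = racah_weight_reduced p N x \<beta> / racah_norm_reduced p N \<nu> \<beta>"
proof -
  have nz: "racah_denoms_nz p N \<beta>" and "racah_norm_sq p N \<nu> \<beta> \<noteq> 0"
    using assms(1) by (auto simp: racah_regular_def racah_denoms_nz_def)
  then show ?thesis
    using racah_norm_eq [OF nz assms(2), of \<nu>] racah_weight_eq [OF nz assms(2,3)] by auto
qed

lemma tendsto_pochhammer:
  fixes f :: "'a \<Rightarrow> real"
  assumes "(f \<longlongrightarrow> a) F"
  shows "((\<lambda>x. poch (f x) n) \<longlongrightarrow> poch a n) F"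
  unfolding pochhammer_prod by (intro tendsto_prod tendsto_add assms tendsto_const)

lemma tendsto_racah_poly:
  assumes B: "\<And>j. ((\<lambda>b. B b j) \<longlongrightarrow> \<beta> j) F"
  shows "((\<lambda>b. racah_poly p N \<nu> x (B b)) \<longlongrightarrow> racah_poly p N \<nu> x \<beta>) F"
  unfolding racah_poly_def terminating_4F3_def Let_def
  by (intro tendsto_intros tendsto_pochhammer B) auto

lemma tendsto_racah_weight_reduced:
  assumes B: "\<And>j. ((\<lambda>b. B b j) \<longlongrightarrow> \<beta> j) F" and ns: "racah_nonsingular p N \<beta>" and x: "x \<in> racah_lattice p N"
  shows "((\<lambda>b. racah_weight_reduced p N x (B b)) \<longlongrightarrow> racah_weight_reduced p N x \<beta>) F"
  unfolding racah_weight_reduced_def Let_def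
  by (intro tendsto_intros tendsto_pochhammer B)
    (use ns x in \<open>auto simp: racah_nonsingular_def Let_def\<close>)

lemma tendsto_racah_norm_reduced:
  assumes B: "\<And>j. ((\<lambda>b. B b j) \<longlongrightarrow> \<beta> j) F" and ns: "racah_nonsingular p N \<beta>"
  shows "((\<lambda>b. racah_norm_reduced p N \<nu> (B b)) \<longlongrightarrow> racah_norm_reduced p N \<nu> \<beta>) F"
  unfolding racah_norm_reduced_def
  by (intro tendsto_intros tendsto_racah_poly tendsto_racah_weight_reduced B ns)

lemma eventually_racah_nonsingular:
  assumes B: "\<And>j. ((\<lambda>b. B b j) \<longlongrightarrow> \<beta> j) F" and ns: "racah_nonsingular p N \<beta>"
  shows "\<forall>\<^sub>F b in F. racah_nonsingular p N (B b)"
  unfolding racah_nonsingular_def Let_def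
proof (intro eventually_ball_finite ballI finite_racah_lattice finite_atLeastAtMost eventually_conj)
  fix x j assume x: "x \<in> racah_lattice p N" and j: "j \<in> {0..p}"
  let ?X = "racah_ext p N x"
  show "\<forall>\<^sub>F b in F. poch (B b (Suc j) + real (?X (Suc j)) + real (?X j)) (?X (Suc j) - ?X j) \<noteq> 0"
    by (rule tendsto_imp_eventually_ne [OF tendsto_pochhammer [OF tendsto_add [OF tendsto_add [OF B
        tendsto_const] tendsto_const]]])
      (use ns x j in \<open>auto simp: racah_nonsingular_def Let_def\<close>)
  show "\<forall>\<^sub>F b in F. poch (B b j + 2 * real (?X j) + 1) (?X (Suc j) - ?X j) \<noteq> 0"
    by (rule tendsto_imp_eventually_ne [OF tendsto_pochhammer [OF tendsto_add [OF tendsto_add [OF B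
        tendsto_const] tendsto_const]]])
      (use ns x j in \<open>auto simp: racah_nonsingular_def Let_def\<close>)
qed

lemma eventually_pochhammer_shift_ne:
  fixes c :: real
  shows "\<forall>\<^sub>F t in at 0. poch (c + t) M \<noteq> 0"
proof -
  have "\<forall>\<^sub>F t in at 0. \<forall>k\<in>{..<M}. t \<noteq> - c - real k"
    by (intro eventually_ball_finite ballI eventually_neq_at_within) auto
  then show ?thesis
  proof eventually_elim
    case (elim t)
    have "c + t \<noteq> - real k" if "k < M" for k
    proof
      assume "c + t = - real k"
      then have "t = - c - real k" by linarith
      with elim that show False by blast
    qed
    then show ?case by (simp add: pochhammer_eq_0_iff)
  qed
qed

lemma eventually_racah_denoms_nz:
  "\<forall>\<^sub>F t in at 0. racah_denoms_nz p N (\<lambda>j. \<beta> j + t)"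
  unfolding racah_denoms_nz_def
proof (intro eventually_ball_finite ballI finite_racah_lattice finite_atLeastAtMost eventually_conj)
  fix y :: "nat \<Rightarrow> nat" and j
  show "\<forall>\<^sub>F t in at 0. poch (\<beta> j + t + 1) (racah_ext p N y (j + 1) + racah_ext p N y j) \<noteq> 0"
    using eventually_pochhammer_shift_ne [of "\<beta> j + 1"] by (simp add: add_ac)
  have "\<forall>\<^sub>F t in at 0. \<forall>k\<in>{..<y j}. t \<noteq> - \<beta> j - 2 * real k"
    by (intro eventually_ball_finite ballI eventually_neq_at_within) auto
  then show "\<forall>\<^sub>F t in at 0. poch ((\<beta> j + t) / 2) (y j) \<noteq> 0"
  proof eventually_elim
    case (elim t)
    have "(\<beta> j + t) / 2 \<noteq> - real k" if "k < y j" for k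
    proof
      assume "(\<beta> j + t) / 2 = - real k"
      then have "t = - \<beta> j - 2 * real k" by (simp add: field_simps)
      with elim that show False by blast
    qed
    then show ?case by (simp add: pochhammer_eq_0_iff)
  qed
qed

lemma eventually_racah_regular_shift:
  assumes ns: "racah_nonsingular p N \<beta>" and nz: "racah_norm_reduced p N \<nu> \<beta> \<noteq> 0"
  shows "\<forall>\<^sub>F t in at 0. (\<lambda>j. \<beta> j + t) \<in> racah_regular p N \<nu>"
proof -
  have B: "((\<lambda>t. \<beta> j + t) \<longlongrightarrow> \<beta> j) (at 0)" for j
  proof -
    have "((\<lambda>t. \<beta> j + t) \<longlongrightarrow> \<beta> j + 0) (at 0)" by (intro tendsto_intros)
    then show ?thesis by simp
  qed
  have "\<forall>\<^sub>F t in at 0. racah_norm_reduced p N \<nu> (\<lambda>j. \<beta> j + t) \<noteq> 0"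
    by (rule tendsto_imp_eventually_ne [OF tendsto_racah_norm_reduced [OF B ns] nz])
  moreover have "\<forall>\<^sub>F t in at 0. racah_nonsingular p N (\<lambda>j. \<beta> j + t)"
    by (rule eventually_racah_nonsingular [OF B ns])
  moreover have "\<forall>\<^sub>F t in at 0. racah_denoms_nz p N (\<lambda>j. \<beta> j + t)"
    by (rule eventually_racah_denoms_nz)
  moreover have "\<forall>\<^sub>F t in at 0. poch (\<beta> (Suc p) + t) (2 * N) \<noteq> 0"
    by (rule eventually_pochhammer_shift_ne)
  ultimately show ?thesis
  proof eventually_elim
    case (elim t)
    have "racah_norm_sq p N \<nu> (\<lambda>j. \<beta> j + t) \<noteq> 0"
      using racah_norm_eq [OF elim(3,2), of \<nu>] elim by simp
    then show ?case using elim(3) by (simp add: racah_regular_def racah_denoms_nz_def)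
  qed
qed

text \<open>
On the line \<open>\<beta> + t (1, 1, \<dots>)\<close> each of the finitely many denominators vanishes for finitely many \<open>t\<close>
only, so the line runs into \<open>\<beta>\<close> through regular parameters.
\<close>

lemma racah_regular_limit_point:
  assumes ns: "racah_nonsingular p N \<beta>" and nz: "racah_norm_reduced p N \<nu> \<beta> \<noteq> 0"
  shows "at \<beta> within racah_regular p N \<nu> \<noteq> bot"
proof
  assume bot: "at \<beta> within racah_regular p N \<nu> = bot"
  define B where "B t = (\<lambda>j. \<beta> j + t)" for t
  have "continuous_on UNIV B"
    unfolding B_def by (intro continuous_on_coordinatewise_then_product continuous_intros)
  then have "isCont B 0" by (simp add: continuous_on_eq_continuous_at)
  then have "(B \<longlongrightarrow> B 0) (at 0)" by (simp add: isCont_def)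
  moreover have "B 0 = \<beta>" by (simp add: B_def)
  moreover have "\<forall>\<^sub>F t in at 0. B t \<in> racah_regular p N \<nu> \<and> B t \<noteq> \<beta>"
    using eventually_racah_regular_shift [OF ns nz] eventually_neq_at_within [of "0 :: real" 0 UNIV]
    by eventually_elim (auto simp: B_def fun_eq_iff)
  ultimately have "filterlim B (at \<beta> within racah_regular p N \<nu>) (at 0)"
    by (simp add: filterlim_at)
  then have "filterlim B bot (at (0 :: real))" unfolding bot .
  then show False by (simp add: filterlim_def bot_unique filtermap_bot_iff)
qed

lemma racah_weighted_orthonormal_eq:
  assumes ns: "racah_nonsingular p N \<beta>" and nz: "racah_norm_reduced p N \<nu> \<beta> \<noteq> 0" and x: "x \<in> racah_lattice p N"
  shows "racah_weighted_orthonormal p N \<nu> x \<beta>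
       = racah_poly p N \<nu> x \<beta> * sqrt (racah_weight_reduced p N x \<beta> / racah_norm_reduced p N \<nu> \<beta>)"
proof (cases "\<beta> \<in> racah_regular p N \<nu>")
  case True
  then show ?thesis
    by (simp add: racah_weighted_orthonormal_def Let_def racah_quotient_eq [OF True ns x])
next
  case False
  let ?R = "racah_regular p N \<nu>"
  define F where "F = at \<beta> within ?R"
  have B: "((\<lambda>b. b j) \<longlongrightarrow> \<beta> j) F" for j
  proof -
    have "continuous_on UNIV (\<lambda>b :: nat \<Rightarrow> real. b j)" by simp
    then have "isCont (\<lambda>b :: nat \<Rightarrow> real. b j) \<beta>" by (simp only: continuous_on_eq_continuous_at open_UNIV
        UNIV_I ball_UNIV simp_thms)
    then show ?thesis unfolding F_def isCont_def by (rule filterlim_mono) (auto intro: at_le)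
  qed
  have lim: "((\<lambda>b. racah_poly p N \<nu> x b * sqrt (racah_weight_reduced p N x b / racah_norm_reduced p N \<nu> b))
     \<longlongrightarrow> racah_poly p N \<nu> x \<beta> * sqrt (racah_weight_reduced p N x \<beta> / racah_norm_reduced p N \<nu> \<beta>)) F"
    by (intro tendsto_intros tendsto_racah_poly tendsto_racah_weight_reduced tendsto_racah_norm_reduced B
        ns nz x)
  have "\<forall>\<^sub>F b in F. b \<in> ?R" unfolding F_def by (auto simp: eventually_at_filter)
  moreover have "\<forall>\<^sub>F b in F. racah_nonsingular p N b" by (rule eventually_racah_nonsingular [OF B ns])
  ultimately have "\<forall>\<^sub>F b in F. racah_poly p N \<nu> x b * sqrt (racah_weight p N x b / racah_norm_sq p N \<nu> b)
      = racah_poly p N \<nu> x b * sqrt (racah_weight_reduced p N x b / racah_norm_reduced p N \<nu> b)"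
    by eventually_elim (simp add: racah_quotient_eq x)
  then have "((\<lambda>b. racah_poly p N \<nu> x b * sqrt (racah_weight p N x b / racah_norm_sq p N \<nu> b))
     \<longlongrightarrow> racah_poly p N \<nu> x \<beta> * sqrt (racah_weight_reduced p N x \<beta> / racah_norm_reduced p N \<nu> \<beta>)) F"
    using lim by (simp only: tendsto_cong)
  then have "Lim F (\<lambda>b. racah_poly p N \<nu> x b * sqrt (racah_weight p N x b / racah_norm_sq p N \<nu> b))
     = racah_poly p N \<nu> x \<beta> * sqrt (racah_weight_reduced p N x \<beta> / racah_norm_reduced p N \<nu> \<beta>)"
    by (rule tendsto_Lim [rotated]) (simp add: F_def racah_regular_limit_point [OF ns nz])
  then show ?thesis using False by (simp add: racah_weighted_orthonormal_def Let_def F_def)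
qed

lemma racah_weighted_orthonormal_cong:
  assumes "\<And>j. j \<in> {1..p} \<Longrightarrow> x j = x' j"
  shows "racah_weighted_orthonormal p N \<nu> x \<beta> = racah_weighted_orthonormal p N \<nu> x' \<beta>"
proof -
  have e: "racah_ext p N x j = racah_ext p N x' j" if "j \<le> Suc p" for j
    using that assms by (auto simp: racah_ext_def)
  have "racah_poly p N \<nu> x \<beta> = racah_poly p N \<nu> x' \<beta>" for \<beta>
    unfolding racah_poly_def Let_def by (intro prod.cong refl) (simp add: e)
  moreover have "racah_weight p N x \<beta> = racah_weight p N x' \<beta>" for \<beta>
    unfolding racah_weight_def Let_def
    by (intro arg_cong2 [where f = "(*)"] prod.cong refl) (auto simp: e)
  ultimately show ?thesis by (simp add: racah_weighted_orthonormal_def)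
qed

text \<open>
If the squared length \<open>k * \<Sum> w R\<^sup>2\<close> is \<open>1\<close>, then \<open>k\<close> is the reciprocal of the reduced norm of
the Racah polynomial. In particular that norm is not \<open>0\<close>, which the passage to the limit needs.
\<close>

lemma unit_vector_racah:
  assumes bij: "bij_betw X M (racah_lattice p N)" and ns: "racah_nonsingular p N \<beta>"
    and U: "\<And>\<nu>. \<nu> \<in> M \<Longrightarrow> U \<nu> = sg \<nu> * (racah_poly p N idx (X \<nu>) \<beta> * t \<nu>)"
    and sg: "\<And>\<nu>. \<nu> \<in> M \<Longrightarrow> (sg \<nu>)\<^sup>2 = 1" and t: "\<And>\<nu>. \<nu> \<in> M \<Longrightarrow> t \<nu> \<ge> 0"
    and tk: "\<And>\<nu>. \<nu> \<in> M \<Longrightarrow> (t \<nu>)\<^sup>2 = k * racah_weight_reduced p N (X \<nu>) \<beta>"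
    and one: "(\<Sum>\<nu>\<in>M. (U \<nu>)\<^sup>2) = 1" and n: "\<nu> \<in> M"
  shows "U \<nu> = sg \<nu> * racah_weighted_orthonormal p N idx (X \<nu>) \<beta>"
proof -
  have "(\<Sum>\<nu>\<in>M. (U \<nu>)\<^sup>2) = (\<Sum>\<nu>\<in>M. k * (racah_weight_reduced p N (X \<nu>) \<beta> * (racah_poly p N idx (X \<nu>) \<beta>)\<^sup>2))"
    by (intro sum.cong refl) (simp add: U power_mult_distrib sg tk)
  also have "\<dots> = k * (\<Sum>\<nu>\<in>M. racah_weight_reduced p N (X \<nu>) \<beta> * (racah_poly p N idx (X \<nu>) \<beta>)\<^sup>2)"
    by (simp only: sum_distrib_left)
  also have "(\<Sum>\<nu>\<in>M. racah_weight_reduced p N (X \<nu>) \<beta> * (racah_poly p N idx (X \<nu>) \<beta>)\<^sup>2)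
      = racah_norm_reduced p N idx \<beta>"
    unfolding racah_norm_reduced_def by (rule sum.reindex_bij_betw [OF bij])
  finally have kS: "k * racah_norm_reduced p N idx \<beta> = 1" using one by simp
  then have S: "racah_norm_reduced p N idx \<beta> \<noteq> 0" by auto
  have x: "X \<nu> \<in> racah_lattice p N" using bij n by (auto simp: bij_betw_def)
  have "racah_weight_reduced p N (X \<nu>) \<beta> / racah_norm_reduced p N idx \<beta> = (t \<nu>)\<^sup>2"
    unfolding tk [OF n] using kS S by (simp add: field_simps)
  then have "sqrt (racah_weight_reduced p N (X \<nu>) \<beta> / racah_norm_reduced p N idx \<beta>) = t \<nu>"
    using t [OF n] by simp
  then show ?thesis using racah_weighted_orthonormal_eq [OF ns S x] U [OF n] by simp
qed

section \<open>Lattice points and parameters attached to multi-indices\<close>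

lemma sum_params_ge:
  fixes \<kappa> :: "nat \<Rightarrow> real"
  assumes k: "integrable_exponents d \<kappa>" and S: "S \<subseteq> {1..d+1}"
  shows "sum \<kappa> S + real (card S) \<ge> 0" "S \<noteq> {} \<Longrightarrow> sum \<kappa> S + real (card S) > 0"
proof -
  have e: "sum \<kappa> S + real (card S) = (\<Sum>i\<in>S. \<kappa> i + 1)" by (simp add: sum.distrib)
  have fin: "finite S" using S finite_subset by blast
  have pos: "\<kappa> i + 1 > 0" if "i \<in> S" for i
  proof -
    have "\<kappa> i > -1" using k S that by blast
    then show ?thesis by linarith
  qed
  show "sum \<kappa> S + real (card S) \<ge> 0" unfolding e by (rule sum_nonneg) (use pos in \<open>auto intro: less_imp_le\<close>)
  show "sum \<kappa> S + real (card S) > 0" if "S \<noteq> {}" unfolding e by (rule sum_pos [OF fin that pos])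
qed

text \<open>
The parameters of the first representation. They are attached to tail sums of \<open>\<nu>\<close> as lattice
points, those of the second, \<open>head_params\<close>, to head sums of \<open>\<mu>\<close>.
\<close>

definition tail_params :: "nat \<Rightarrow> (nat \<Rightarrow> real) \<Rightarrow> nat \<Rightarrow> real" where
  "tail_params d \<kappa> j = \<kappa> 1 + (\<Sum>i=d+2-j..d+1. \<kappa> i) + real j"

definition head_params :: "nat \<Rightarrow> nat \<Rightarrow> (nat \<Rightarrow> real) \<Rightarrow> nat \<Rightarrow> real" where
  "head_params d n \<kappa> j = (if j = 0 then \<kappa> 1 else - (\<Sum>i=j+1..d+1. \<kappa> i) - 2 * real n - real d + real j)"

definition tail_point :: "nat \<Rightarrow> (nat \<Rightarrow> nat) \<Rightarrow> nat \<Rightarrow> nat" where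
  "tail_point d \<nu> j = (if j \<in> {1..d - 1} then tail_sum d \<nu> (d + 1 - j) else 0)"

definition head_point :: "nat \<Rightarrow> (nat \<Rightarrow> nat) \<Rightarrow> nat \<Rightarrow> nat" where
  "head_point d \<mu> j = (if j \<in> {1..d - 1} then \<Sum>i=1..j. \<mu> i else 0)"

lemma multi_idx_tail_sum: "\<nu> \<in> multi_idx d n \<Longrightarrow> tail_sum d \<nu> 1 = n"
  by (simp add: multi_idx_def tail_sum_def)

lemma racah_ext_tail_point:
  assumes "\<nu> \<in> multi_idx d n" "j \<le> d" "d \<ge> 1"
  shows "racah_ext (d - 1) n (tail_point d \<nu>) j = tail_sum d \<nu> (d + 1 - j)"
  using assms multi_idx_tail_sum [OF assms(1)]
  by (cases "j = 0") (auto simp: racah_ext_def tail_point_def)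

lemma head_sum_add_tail_sum:
  assumes "\<mu> \<in> multi_idx d n" "j \<le> d"
  shows "(\<Sum>i=1..j. \<mu> i) + tail_sum d \<mu> (Suc j) = n"
proof -
  have "(\<Sum>i=1..d. \<mu> i) = (\<Sum>i=1..j. \<mu> i) + (\<Sum>i=Suc j..d. \<mu> i)"
    using sum.ub_add_nat [of 1 j \<mu> "d - j"] assms(2) by simp
  then show ?thesis using assms(1) by (simp add: multi_idx_def tail_sum_def)
qed

lemma racah_ext_head_point:
  assumes m: "\<mu> \<in> multi_idx d n" and "j \<le> d" and d: "d \<ge> 1"
  shows "racah_ext (d - 1) n (head_point d \<mu>) j + tail_sum d \<mu> (Suc j) = n"
proof -
  consider "j = 0" | "j = d" | "j \<in> {1..d - 1}" using assms(2) by fastforce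
  then show ?thesis
  proof cases
    case 1
    then show ?thesis using multi_idx_tail_sum [OF m] d by (simp add: racah_ext_def)
  next
    case 2
    then show ?thesis using d by (simp add: racah_ext_def)
  next
    case 3
    then have "racah_ext (d - 1) n (head_point d \<mu>) j = (\<Sum>i=1..j. \<mu> i)"
      by (auto simp: racah_ext_def head_point_def)
    then show ?thesis using head_sum_add_tail_sum [OF m assms(2)] by simp
  qed
qed

lemma tail_sum_differences:
  fixes E :: "nat \<Rightarrow> nat"
  assumes mono: "\<And>j. j < d \<Longrightarrow> E j \<le> E (Suc j)" and j: "1 \<le> j" "j \<le> Suc d"
  shows "tail_sum d (\<lambda>i. E (d + 1 - i) - E (d - i)) j = E (d + 1 - j) - E 0"
  using j(2,1)
proof (induction rule: inc_induct)
  case base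
  then show ?case by simp
next
  case (step j)
  have E0: "E 0 \<le> E i" if "i \<le> d" for i using that
  proof (induction i)
    case (Suc i)
    then have "E 0 \<le> E i" "E i \<le> E (Suc i)" using mono by auto
    then show ?case by simp
  qed simp
  have "d + 1 - j = Suc (d - j)" using step by simp
  moreover have "E 0 \<le> E (d - j)" using E0 [of "d - j"] by simp
  moreover have "E (d - j) \<le> E (Suc (d - j))" using mono [of "d - j"] step by simp
  ultimately show ?case using step by (simp add: tail_sum_rec)
qed

lemma bij_betw_tail_point:
  assumes d: "d \<ge> 1"
  shows "bij_betw (tail_point d) (multi_idx d n) (racah_lattice (d - 1) n)"
proof -
  define inv where "inv y = (\<lambda>i. if i \<in> {1..d} then racah_ext (d - 1) n y (d + 1 - i) - racah_ext (d - 1)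
      n y (d - i) else 0)" for y
  have sd: "Suc (d - 1) = d" using d by simp
  show ?thesis
  proof (rule bij_betw_byWitness [where f' = inv])
    show "\<forall>\<nu>\<in>multi_idx d n. inv (tail_point d \<nu>) = \<nu>"
    proof
      fix \<nu> assume n: "\<nu> \<in> multi_idx d n"
      show "inv (tail_point d \<nu>) = \<nu>"
      proof
        fix i
        show "inv (tail_point d \<nu>) i = \<nu> i"
        proof (cases "i \<in> {1..d}")
          case True
          have "racah_ext (d - 1) n (tail_point d \<nu>) (d + 1 - i) = tail_sum d \<nu> (d + 1 - (d + 1 - i))"
            by (rule racah_ext_tail_point [OF n _ d]) (use True in auto)
          moreover have "racah_ext (d - 1) n (tail_point d \<nu>) (d - i) = tail_sum d \<nu> (d + 1 - (d - i))"
            by (rule racah_ext_tail_point [OF n _ d]) auto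
          moreover have "d + 1 - (d + 1 - i) = i" "d + 1 - (d - i) = Suc i" using True by auto
          ultimately have "inv (tail_point d \<nu>) i = tail_sum d \<nu> i - tail_sum d \<nu> (Suc i)"
            using True unfolding inv_def by (simp only: if_True)
          then show ?thesis using True by (simp add: tail_sum_rec)
        next
          case False
          then show ?thesis using n by (auto simp: inv_def multi_idx_def)
        qed
      qed
    qed
    have T: "tail_sum d (inv y) j = racah_ext (d - 1) n y (d + 1 - j)"
      if y: "y \<in> racah_lattice (d - 1) n" and j: "1 \<le> j" "j \<le> Suc d" for y j
    proof -
      have "tail_sum d (inv y) j = tail_sum d (\<lambda>i. racah_ext (d - 1) n y (d + 1 - i) - racah_ext (d - 1) n
          y (d - i)) j"
        by (rule tail_sum_cong) (use j in \<open>auto simp: inv_def\<close>)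
      also have "\<dots> = racah_ext (d - 1) n y (d + 1 - j) - racah_ext (d - 1) n y 0"
        by (rule tail_sum_differences) (use j racah_ext_mono [OF y] in auto)
      finally show ?thesis by (simp add: racah_ext_simps)
    qed
    show "\<forall>y\<in>racah_lattice (d - 1) n. tail_point d (inv y) = y"
    proof
      fix y assume y: "y \<in> racah_lattice (d - 1) n"
      show "tail_point d (inv y) = y"
      proof
        fix j
        show "tail_point d (inv y) j = y j"
        proof (cases "j \<in> {1..d - 1}")
          case True
          then have "1 \<le> d + 1 - j" "d + 1 - j \<le> Suc d" "d + 1 - (d + 1 - j) = j" by auto
          then show ?thesis using True T [OF y, of "d + 1 - j"] by (simp add: tail_point_def racah_ext_simps)
        next
          case False
          then have "y j = 0" using y by (simp add: racah_lattice_def)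
          then show ?thesis using False by (simp only: tail_point_def if_False)
        qed
      qed
    qed
    show "tail_point d ` multi_idx d n \<subseteq> racah_lattice (d - 1) n"
    proof (rule image_subsetI)
      fix \<nu> assume n: "\<nu> \<in> multi_idx d n"
      have mono: "tail_sum d \<nu> i \<le> tail_sum d \<nu> j" if "j \<le> i" for i j
        unfolding tail_sum_def by (rule sum_mono2) (use that in auto)
      have "tail_sum d \<nu> i \<le> n" if "1 \<le> i" for i
        using mono [OF that] multi_idx_tail_sum [OF n] by simp
      then show "tail_point d \<nu> \<in> racah_lattice (d - 1) n"
        unfolding racah_lattice_def tail_point_def by (auto intro!: mono)
    qed
    show "inv ` racah_lattice (d - 1) n \<subseteq> multi_idx d n"
    proof (rule image_subsetI)
      fix y assume y: "y \<in> racah_lattice (d - 1) n"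
      have "tail_sum d (inv y) 1 = n"
        using T [OF y, of 1] racah_ext_simps(1) [of "d - 1" n y] sd by simp
      then show "inv y \<in> multi_idx d n" by (auto simp: multi_idx_def tail_sum_def inv_def)
    qed
  qed
qed

definition reverse_idx :: "nat \<Rightarrow> (nat \<Rightarrow> nat) \<Rightarrow> nat \<Rightarrow> nat" where
  "reverse_idx d \<mu> i = (if i \<in> {1..d} then \<mu> (d + 1 - i) else 0)"

lemma sum_reverse:
  fixes f :: "nat \<Rightarrow> 'a :: comm_monoid_add"
  assumes "j \<le> d"
  shows "(\<Sum>i=d+1-j..d. f (d + 1 - i)) = (\<Sum>i=1..j. f i)"
  by (rule sum.reindex_bij_witness [where i = "\<lambda>i. d + 1 - i" and j = "\<lambda>i. d + 1 - i"]) (use assms in auto)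

lemma bij_betw_reverse_idx: "bij_betw (reverse_idx d) (multi_idx d n) (multi_idx d n)"
proof -
  have inv: "reverse_idx d (reverse_idx d \<mu>) = \<mu>" if "\<mu> \<in> multi_idx d n" for \<mu>
  proof
    fix i
    show "reverse_idx d (reverse_idx d \<mu>) i = \<mu> i"
      using that by (cases "i \<in> {1..d}") (auto simp: reverse_idx_def multi_idx_def)
  qed
  have mem: "reverse_idx d \<mu> \<in> multi_idx d n" if "\<mu> \<in> multi_idx d n" for \<mu>
  proof -
    have "(\<Sum>i=1..d. reverse_idx d \<mu> i) = (\<Sum>i=d+1-d..d. \<mu> (d + 1 - i))"
      by (intro sum.cong) (auto simp: reverse_idx_def)
    also have "\<dots> = n" unfolding sum_reverse [OF order_refl] using that by (simp add: multi_idx_def)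
    finally show ?thesis by (auto simp: multi_idx_def reverse_idx_def)
  qed
  show ?thesis by (rule bij_betw_byWitness [where f' = "reverse_idx d"]) (use inv mem in auto)
qed

lemma head_point_eq: "head_point d \<mu> = tail_point d (reverse_idx d \<mu>)"
proof
  fix j
  show "head_point d \<mu> j = tail_point d (reverse_idx d \<mu>) j"
  proof (cases "j \<in> {1..d - 1}")
    case True
    then have j: "j \<le> d" by auto
    have "tail_sum d (reverse_idx d \<mu>) (d + 1 - j) = (\<Sum>i=d+1-j..d. \<mu> (d + 1 - i))"
      unfolding tail_sum_def using j by (intro sum.cong refl) (auto simp: reverse_idx_def)
    then show ?thesis using True unfolding sum_reverse [OF j] by (simp add: head_point_def tail_point_def)
  next
    case False
    then show ?thesis by (simp only: head_point_def tail_point_def if_False)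
  qed
qed

lemma bij_betw_head_point:
  assumes d: "d \<ge> 1"
  shows "bij_betw (head_point d) (multi_idx d n) (racah_lattice (d - 1) n)"
proof -
  have "head_point d = tail_point d \<circ> reverse_idx d" by (auto simp: head_point_eq)
  then show ?thesis using bij_betw_trans [OF bij_betw_reverse_idx bij_betw_tail_point [OF d]] by simp
qed

lemma real_diff_of_sum: "a + b = (n :: nat) \<Longrightarrow> real a = real n - real b"
  by auto

section \<open>Racah polynomials as products along the cycle\<close>

lemma terminating_4F3_cong:
  "a = a' \<Longrightarrow> b = b' \<Longrightarrow> c = c' \<Longrightarrow> u = u' \<Longrightarrow> v = v' \<Longrightarrow> t = t'
    \<Longrightarrow> terminating_4F3 m a b c u v t = terminating_4F3 m a' b' c' u' v' t'"
  by simp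

lemma tail_params_Suc:
  assumes "q < d"
  shows "tail_params d \<kappa> (Suc q) = tail_params d \<kappa> q + \<kappa> (d + 1 - q) + 1"
proof -
  have "(\<Sum>i=d+2-Suc q..d+1. \<kappa> i) = \<kappa> (d + 1 - q) + (\<Sum>i=d+2-q..d+1. \<kappa> i)"
    using assms by (subst sum.atLeast_Suc_atMost) (auto simp: Suc_diff_le)
  then show ?thesis by (simp add: tail_params_def)
qed

lemma tail_params_param:
  assumes "1 \<le> i" "i \<le> d"
  shows "jparam d \<kappa> \<mu> i = tail_params d \<kappa> (d + 1 - i) - \<kappa> 1 - 1 + 2 * real (tail_sum d \<mu> (Suc i))"
proof -
  have e: "d + 2 - (d + 1 - i) = i + 1" "real (d + 1 - i) = real (d - i) + 1" using assms by auto
  show ?thesis unfolding simplex_jacobi_param_tail tail_params_def e by simp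
qed

text \<open>
The \<open>\<^sub>4F\<^sub>3\<close> of \<open>swap_coeff_last\<close> in the exchange with \<open>x\<^sub>i\<close>. The differences are taken between real
numbers, so that the term is also defined for index pairs where they are negative.
\<close>

definition tail_factor :: "nat \<Rightarrow> (nat \<Rightarrow> real) \<Rightarrow> (nat \<Rightarrow> nat) \<Rightarrow> (nat \<Rightarrow> nat) \<Rightarrow> nat \<Rightarrow> real" where
  "tail_factor d \<kappa> \<nu> \<mu> i =
     (let a = jparam d \<kappa> \<mu> i; p = real (tail_sum d \<nu> i) - real (tail_sum d \<mu> (Suc i));
            N = real (tail_sum d \<nu> (i - 1)) - real (tail_sum d \<mu> (Suc i))
          in terminating_4F3 (\<mu> i) (real (\<mu> i) + a + \<kappa> i + 1) (- p) (p + a + \<kappa> 1 + 1)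
               (a + 1) (N + a + \<kappa> 1 + \<kappa> i + 2) (- N))"

text \<open>
The \<open>\<^sub>4F\<^sub>3\<close> of \<open>swap_coeff_first\<close> in the same exchange.
\<close>

definition head_factor :: "nat \<Rightarrow> (nat \<Rightarrow> real) \<Rightarrow> (nat \<Rightarrow> nat) \<Rightarrow> (nat \<Rightarrow> nat) \<Rightarrow> nat \<Rightarrow> real" where
  "head_factor d \<kappa> \<nu> \<mu> i =
     (let a = jparam d \<kappa> \<mu> i; p = real (tail_sum d \<nu> i) - real (tail_sum d \<mu> (Suc i));
            N = real (tail_sum d \<nu> (i - 1)) - real (tail_sum d \<mu> (Suc i)); m
                = real (tail_sum d \<nu> (i - 1)) - real (tail_sum d \<mu> i)
          in terminating_4F3 (\<nu> (i - 1)) (- (N + p + a + \<kappa> 1 + 1)) (- m) (- (real (\<mu> i) + N + a + \<kappa> i + 1))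
               (- 2 * N - a - \<kappa> 1 - \<kappa> i - 1) (- a - N) (- N))"

text \<open>
The \<open>j\<close>-th factor of the Racah polynomial belongs to the exchange of \<open>x\<^sub>1\<close> with \<open>x\<^sub>i\<close>, where
\<open>i = d + 1 - j\<close>: its lattice coordinates are \<open>|\<nu>\<^sup>i|\<close> and \<open>|\<nu>\<^bsup>i-1\<^esup>|\<close>, and the sum of its earlier
indices is \<open>|\<mu>\<^bsup>i+1\<^esup>|\<close>.
\<close>

lemma racah_poly_tail_point:
  assumes n: "\<nu> \<in> multi_idx d n" and d: "d \<ge> 1"
  shows "racah_poly (d - 1) n (\<lambda>j. \<mu> (d + 1 - j)) (tail_point d \<nu>) (tail_params d \<kappa>)
       = (\<Prod>i=2..d. tail_factor d \<kappa> \<nu> \<mu> i)"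
proof -
  define X where "X = racah_ext (d - 1) n (tail_point d \<nu>)"
  define \<beta> where "\<beta> = tail_params d \<kappa>"
  define R where "R j = (let s = real (\<Sum>i=1..<j. \<mu> (d + 1 - i)) in
        terminating_4F3 (\<mu> (d + 1 - j))
          (real (\<mu> (d + 1 - j)) + 2 * s + \<beta> (j + 1) - \<beta> 0 - 1) (s - real (X j)) (s + \<beta> j + real (X j))
          (2 * s + \<beta> j - \<beta> 0) (s + \<beta> (j + 1) + real (X (j + 1))) (s - real (X (j + 1))))" for j
  have RT: "R j = tail_factor d \<kappa> \<nu> \<mu> (d + 1 - j)" if j: "j \<in> {1..d - 1}" for j
  proof -
    define i where "i = d + 1 - j"
    have i: "2 \<le> i" "i \<le> d" "j = d + 1 - i" "d + 1 - (j + 1) = i - 1" "d + 1 - j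
        = i" using j by (auto simp: i_def)
    have s: "(\<Sum>i'=1..<j. \<mu> (d + 1 - i')) = tail_sum d \<mu> (Suc i)"
      unfolding tail_sum_def
      by (rule sum.reindex_bij_witness [where i = "\<lambda>i. d + 1 - i" and j
          = "\<lambda>i. d + 1 - i"]) (use j in \<open>auto simp: i_def\<close>)
    have jd: "j \<le> d" "j + 1 \<le> d" using j by auto
    have X: "X j = tail_sum d \<nu> i" "X (j + 1) = tail_sum d \<nu> (i - 1)"
      using racah_ext_tail_point [OF n jd(1) d] racah_ext_tail_point [OF n jd(2) d] unfolding i(4,5) X_def .
    have a: "jparam d \<kappa> \<mu> i = \<beta> j - \<kappa> 1 - 1 + 2 * real (tail_sum d \<mu> (Suc i))"
      using tail_params_param [of i d \<kappa> \<mu>] i by (simp add: \<beta>_def)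
    have b1: "\<beta> (j + 1) = \<beta> j + \<kappa> i + 1"
      using tail_params_Suc [of j d \<kappa>] jd by (simp add: i_def \<beta>_def)
    have b0: "\<beta> 0 = \<kappa> 1" by (simp add: tail_params_def \<beta>_def)
    show ?thesis
      unfolding R_def tail_factor_def Let_def i(5) s X a b1 b0
      by (rule terminating_4F3_cong; simp add: algebra_simps)
  qed
  have "racah_poly (d - 1) n (\<lambda>j. \<mu> (d + 1 - j)) (tail_point d \<nu>) (tail_params d \<kappa>) = (\<Prod>j=1..d - 1. R j)"
    unfolding racah_poly_def X_def [symmetric] \<beta>_def [symmetric] R_def Let_def ..
  also have "\<dots> = (\<Prod>j=1..d - 1. tail_factor d \<kappa> \<nu> \<mu> (d + 1 - j))" by (intro prod.cong refl RT)
  also have "\<dots> = (\<Prod>i=2..d. tail_factor d \<kappa> \<nu> \<mu> i)"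
    by (rule prod.reindex_bij_witness [where i = "\<lambda>i. d + 1 - i" and j = "\<lambda>i. d + 1 - i"]) (use d in auto)
  finally show ?thesis .
qed

lemma head_params_pos_idx:
  "j \<ge> 1 \<Longrightarrow> head_params d n \<kappa> j = - (\<Sum>i=j+1..d+1. \<kappa> i) - 2 * real n - real d + real j"
  by (simp add: head_params_def)

lemma head_params_param:
  assumes "1 \<le> i" "i \<le> d"
  shows "head_params d n \<kappa> i = 2 * real (tail_sum d \<mu> (Suc i)) - 2 * real n - jparam d \<kappa> \<mu> i"
  using assms by (simp add: head_params_pos_idx simplex_jacobi_param_tail of_nat_diff)

lemma head_params_Suc:
  assumes "1 \<le> j" "j < d"
  shows "head_params d n \<kappa> (Suc j) = head_params d n \<kappa> j + \<kappa> (Suc j) + 1"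
proof -
  have "(\<Sum>i=j+1..d+1. \<kappa> i) = \<kappa> (Suc j) + (\<Sum>i=Suc j+1..d+1. \<kappa> i)"
    using assms by (subst sum.atLeast_Suc_atMost) auto
  then show ?thesis using assms by (simp add: head_params_pos_idx)
qed

text \<open>
Now the \<open>j\<close>-th factor belongs to the exchange of \<open>x\<^sub>1\<close> with \<open>x\<^bsub>j+1\<^esub>\<close>. Head sums turn into tail sums
because \<open>|\<nu>| = |\<mu>| = n\<close>.
\<close>

lemma racah_poly_head_point:
  assumes n: "\<nu> \<in> multi_idx d n" and m: "\<mu> \<in> multi_idx d n" and d: "d \<ge> 1"
  shows "racah_poly (d - 1) n \<nu> (head_point d \<mu>) (head_params d n \<kappa>)
       = (\<Prod>i=2..d. head_factor d \<kappa> \<nu> \<mu> i)"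
proof -
  define X where "X = racah_ext (d - 1) n (head_point d \<mu>)"
  define \<beta> where "\<beta> = head_params d n \<kappa>"
  define R where "R j = (let s = real (\<Sum>i=1..<j. \<nu> i) in
        terminating_4F3 (\<nu> j)
          (real (\<nu> j) + 2 * s + \<beta> (j + 1) - \<beta> 0 - 1) (s - real (X j)) (s + \<beta> j + real (X j))
          (2 * s + \<beta> j - \<beta> 0) (s + \<beta> (j + 1) + real (X (j + 1))) (s - real (X (j + 1))))" for j
  have RT: "R j = head_factor d \<kappa> \<nu> \<mu> (Suc j)" if j: "j \<in> {1..d - 1}" for j
  proof -
    have jd: "1 \<le> j" "j < d" "j \<le> d" "Suc j \<le> d" using j d by auto
    have "(\<Sum>i=1..<j. \<nu> i) + tail_sum d \<nu> j = n"
    proof -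
      obtain k where k: "j = Suc k" using jd by (cases j) auto
      show ?thesis using head_sum_add_tail_sum [OF n, of k] jd unfolding k
          by (simp add: atLeastLessThanSuc_atLeastAtMost)
    qed
    then have s: "real (\<Sum>i=1..<j. \<nu> i) = real n - real (tail_sum d \<nu> j)" by (rule real_diff_of_sum)
    have X1: "real (X j) = real n - real (tail_sum d \<mu> (Suc j))"
      unfolding X_def by (rule real_diff_of_sum [OF racah_ext_head_point [OF m jd(3) d]])
    have X2: "real (X (Suc j)) = real n - real (tail_sum d \<mu> (Suc (Suc j)))"
      unfolding X_def by (rule real_diff_of_sum [OF racah_ext_head_point [OF m jd(4) d]])
    define a where "a = jparam d \<kappa> \<mu> (Suc j)"
    have b1: "\<beta> (Suc j) = 2 * real (tail_sum d \<mu> (Suc (Suc j))) - 2 * real n - a"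
      unfolding a_def \<beta>_def by (rule head_params_param) (use jd in auto)
    have b: "\<beta> j = 2 * real (tail_sum d \<mu> (Suc (Suc j))) - 2 * real n - a - \<kappa> (Suc j) - 1"
      using head_params_Suc [OF jd(1,2), of n \<kappa>] b1 by (simp add: \<beta>_def)
    have b0: "\<beta> 0 = \<kappa> 1" by (simp add: head_params_def \<beta>_def)
    have t1: "real (tail_sum d \<nu> j) = real (\<nu> j) + real (tail_sum d \<nu> (Suc j))" using jd
        by (simp add: tail_sum_rec)
    have t2: "real (tail_sum d \<mu> (Suc j)) = real (\<mu> (Suc j)) + real (tail_sum d \<mu> (Suc (Suc j)))" using jd
        by (simp add: tail_sum_rec)
    have ij: "j + 1 = Suc j" "Suc j - 1 = j" by simp_all
    show ?thesis
      unfolding R_def head_factor_def Let_def ij a_def [symmetric] s X1 X2 b1 b b0 t1 t2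
      by (rule terminating_4F3_cong; simp add: algebra_simps)
  qed
  have "racah_poly (d - 1) n \<nu> (head_point d \<mu>) (head_params d n \<kappa>) = (\<Prod>j=1..d - 1. R j)"
    unfolding racah_poly_def X_def [symmetric] \<beta>_def [symmetric] R_def Let_def ..
  also have "\<dots> = (\<Prod>j=1..d - 1. head_factor d \<kappa> \<nu> \<mu> (Suc j))" by (intro prod.cong refl RT)
  also have "\<dots> = (\<Prod>i=2..d. head_factor d \<kappa> \<nu> \<mu> i)"
    by (rule prod.reindex_bij_witness [where i = "\<lambda>i. i - 1" and j = Suc]) (use d in auto)
  finally show ?thesis .
qed

text \<open>
At the last place where the degree carried by \<open>x\<^sub>1\<close> would become negative, the numbers that occur
are still nonnegative and the \<open>\<^sub>4F\<^sub>3\<close> vanishes by \<open>terminating_4F3_eq_0\<close>.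
\<close>

lemma racah_poly_tail_point_zero:
  assumes n: "\<nu> \<in> multi_idx d n" and d: "d \<ge> 1" and na: "\<not> admissible d \<nu> \<mu>"
  shows "racah_poly (d - 1) n (\<lambda>j. \<mu> (d + 1 - j)) (tail_point d \<nu>) (tail_params d \<kappa>) = 0"
proof -
  define S where "S = {i \<in> {2..d}. tail_sum d \<mu> i > tail_sum d \<nu> (i - 1)}"
  have "finite S" by (simp add: S_def)
  moreover obtain i0 where "i0 \<in> {2..d}" "\<not> tail_sum d \<mu> i0 \<le> tail_sum d \<nu> (i0 - 1)"
    using na unfolding admissible_def by blast
  then have "S \<noteq> {}" by (auto simp: S_def)
  ultimately
  have mem: "Max S \<in> S" and max: "\<And>i. i \<in> S \<Longrightarrow> i \<le> Max S" by auto
  define i where "i = Max S"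
  have i: "i \<in> {2..d}" "tail_sum d \<mu> i > tail_sum d \<nu> (i - 1)" using mem by (auto simp: S_def i_def)
  have le: "tail_sum d \<mu> (Suc i) \<le> tail_sum d \<nu> i"
  proof (rule ccontr)
    assume *: "\<not> ?thesis"
    then have "Suc i \<le> d" by (metis le0 not_le tail_sum_beyond)
    with * have "Suc i \<in> S" using i by (auto simp: S_def)
    then show False using max by (fastforce simp: i_def)
  qed
  have le': "tail_sum d \<nu> i \<le> tail_sum d \<nu> (i - 1)"
    unfolding tail_sum_def by (rule sum_mono2) auto
  define p where "p = tail_sum d \<nu> i - tail_sum d \<mu> (Suc i)"
  define N where "N = tail_sum d \<nu> (i - 1) - tail_sum d \<mu> (Suc i)"
  have pN: "p \<le> N" using le' by (simp add: p_def N_def)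
  have "N < \<mu> i"
    using i le le' tail_sum_rec [of i d \<mu>] by (simp add: N_def)
  moreover have "real p = real (tail_sum d \<nu> i) - real (tail_sum d \<mu> (Suc i))"
    "real N = real (tail_sum d \<nu> (i - 1)) - real (tail_sum d \<mu> (Suc i))"
    using le le' by (simp_all add: p_def N_def of_nat_diff)
  ultimately have "tail_factor d \<kappa> \<nu> \<mu> i = 0"
    unfolding tail_factor_def Let_def using terminating_4F3_eq_0 [OF pN] by metis
  then show ?thesis
    unfolding racah_poly_tail_point [OF n d] using i by (intro prod_zero) auto
qed

text \<open>
Here the first such place has to be taken, because the roles of \<open>\<nu>\<close> and \<open>\<mu>\<close> in the \<open>\<^sub>4F\<^sub>3\<close> are
exchanged; the factor that vanishes belongs to the exchange before it.
\<close>

lemma racah_poly_head_point_zero: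
  assumes n: "\<nu> \<in> multi_idx d n" and m: "\<mu> \<in> multi_idx d n" and d: "d \<ge> 1" and na: "\<not> admissible d \<nu> \<mu>"
  shows "racah_poly (d - 1) n \<nu> (head_point d \<mu>) (head_params d n \<kappa>) = 0"
proof -
  define S where "S = {i \<in> {2..d}. tail_sum d \<mu> i > tail_sum d \<nu> (i - 1)}"
  have "finite S" by (simp add: S_def)
  moreover obtain i0 where "i0 \<in> {2..d}" "\<not> tail_sum d \<mu> i0 \<le> tail_sum d \<nu> (i0 - 1)"
    using na unfolding admissible_def by blast
  then have "S \<noteq> {}" by (auto simp: S_def)
  ultimately
  have mem: "Min S \<in> S" and min: "\<And>i. i \<in> S \<Longrightarrow> Min S \<le> i" by auto
  have decr: "tail_sum d \<mu> (Suc j) \<le> tail_sum d \<mu> j" for j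
    unfolding tail_sum_def by (rule sum_mono2) auto
  have "Min S \<noteq> 2"
  proof
    assume "Min S = 2"
    then have "tail_sum d \<mu> 2 > tail_sum d \<nu> 1" using mem by (simp add: S_def)
    then show False
      using multi_idx_tail_sum [OF n] multi_idx_tail_sum [OF m] decr [of 1] by (simp add: numeral_2_eq_2)
  qed
  then obtain i where iS: "Min S = Suc i" and i: "i \<in> {2..d}" "Suc i \<le> d" "tail_sum d \<mu> (Suc i) > tail_sum
      d \<nu> i"
    using mem by (cases "Min S") (auto simp: S_def)
  have le: "tail_sum d \<mu> i \<le> tail_sum d \<nu> (i - 1)"
  proof (rule ccontr)
    assume "\<not> ?thesis"
    then have "i \<in> S" using i by (auto simp: S_def)
    then show False using min [of i] iS by simp
  qed
  define q where "q = tail_sum d \<nu> (i - 1) - tail_sum d \<mu> i"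
  define N where "N = tail_sum d \<nu> (i - 1) - tail_sum d \<mu> (Suc i)"
  have qN: "q \<le> N" using decr [of i] by (simp add: q_def N_def)
  have "N < \<nu> (i - 1)"
    using i le decr [of i] tail_sum_rec [of "i - 1" d \<nu>] by (simp add: N_def)
  moreover have "real q = real (tail_sum d \<nu> (i - 1)) - real (tail_sum d \<mu> i)"
    "real N = real (tail_sum d \<nu> (i - 1)) - real (tail_sum d \<mu> (Suc i))"
    using le decr [of i] by (simp_all add: q_def N_def of_nat_diff)
  ultimately have "head_factor d \<kappa> \<nu> \<mu> i = 0"
    unfolding head_factor_def Let_def using terminating_4F3_eq_0 [OF qN] by metis
  then show ?thesis
    unfolding racah_poly_head_point [OF n m d] using i by (intro prod_zero) auto
qed

lemma excess_facts:
  assumes ad: "admissible d \<nu> \<mu>" and i: "i \<in> {2..d}"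
  shows "excess d \<nu> \<mu> (i - 1) + \<mu> i = \<nu> (i - 1) + excess d \<nu> \<mu> i"
    "real (excess d \<nu> \<mu> i) = real (tail_sum d \<nu> i) - real (tail_sum d \<mu> (Suc i))"
    "real (excess d \<nu> \<mu> (i - 1)) = real (tail_sum d \<nu> (i - 1)) - real (tail_sum d \<mu> i)"
    "real (\<nu> (i - 1) + excess d \<nu> \<mu> i) = real (tail_sum d \<nu> (i - 1)) - real (tail_sum d \<mu> (Suc i))"
proof -
  have le1: "tail_sum d \<mu> i \<le> tail_sum d \<nu> (i - 1)" using ad i by (simp add: admissible_def)
  have le2: "tail_sum d \<mu> (Suc i) \<le> tail_sum d \<nu> i"
  proof (cases "Suc i \<le> d")
    case True
    then have "Suc i \<in> {2..d}" using i by simp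
    then have "tail_sum d \<mu> (Suc i) \<le> tail_sum d \<nu> (Suc i - 1)" using ad unfolding admissible_def by blast
    then show ?thesis by simp
  qed simp
  have r1: "tail_sum d \<nu> (i - 1) = \<nu> (i - 1) + tail_sum d \<nu> i"
  proof -
    have "i - 1 \<le> d" "Suc (i - 1) = i" using i by auto
    then show ?thesis using tail_sum_rec [of "i - 1" d \<nu>] by metis
  qed
  have r2: "tail_sum d \<mu> i = \<mu> i + tail_sum d \<mu> (Suc i)" using i by (simp add: tail_sum_rec)
  have si: "Suc (i - 1) = i" using i by simp
  show "excess d \<nu> \<mu> (i - 1) + \<mu> i = \<nu> (i - 1) + excess d \<nu> \<mu> i"
    using le1 le2 r1 r2 unfolding excess_def si by linarith
  show "real (excess d \<nu> \<mu> i) = real (tail_sum d \<nu> i) - real (tail_sum d \<mu> (Suc i))"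
    using le2 by (simp add: excess_def of_nat_diff)
  show "real (excess d \<nu> \<mu> (i - 1)) = real (tail_sum d \<nu> (i - 1)) - real (tail_sum d \<mu> i)"
    using le1 unfolding excess_def si by (simp add: of_nat_diff)
  show "real (\<nu> (i - 1) + excess d \<nu> \<mu> i) = real (tail_sum d \<nu> (i - 1)) - real (tail_sum d \<mu> (Suc i))"
    using le2 r1 by (simp add: excess_def of_nat_diff)
qed

lemma excess_ends:
  assumes n: "\<nu> \<in> multi_idx d n" and m: "\<mu> \<in> multi_idx d n" and d: "d \<ge> 1"
  shows "excess d \<nu> \<mu> d = \<nu> d" "excess d \<nu> \<mu> 1 = \<mu> 1"
proof -
  show "excess d \<nu> \<mu> d = \<nu> d" by (simp add: excess_def tail_sum_def)
  have "tail_sum d \<mu> 1 = \<mu> 1 + tail_sum d \<mu> 2" using d tail_sum_rec [of 1 d \<mu>] by (simp add: numeral_2_eq_2)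
  then show "excess d \<nu> \<mu> 1 = \<mu> 1"
    using multi_idx_tail_sum [OF n] multi_idx_tail_sum [OF m] by (simp add: excess_def numeral_2_eq_2)
qed

lemma prod_shift_pred:
  fixes f :: "nat \<Rightarrow> real"
  assumes d: "d \<ge> 1"
  shows "(\<Prod>i=2..d. f (i - 1)) * f d = (\<Prod>j=1..d. f j)"
proof -
  have "(\<Prod>i=2..d. f (i - 1)) = (\<Prod>j=1..d-1. f j)"
    by (rule prod.reindex_bij_witness [where i = Suc and j = "\<lambda>i. i - 1"]) (use d in auto)
  moreover obtain e where "d = Suc e" using d by (cases d) auto
  ultimately show ?thesis by simp
qed

lemma prod_sign:
  assumes n: "\<nu> \<in> multi_idx d n" and d: "d \<ge> 1"
  shows "(\<Prod>i=2..d. (-1 :: real) ^ \<nu> (i - 1)) = (-1) ^ (n + \<nu> d)"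
proof -
  have "(\<Prod>i=2..d. (-1 :: real) ^ \<nu> (i - 1)) * (-1) ^ \<nu> d = (-1) ^ n"
    using prod_shift_pred [OF d, of "\<lambda>i. (-1) ^ \<nu> i"] n by (simp add: multi_idx_def flip: power_sum)
  moreover have "(-1 :: real) ^ \<nu> d * (-1) ^ \<nu> d = 1" by (simp flip: power_mult_distrib)
  ultimately show ?thesis by (metis mult.assoc mult.right_neutral power_add)
qed

definition source_factor :: "nat \<Rightarrow> (nat \<Rightarrow> real) \<Rightarrow> (nat \<Rightarrow> nat) \<Rightarrow> real" where
  "source_factor d \<kappa> \<nu> = (\<Prod>j=1..d. poch (\<kappa> (Suc j) + 1) (\<nu> j) / fact (\<nu> j))"

definition target_factor :: "nat \<Rightarrow> (nat \<Rightarrow> real) \<Rightarrow> (nat \<Rightarrow> nat) \<Rightarrow> real" where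
  "target_factor d \<kappa> \<mu> = fact (\<mu> 1) / poch (jparam d \<kappa> \<mu> 1 + 1) (\<mu> 1) *
     (\<Prod>i=2..d. 1 / (poch (\<kappa> i + 1) (\<mu> i) * poch (jparam d \<kappa> \<mu> i + 1) (\<mu> i)
         * poch (real (\<mu> i) + jparam d \<kappa> \<mu> i + \<kappa> i + 1) (\<mu> i)))"

lemma pochhammer_param_pos:
  assumes k: "integrable_exponents d \<kappa>" and i: "i \<in> {1..d}"
  shows "poch (jparam d \<kappa> \<mu> i + 1) m > 0"
    "poch (\<kappa> i + 1) m > 0" "poch (\<kappa> (Suc i) + 1) m > 0"
    "poch (real l + jparam d \<kappa> \<mu> i + \<kappa> i + 1) l > 0"
proof -
  have a: "jparam d \<kappa> \<mu> i > -1" "\<kappa> i > -1" "\<kappa> (Suc i) > -1"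
    using simplex_jacobi_param_gt [OF k] k i by auto
  then show "poch (jparam d \<kappa> \<mu> i + 1) m > 0"
    "poch (\<kappa> i + 1) m > 0" "poch (\<kappa> (Suc i) + 1) m > 0"
    by (auto intro!: pochhammer_pos)
  show "poch (real l + jparam d \<kappa> \<mu> i + \<kappa> i + 1) l > 0"
    using pochhammer_diagonal_pos [of "jparam d \<kappa> \<mu> i + \<kappa> i + 1" l] a by (simp only: add.assoc)
qed

text \<open>
The prefactors of the single exchanges mix \<open>\<nu>\<close> and \<open>\<mu>\<close> only through the quotients \<open>F i / F (i - 1)\<close>,
which telescope. What is left is a product of a function of \<open>\<nu>\<close> and a function of \<open>\<mu>\<close>.
\<close>

lemma swap_product_last_eq:
  assumes k: "integrable_exponents d \<kappa>" and n: "\<nu> \<in> multi_idx d n" and m: "\<mu> \<in> multi_idx d n" and d: "d \<ge> 1"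
    and ad: "admissible d \<nu> \<mu>"
  shows "swap_product swap_coeff_last d \<kappa> \<nu> \<mu> 1 = (-1) ^ (n + \<nu> d) *
     (racah_poly (d - 1) n (\<lambda>j. \<mu> (d + 1 - j)) (tail_point d \<nu>) (tail_params d \<kappa>) * (source_factor d \<kappa> \<nu>
         * target_factor d \<kappa> \<mu>))"
proof -
  let ?A = "jparam d \<kappa> \<mu>"
  define F where "F i = poch (?A i + 1) (excess d \<nu> \<mu> i) / fact (excess d \<nu> \<mu> i)" for i
  define G where "G j = poch (\<kappa> (Suc j) + 1) (\<nu> j) / fact (\<nu> j)" for j
  define h where "h i = 1 / (poch (\<kappa> i + 1) (\<mu> i) * poch (?A i + 1) (\<mu> i)
         * poch (real (\<mu> i) + ?A i + \<kappa> i + 1) (\<mu> i))" for i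
  define T where "T = tail_factor d \<kappa> \<nu> \<mu>"
  have F: "F j \<noteq> 0" if "1 \<le> j" "j \<le> d" for j
    using pochhammer_param_pos(1) [OF k, of j \<mu>] that by (simp add: F_def less_imp_neq [THEN not_sym])
  have "swap_product swap_coeff_last d \<kappa> \<nu> \<mu> 1 = (\<Prod>i=2..d. (-1) ^ \<nu> (i - 1) * G (i - 1) * h i * (F i
      / F (i - 1)) * T i)"
    unfolding swap_product_def Suc_1
  proof (intro prod.cong refl)
    fix i assume i: "i \<in> {2..d}"
    define N where "N = \<nu> (i - 1) + excess d \<nu> \<mu> i"
    note ef = excess_facts [OF ad i]
    have Nm: "N - \<mu> i = excess d \<nu> \<mu> (i - 1)" using ef(1) by (simp add: N_def)
    have T: "T i = terminating_4F3 (\<mu> i) (real (\<mu> i) + ?A i + \<kappa> i + 1) (- real (excess d \<nu> \<mu> i)) (real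
        (excess d \<nu> \<mu> i) + ?A i + \<kappa> 1 + 1)
               (?A i + 1) (real N + ?A i + \<kappa> 1 + \<kappa> i + 2) (- real N)"
      unfolding T_def tail_factor_def Let_def N_def ef(2,4) ..
    have "jparam d \<kappa> \<mu> (i - 1) = ?A i + \<kappa> i + 2 * real (\<mu> i) + 1"
      by (rule simplex_jacobi_param_pred) (use i in auto)
    then have A: "2 * real (\<mu> i) + ?A i + \<kappa> i + 2 = ?A (i - 1) + 1" by simp
    have si: "Suc (i - 1) = i" using i by simp
    show "swap_coeff_last (\<nu> (i - 1)) (excess d \<nu> \<mu> i) (\<mu> i) (?A i) (\<kappa> 1) (\<kappa> i)
       = (-1) ^ \<nu> (i - 1) * G (i - 1) * h i * (F i / F (i - 1)) * T i"
      unfolding swap_coeff_last_def Let_def N_def [symmetric] Nm T [symmetric] A G_def h_def F_def si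
      by (simp add: mult_ac)
  qed
  also have "\<dots> = (\<Prod>i=2..d. (-1) ^ \<nu> (i - 1)) * (\<Prod>i=2..d. G (i - 1)) * (\<Prod>i=2..d. h i) * (\<Prod>i=Suc 1..d. F i
      / F (i - 1)) * (\<Prod>i=2..d. T i)"
    unfolding Suc_1 by (simp only: prod.distrib)
  also have "(\<Prod>i=Suc 1..d. F i / F (i - 1)) = F d / F 1"
    by (rule prod_ratio_telescope_from) (use F d in auto)
  also have "F d = G d" using excess_ends [OF n m d] by (simp add: F_def G_def simplex_jacobi_param_last)
  also have "(\<Prod>i=2..d. T i) = racah_poly (d - 1) n (\<lambda>j. \<mu> (d + 1 - j)) (tail_point d \<nu>) (tail_params d \<kappa>)"
    unfolding racah_poly_tail_point [OF n d] T_def ..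
  also have "(\<Prod>i=2..d. (-1 :: real) ^ \<nu> (i - 1)) = (-1) ^ (n + \<nu> d)" by (rule prod_sign [OF n d])
  finally have e: "swap_product swap_coeff_last d \<kappa> \<nu> \<mu> 1 = (-1) ^ (n + \<nu> d) * (\<Prod>i=2..d. G (i - 1))
      * (\<Prod>i=2..d. h i) * (G d / F 1)
      * racah_poly (d - 1) n (\<lambda>j. \<mu> (d + 1 - j)) (tail_point d \<nu>) (tail_params d \<kappa>)" .
  have "source_factor d \<kappa> \<nu> = (\<Prod>i=2..d. G (i - 1)) * G d"
    unfolding prod_shift_pred [OF d] by (simp add: source_factor_def G_def)
  moreover have "target_factor d \<kappa> \<mu> = (\<Prod>i=2..d. h i) / F 1"
    using excess_ends [OF n m d] by (simp add: target_factor_def h_def F_def)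
  ultimately show ?thesis unfolding e by simp
qed

definition head_source_factor :: "nat \<Rightarrow> (nat \<Rightarrow> real) \<Rightarrow> (nat \<Rightarrow> nat) \<Rightarrow> real" where
  "head_source_factor d \<kappa> \<nu> = poch (\<kappa> 1 + 1) (\<nu> d) * poch (\<kappa> (d + 1) + 1) (\<nu> d) * (\<Prod>i=2..d. 1
      / fact (\<nu> (i - 1)))"

definition head_target_factor :: "nat \<Rightarrow> (nat \<Rightarrow> real) \<Rightarrow> (nat \<Rightarrow> nat) \<Rightarrow> nat \<Rightarrow> real" where
  "head_target_factor d \<kappa> \<mu> i = 1 / (poch (jparam d \<kappa> \<mu> i + 1) (\<mu> i)
     * (if i = 1 then poch (\<kappa> 1 + 1) (\<mu> 1) else poch (real (\<mu> i) + jparam d \<kappa> \<mu> i + \<kappa> i + 1) (\<mu> i)))"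

text \<open>
As in \<open>swap_product_last_eq\<close> the mixed prefactors telescope.
\<close>

lemma swap_product_first_eq:
  assumes k: "integrable_exponents d \<kappa>" and n: "\<nu> \<in> multi_idx d n" and m: "\<mu> \<in> multi_idx d n" and d: "d \<ge> 1"
    and ad: "admissible d \<nu> \<mu>"
  shows "swap_product swap_coeff_first d \<kappa> \<nu> \<mu> 1 = (-1) ^ (n + \<nu> d) *
     (racah_poly (d - 1) n \<nu> (head_point d \<mu>) (head_params d n \<kappa>) * (head_source_factor d \<kappa> \<nu>
         * (\<Prod>i=1..d. head_target_factor d \<kappa> \<mu> i)))"
proof -
  let ?A = "jparam d \<kappa> \<mu>"
  define F where "F i = poch (\<kappa> 1 + 1) (excess d \<nu> \<mu> i) * poch (?A i + 1) (excess d \<nu> \<mu> i)" for i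
  define h where "h = head_target_factor d \<kappa> \<mu>"
  define T where "T = head_factor d \<kappa> \<nu> \<mu>"
  have F: "F j \<noteq> 0" if "1 \<le> j" "j \<le> d" for j
    using pochhammer_param_pos(1) [OF k, of j \<mu>] pochhammer_param_pos(2) [OF k, of 1] that d
    by (simp add: F_def less_imp_neq [THEN not_sym])
  have "swap_product swap_coeff_first d \<kappa> \<nu> \<mu> 1 = (\<Prod>i=2..d. (-1) ^ \<nu> (i - 1) * (1 / fact (\<nu> (i - 1)))
      * h i * (F i / F (i - 1)) * T i)"
    unfolding swap_product_def Suc_1
  proof (intro prod.cong refl)
    fix i assume i: "i \<in> {2..d}"
    define N where "N = \<nu> (i - 1) + excess d \<nu> \<mu> i"
    note ef = excess_facts [OF ad i]
    have Nm: "N - \<mu> i = excess d \<nu> \<mu> (i - 1)" using ef(1) by (simp add: N_def)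
    have T: "T i = terminating_4F3 (\<nu> (i - 1)) (- (real N + real (excess d \<nu> \<mu> i) + ?A i + \<kappa> 1
        + 1)) (- real (excess d \<nu> \<mu> (i - 1)))
         (- (real (\<mu> i) + real N + ?A i + \<kappa> i + 1)) (- 2 * real N - ?A i - \<kappa> 1 - \<kappa> i - 1) (- ?A i - real
             N) (- real N)"
      unfolding T_def head_factor_def Let_def N_def ef(2,3,4) ..
    have "jparam d \<kappa> \<mu> (i - 1) = ?A i + \<kappa> i + 2 * real (\<mu> i) + 1"
      by (rule simplex_jacobi_param_pred) (use i in auto)
    then have A: "2 * real (\<mu> i) + ?A i + \<kappa> i + 2 = ?A (i - 1) + 1" by simp
    have i1: "i \<noteq> 1" using i by simp
    show "swap_coeff_first (\<nu> (i - 1)) (excess d \<nu> \<mu> i) (\<mu> i) (?A i) (\<kappa> 1) (\<kappa> i)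
       = (-1) ^ \<nu> (i - 1) * (1 / fact (\<nu> (i - 1))) * h i * (F i / F (i - 1)) * T i"
      unfolding swap_coeff_first_def Let_def N_def [symmetric] Nm T [symmetric] A h_def
          head_target_factor_def F_def if_not_P [OF i1]
      by (simp add: mult_ac)
  qed
  also have "\<dots> = (\<Prod>i=2..d. (-1) ^ \<nu> (i - 1)) * (\<Prod>i=2..d. 1 / fact (\<nu> (i - 1))) * (\<Prod>i=2..d. h i)
      * (\<Prod>i=Suc 1..d. F i / F (i - 1)) * (\<Prod>i=2..d. T i)"
    unfolding Suc_1 by (simp only: prod.distrib)
  also have "(\<Prod>i=Suc 1..d. F i / F (i - 1)) = F d / F 1"
    by (rule prod_ratio_telescope_from) (use F d in auto)
  also have "(\<Prod>i=2..d. T i) = racah_poly (d - 1) n \<nu> (head_point d \<mu>) (head_params d n \<kappa>)"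
    unfolding racah_poly_head_point [OF n m d] T_def ..
  also have "(\<Prod>i=2..d. (-1 :: real) ^ \<nu> (i - 1)) = (-1) ^ (n + \<nu> d)" by (rule prod_sign [OF n d])
  finally have e: "swap_product swap_coeff_first d \<kappa> \<nu> \<mu> 1
      = (-1) ^ (n + \<nu> d) * (\<Prod>i=2..d. 1 / fact (\<nu> (i - 1))) * (\<Prod>i=2..d. h i) * (F d / F 1)
      * racah_poly (d - 1) n \<nu> (head_point d \<mu>) (head_params d n \<kappa>)" .
  have Fd: "F d = poch (\<kappa> 1 + 1) (\<nu> d) * poch (\<kappa> (d + 1) + 1) (\<nu> d)"
    using excess_ends [OF n m d] by (simp add: F_def simplex_jacobi_param_last)
  have "h 1 = 1 / F 1" using excess_ends [OF n m d] by (simp add: h_def head_target_factor_def F_def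
      mult.commute)
  moreover have "(\<Prod>i=1..d. h i) = h 1 * (\<Prod>i=2..d. h i)"
    using d by (subst prod.atLeast_Suc_atMost) (auto simp: numeral_2_eq_2)
  ultimately show ?thesis unfolding e Fd head_source_factor_def h_def [symmetric] by simp
qed

section \<open>Racah weights in terms of Jacobi norms\<close>

lemma tail_params_gt:
  assumes k: "integrable_exponents d \<kappa>" and j: "j \<le> d"
  shows "tail_params d \<kappa> j > -1"
proof -
  have "\<kappa> 1 > -1" using k by auto
  moreover have "(\<Sum>i=d+2-j..d+1. \<kappa> i) + real (card {d+2-j..d+1}) \<ge> 0"
    by (rule sum_params_ge(1) [OF k]) (use j in auto)
  moreover have "card {d+2-j..d+1} = j" using j by simp
  ultimately show ?thesis by (simp add: tail_params_def)
qed

lemma racah_nonsingular_tail_params: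
  assumes k: "integrable_exponents d \<kappa>" and d: "d \<ge> 1"
  shows "racah_nonsingular (d - 1) n (tail_params d \<kappa>)"
  unfolding racah_nonsingular_def Let_def
proof (intro ballI conjI)
  fix x j assume x: "x \<in> racah_lattice (d - 1) n" and j: "j \<in> {0..d - 1}"
  define X where "X = racah_ext (d - 1) n x"
  have b: "tail_params d \<kappa> j > -1" "tail_params d \<kappa> (Suc j) > -1"
    using tail_params_gt [OF k] j d by auto
  show "poch (tail_params d \<kappa> (Suc j) + real (racah_ext (d - 1) n x (Suc j)) + real (racah_ext (d - 1) n x j))
        (racah_ext (d - 1) n x (Suc j) - racah_ext (d - 1) n x j) \<noteq> 0"
    unfolding X_def [symmetric]
  proof (cases "X (Suc j) - X j")
    case (Suc q)
    then have "real (X (Suc j)) \<ge> 1" by simp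
    then have "tail_params d \<kappa> (Suc j) + real (X (Suc j)) + real (X j) > 0" using b by linarith
    then show "poch (tail_params d \<kappa> (Suc j) + real (X (Suc j)) + real (X j)) (X (Suc j) - X j) \<noteq> 0"
      by (rule pochhammer_nonzero)
  qed simp
  show "poch (tail_params d \<kappa> j + 2 * real (racah_ext (d - 1) n x j) + 1)
        (racah_ext (d - 1) n x (Suc j) - racah_ext (d - 1) n x j) \<noteq> 0"
    by (rule pochhammer_nonzero) (use b in linarith)
qed

lemma pochhammer_nonzero_below: "z + real n < 1 \<Longrightarrow> poch z n \<noteq> 0" for z :: real
  by (auto simp: pochhammer_eq_0_iff)

lemma head_params_lt:
  assumes k: "integrable_exponents d \<kappa>" and j: "1 \<le> j" "j \<le> d"
  shows "head_params d n \<kappa> j + 2 * real n < 1"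
proof -
  have "(\<Sum>i=j+1..d+1. \<kappa> i) + real (card {j+1..d+1}) > 0"
    by (rule sum_params_ge(2) [OF k]) (use j in auto)
  moreover have "real (card {j+1..d+1}) = real d - real j + 1" using j by (simp add: of_nat_diff)
  ultimately show ?thesis using j by (simp add: head_params_pos_idx)
qed

text \<open>
All denominators are products of negative numbers, since \<open>\<beta>\<^sub>j + 2 n < 1\<close>; only the one with
\<open>j = 0\<close> is a product of positive numbers.
\<close>

lemma racah_nonsingular_head_params:
  assumes k: "integrable_exponents d \<kappa>" and d: "d \<ge> 1"
  shows "racah_nonsingular (d - 1) n (head_params d n \<kappa>)"
  unfolding racah_nonsingular_def Let_def
proof (intro ballI conjI)
  fix x j assume x: "x \<in> racah_lattice (d - 1) n" and j: "j \<in> {0..d - 1}"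
  define X where "X = racah_ext (d - 1) n x"
  have le: "X i \<le> n" for i
    using x unfolding X_def racah_ext_def racah_lattice_def by (cases "i \<in> {1..d - 1}") auto
  have mono: "X j \<le> X (Suc j)" unfolding X_def by (rule racah_ext_mono [OF x]) (use j in simp)
  have b: "head_params d n \<kappa> (Suc j) + 2 * real n < 1" by (rule head_params_lt [OF k]) (use j d in auto)
  show "poch (head_params d n \<kappa> (Suc j) + real (racah_ext (d - 1) n x (Suc j)) + real (racah_ext (d - 1) n x j))
        (racah_ext (d - 1) n x (Suc j) - racah_ext (d - 1) n x j) \<noteq> 0"
    unfolding X_def [symmetric]
    by (rule pochhammer_nonzero_below) (use b le [of "Suc j"] mono in \<open>simp add: of_nat_diff\<close>)
  show "poch (head_params d n \<kappa> j + 2 * real (racah_ext (d - 1) n x j) + 1)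
        (racah_ext (d - 1) n x (Suc j) - racah_ext (d - 1) n x j) \<noteq> 0"
    unfolding X_def [symmetric]
  proof (cases "j = 0")
    case True
    have "\<kappa> 1 > -1" using k by auto
    moreover have "X 0 = 0" by (simp add: X_def racah_ext_simps)
    ultimately show "poch (head_params d n \<kappa> j + 2 * real (X j) + 1) (X (Suc j) - X j) \<noteq> 0"
      using True by (intro pochhammer_nonzero) (simp add: head_params_def)
  next
    case False
    then have bj: "head_params d n \<kappa> j + 2 * real n < 1" by (intro head_params_lt [OF k]) (use j in auto)
    show "poch (head_params d n \<kappa> j + 2 * real (X j) + 1) (X (Suc j) - X j) \<noteq> 0"
    proof (cases "X j = X (Suc j)")
      case False
      then have "X j + X (Suc j) + 1 \<le> 2 * n" using mono le [of "Suc j"] by linarith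
      then have "real (X j) + real (X (Suc j)) + 1 \<le> 2 * real n" by linarith
      then show ?thesis using bj mono by (intro pochhammer_nonzero_below) (simp add: of_nat_diff)
    qed simp
  qed
qed

text \<open>
The two denominators of the reduced weight are two of the Pochhammer symbols in the norm of
\<open>P\<^sub>\<nu>\<^bsup>\<tau>\<kappa>\<^esup>\<close>, factor by factor.
\<close>

lemma reduced_weight_tail_point:
  assumes k: "integrable_exponents d \<kappa>" and n: "\<nu> \<in> multi_idx d n" and d: "d \<ge> 1"
  shows "racah_weight_reduced (d - 1) n (tail_point d \<nu>) (tail_params d \<kappa>)
       = (source_factor d \<kappa> \<nu>)\<^sup>2 / (\<Prod>j=1..d. hjac_norm_factor d (\<kappa> \<circ> cyc d) \<nu> j)"
proof -
  define X where "X = racah_ext (d - 1) n (tail_point d \<nu>)"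
  define \<beta> where "\<beta> = tail_params d \<kappa>"
  define G where "G j = poch (\<kappa> (Suc j) + 1) (\<nu> j) / fact (\<nu> j)" for j
  have "racah_weight_reduced (d - 1) n (tail_point d \<nu>) \<beta>
      = (\<Prod>q=0..d-1. (G (d - q))\<^sup>2 / hjac_norm_factor d (\<kappa> \<circ> cyc d) \<nu> (d - q))"
    unfolding racah_weight_reduced_def Let_def X_def [symmetric]
  proof (intro prod.cong refl)
    fix q assume q: "q \<in> {0..d - 1}"
    define j where "j = d - q"
    have j: "1 \<le> j" "j \<le> d" "d + 1 - q = Suc j" "d + 1 - Suc q = j" and qd: "q < d" "q \<le> d" "Suc q \<le> d"
      using q d by (auto simp: j_def)
    have X: "X q = tail_sum d \<nu> (Suc j)" "X (Suc q) = \<nu> j + tail_sum d \<nu> (Suc j)"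
      using racah_ext_tail_point [OF n qd(2) d] racah_ext_tail_point [OF n qd(3) d] j
      by (simp_all add: X_def tail_sum_rec)
    define s where "s = real (tail_sum d \<nu> (Suc j))"
    have bS: "\<beta> (Suc q) = \<beta> q + \<kappa> (Suc j) + 1"
      using tail_params_Suc [OF qd(1), of \<kappa>] j by (simp add: \<beta>_def)
    define D1 where "D1 = poch (\<beta> (Suc q) + real (X (Suc q)) + real (X q)) (\<nu> j)"
    define D2 where "D2 = poch (\<beta> q + 2 * real (X q) + 1) (\<nu> j)"
    define P where "P = poch (\<kappa> (Suc j) + 1) (\<nu> j)"
    have nf: "hjac_norm_factor d (\<kappa> \<circ> cyc d) \<nu> j = D2 * P * D1 / fact (\<nu> j)"
    proof (cases "j = d")
      case True
      then have q0: "q = 0" using qd by (simp add: j_def)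
      have "cyc d d = 1" using cyc_eq [of d d] d by simp
      moreover have "jparam d (\<kappa> \<circ> cyc d) \<nu> d = \<kappa> (Suc d)"
        using cyc_last [of d] by (simp add: simplex_jacobi_param_last)
      moreover have "\<beta> 0 = \<kappa> 1" by (simp add: \<beta>_def tail_params_def)
      ultimately show ?thesis
        using True bS unfolding q0 hjac_norm_factor_def Let_def D1_def D2_def P_def X
        by (simp add: X [unfolded q0] add_ac mult_ac)
    next
      case False
      then have jd: "j < d" using j by simp
      have "d + 2 - q = j + 2" "real (d - j) = real q" using qd by (auto simp: j_def)
      then have a: "jparam d (\<kappa> \<circ> cyc d) \<nu> j = \<beta> q + 2 * s"
        unfolding simplex_jacobi_param_cyc [OF j(1) jd] by (simp add: \<beta>_def tail_params_def s_def)
      have c: "(\<kappa> \<circ> cyc d) j = \<kappa> (Suc j)" using cyc_eq [of j d] j jd by simp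
      have e1: "real (\<nu> j) + (\<beta> q + 2 * s) + \<kappa> (Suc j) + 1 = \<beta> (Suc q) + real (X (Suc q)) + real (X q)"
        unfolding bS X by (simp add: s_def)
      have e2: "\<beta> q + 2 * s + 1 = \<beta> q + 2 * real (X q) + 1" by (simp add: X s_def)
      show ?thesis
        unfolding hjac_norm_factor_def Let_def a c e1 e2 D1_def D2_def P_def ..
    qed
    have P: "P > 0" unfolding P_def using pochhammer_param_pos(3) [OF k, of j] j by simp
    have Xd: "X (Suc q) - X q = \<nu> j" by (simp add: X)
    have bd: "\<beta> (Suc q) - \<beta> q = \<kappa> (Suc j) + 1" using bS by simp
    show "poch (\<beta> (Suc q) - \<beta> q) (X (Suc q) - X q) / (fact (X (Suc q) - X q)
           * poch (\<beta> (Suc q) + real (X (Suc q)) + real (X q)) (X (Suc q) - X q)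
           * poch (\<beta> q + 2 * real (X q) + 1) (X (Suc q) - X q))
        = (G (d - q))\<^sup>2 / hjac_norm_factor d (\<kappa> \<circ> cyc d) \<nu> (d - q)"
      unfolding j_def [symmetric] Xd bd nf G_def P_def [symmetric] D1_def [symmetric] D2_def [symmetric]
      using P by (simp add: power2_eq_square mult_ac)
  qed
  also have "\<dots> = (\<Prod>j=1..d. (G j)\<^sup>2 / hjac_norm_factor d (\<kappa> \<circ> cyc d) \<nu> j)"
    by (rule prod.reindex_bij_witness [where i = "\<lambda>j. d - j" and j = "\<lambda>q. d - q"]) (use d in auto)
  also have "\<dots> = (source_factor d \<kappa> \<nu>)\<^sup>2 / (\<Prod>j=1..d. hjac_norm_factor d (\<kappa> \<circ> cyc d) \<nu> j)"
  proof -
    have "(source_factor d \<kappa> \<nu>)\<^sup>2 = (\<Prod>j=1..d. (G j)\<^sup>2)"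
      unfolding source_factor_def G_def by (rule prod_power_distrib)
    then show ?thesis by (simp only: prod_dividef)
  qed
  finally show ?thesis by (simp add: \<beta>_def)
qed

text \<open>
The parameters are negative, so each Pochhammer symbol is reflected. The signs cancel within each
factor.
\<close>

lemma reduced_weight_head_point:
  assumes k: "integrable_exponents d \<kappa>" and m: "\<mu> \<in> multi_idx d n" and d: "d \<ge> 1"
  shows "racah_weight_reduced (d - 1) n (head_point d \<mu>) (head_params d n \<kappa>)
       = (\<Prod>j=1..d. hjac_norm_factor d \<kappa> \<mu> j) * (\<Prod>j=1..d. head_target_factor d \<kappa> \<mu> j)\<^sup>2"
proof -
  define X where "X = racah_ext (d - 1) n (head_point d \<mu>)"
  define \<beta> where "\<beta> = head_params d n \<kappa>"
  have "racah_weight_reduced (d - 1) n (head_point d \<mu>) \<beta>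
      = (\<Prod>q=0..d-1. hjac_norm_factor d \<kappa> \<mu> (Suc q) * (head_target_factor d \<kappa> \<mu> (Suc q))\<^sup>2)"
    unfolding racah_weight_reduced_def Let_def X_def [symmetric]
  proof (intro prod.cong refl)
    fix q assume q: "q \<in> {0..d - 1}"
    define j where "j = Suc q"
    have j: "j \<in> {1..d}" "1 \<le> j" "j \<le> d" and qd: "q \<le> d" "Suc q \<le> d" using q d by (auto simp: j_def)
    define a where "a = jparam d \<kappa> \<mu> j"
    define s where "s = real (tail_sum d \<mu> (Suc j))"
    have "tail_sum d \<mu> j = \<mu> j + tail_sum d \<mu> (Suc j)" using j by (simp add: tail_sum_rec)
    then have X: "real (X q) = real n - real (\<mu> j) - s" "real (X j) = real n - s"
      using real_diff_of_sum [OF racah_ext_head_point [OF m qd(1) d]] real_diff_of_sum [OF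
          racah_ext_head_point [OF m qd(2) d]]
      by (simp_all add: X_def j_def s_def)
    have Xd: "X j - X q = \<mu> j"
    proof -
      have "real (X j) = real (X q) + real (\<mu> j)" using X by simp
      then have "X j = X q + \<mu> j" by (simp only: of_nat_add [symmetric] of_nat_eq_iff)
      then show ?thesis by simp
    qed
    have bj: "\<beta> j = 2 * s - 2 * real n - a"
      unfolding \<beta>_def a_def s_def by (rule head_params_param) (use j in auto)
    define A1 where "A1 = poch (a + 1) (\<mu> j)"
    define A2 where "A2 = poch (real (\<mu> j) + a + \<kappa> j + 1) (\<mu> j)"
    define P where "P = poch (\<kappa> j + 1) (\<mu> j)"
    have pos: "A1 > 0" "A2 > 0" "P > 0"
      unfolding A1_def A2_def P_def a_def using pochhammer_param_pos [OF k j(1)] by auto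
    have D1: "poch (\<beta> j + real (X j) + real (X q)) (\<mu> j) = (-1) ^ \<mu> j * A1"
    proof -
      have e: "\<beta> j + real (X j) + real (X q) = - (a + real (\<mu> j))" unfolding bj X by simp
      show ?thesis unfolding e pochhammer_minus A1_def by simp
    qed
    have neg: "poch (- (a + \<kappa> j + 2 * real (\<mu> j))) (\<mu> j) = (-1) ^ \<mu> j * A2"
    proof -
      have e: "a + \<kappa> j + 2 * real (\<mu> j) - real (\<mu> j) + 1 = real (\<mu> j) + a + \<kappa> j + 1" by simp
      show ?thesis unfolding pochhammer_minus A2_def e ..
    qed
    have nf: "hjac_norm_factor d \<kappa> \<mu> j = A1 * P * A2 / fact (\<mu> j)"
      by (simp add: hjac_norm_factor_def Let_def A1_def A2_def P_def a_def)
    have "poch (\<beta> j - \<beta> q) (\<mu> j) / (fact (\<mu> j) * ((-1) ^ \<mu> j * A1) * poch (\<beta> q + 2 * real (X q) + 1) (\<mu> j))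
       = hjac_norm_factor d \<kappa> \<mu> j * (head_target_factor d \<kappa> \<mu> j)\<^sup>2"
    proof (cases "q = 0")
      case True
      then have j1: "j = 1" by (simp add: j_def)
      have b0: "\<beta> q = \<kappa> 1" "X q = 0" using True by (simp_all add: \<beta>_def head_params_def X_def racah_ext_simps)
      have "real n - real (\<mu> j) - s = 0" using X(1) b0 by simp
      moreover have kj: "\<kappa> 1 = \<kappa> j" by (simp add: j1)
      ultimately have e: "\<beta> j - \<beta> q = - (a + \<kappa> j + 2 * real (\<mu> j))" unfolding bj b0(1) by simp
      have e2: "\<beta> q + 2 * real (X q) + 1 = \<kappa> j + 1" unfolding b0 kj by simp
      have t: "head_target_factor d \<kappa> \<mu> j = 1 / (A1 * P)" by (simp add: head_target_factor_def j1 A1_def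
          P_def a_def)
      show ?thesis unfolding e neg e2 P_def [symmetric] nf t using pos
        by (simp add: power2_eq_square)
    next
      case False
      then have q1: "1 \<le> q" "q < d" using j by (auto simp: j_def)
      have bS: "\<beta> j = \<beta> q + \<kappa> j + 1" using head_params_Suc [OF q1, of n \<kappa>] by (simp add: \<beta>_def j_def)
      have e: "\<beta> j - \<beta> q = \<kappa> j + 1" using bS by simp
      have e2: "\<beta> q + 2 * real (X q) + 1 = - (a + \<kappa> j + 2 * real (\<mu> j))" using bS unfolding bj X by simp
      have j1: "j \<noteq> 1" using False by (simp add: j_def)
      have t: "head_target_factor d \<kappa> \<mu> j = 1 / (A1 * A2)"
        unfolding head_target_factor_def if_not_P [OF j1] A1_def A2_def a_def ..
      have "(-1 :: real) ^ \<mu> j * (-1) ^ \<mu> j = 1" by (simp flip: power_mult_distrib)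
      then have sg: "fact (\<mu> j) * ((-1) ^ \<mu> j * A1) * ((-1) ^ \<mu> j * A2) = fact (\<mu> j) * A1 * A2"
        by (metis (no_types, opaque_lifting) mult.assoc mult.left_commute mult_1)
      show ?thesis unfolding e e2 neg P_def [symmetric] nf t sg using pos
        by (simp add: power2_eq_square)
    qed
    then show "poch (\<beta> (Suc q) - \<beta> q) (X (Suc q) - X q) / (fact (X (Suc q) - X q)
           * poch (\<beta> (Suc q) + real (X (Suc q)) + real (X q)) (X (Suc q) - X q)
           * poch (\<beta> q + 2 * real (X q) + 1) (X (Suc q) - X q))
        = hjac_norm_factor d \<kappa> \<mu> (Suc q) * (head_target_factor d \<kappa> \<mu> (Suc q))\<^sup>2"
      unfolding j_def [symmetric] Xd D1 .
  qed
  also have "\<dots> = (\<Prod>j=1..d. hjac_norm_factor d \<kappa> \<mu> j * (head_target_factor d \<kappa> \<mu> j)\<^sup>2)"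
    by (rule prod.reindex_bij_witness [where i = "\<lambda>j. j - 1" and j = Suc]) (use d in auto)
  also have "\<dots> = (\<Prod>j=1..d. hjac_norm_factor d \<kappa> \<mu> j) * (\<Prod>j=1..d. head_target_factor d \<kappa> \<mu> j)\<^sup>2"
    by (simp add: prod.distrib prod_power_distrib)
  finally show ?thesis by (simp add: \<beta>_def)
qed

section \<open>The Racah representations\<close>

lemma conn_coeff_cyc_tail:
  assumes k: "integrable_exponents d \<kappa>" and n: "\<nu> \<in> multi_idx d n" and m: "\<mu> \<in> multi_idx d n" and d: "d \<ge> 1"
  shows "conn_coeff d (cyc d) \<kappa> \<nu> \<mu> = (-1) ^ (n + \<nu> d) *
     (racah_poly (d - 1) n (\<lambda>j. \<mu> (d + 1 - j)) (tail_point d \<nu>) (tail_params d \<kappa>) * (source_factor d \<kappa> \<nu>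
         * target_factor d \<kappa> \<mu>))"
  unfolding conn_coeff_cyc [OF swap_identity_last k d n m]
  using swap_product_last_eq [OF k n m d] racah_poly_tail_point_zero [OF n d, of \<mu> \<kappa>] by simp

lemma conn_coeff_cyc_head:
  assumes k: "integrable_exponents d \<kappa>" and n: "\<nu> \<in> multi_idx d n" and m: "\<mu> \<in> multi_idx d n" and d: "d \<ge> 1"
  shows "conn_coeff d (cyc d) \<kappa> \<nu> \<mu> = (-1) ^ (n + \<nu> d) *
     (racah_poly (d - 1) n \<nu> (head_point d \<mu>) (head_params d n \<kappa>) * (head_source_factor d \<kappa> \<nu>
         * (\<Prod>i=1..d. head_target_factor d \<kappa> \<mu> i)))"
  unfolding conn_coeff_cyc [OF swap_identity_first k d n m]
  using swap_product_first_eq [OF k n m d] racah_poly_head_point_zero [OF n m d, of \<kappa>] by simp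

lemma factors_nonneg:
  assumes k: "integrable_exponents d \<kappa>" and d: "d \<ge> 1"
  shows "source_factor d \<kappa> \<nu> \<ge> 0" "target_factor d \<kappa> \<mu> \<ge> 0" "head_source_factor d \<kappa> \<nu> \<ge> 0"
    "(\<Prod>i=1..d. head_target_factor d \<kappa> \<mu> i) \<ge> 0"
proof -
  note pos = pochhammer_param_pos [OF k, THEN less_imp_le]
  have one: "1 \<in> {1..d}" "d \<in> {1..d}" using d by auto
  show "source_factor d \<kappa> \<nu> \<ge> 0" unfolding source_factor_def
      by (intro prod_nonneg ballI divide_nonneg_nonneg pos) auto
  show "target_factor d \<kappa> \<mu> \<ge> 0" unfolding target_factor_def
    by (intro mult_nonneg_nonneg prod_nonneg ballI divide_nonneg_nonneg pos) (use one in auto)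
  show "head_source_factor d \<kappa> \<nu> \<ge> 0" unfolding head_source_factor_def
    using pos(2) [OF one(1)] pos(3) [OF one(2)] by (intro mult_nonneg_nonneg prod_nonneg ballI) auto
  show "(\<Prod>i=1..d. head_target_factor d \<kappa> \<mu> i) \<ge> 0"
    unfolding head_target_factor_def
  proof (intro prod_nonneg ballI)
    fix i assume i: "i \<in> {1..d}"
    show "0 \<le> 1 / (poch (jparam d \<kappa> \<mu> i + 1) (\<mu> i)
     * (if i = 1 then poch (\<kappa> 1 + 1) (\<mu> 1) else poch (real (\<mu> i) + jparam d \<kappa> \<mu> i + \<kappa> i + 1) (\<mu> i)))"
      using pos(1,4) [OF i] pos(2) [OF one(1)] by auto
  qed
qed

text \<open>
\<open>\<mu>\<close> is fixed and the column of the orthogonal matrix is normalized.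
\<close>

theorem conn_coeff_normalized_cyc_tail:
  assumes d: "d \<ge> 1" and k: "integrable_exponents d \<kappa>"
    and n: "\<nu> \<in> multi_idx d n" and m: "\<mu> \<in> multi_idx d n"
  shows "conn_coeff_normalized d (cyc d) \<kappa> \<nu> \<mu> = (-1) ^ (n + \<nu> d) *
      racah_weighted_orthonormal (d - 1) n (\<lambda>j. \<mu> (d + 1 - j)) (tail_point d \<nu>) (tail_params d \<kappa>)"
proof -
  let ?\<kappa> = "\<kappa> \<circ> cyc d"
  have kt: "integrable_exponents d ?\<kappa>" by (rule permuted_params_gt [OF k cyc_permutes])
  define t where "t \<nu> = sqrt (jacobi_norm_sq d \<kappa> \<mu> / jacobi_norm_sq d ?\<kappa> \<nu>) * (source_factor d \<kappa> \<nu>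
      * target_factor d \<kappa> \<mu>)" for \<nu>
  define K where "K = jacobi_norm_sq d \<kappa> \<mu> * (target_factor d \<kappa> \<mu>)\<^sup>2 / simplex_norm_const d ?\<kappa> n"
  have A: "jacobi_norm_sq d \<kappa> \<mu> > 0" by (rule jacobi_norm_sq_pos [OF d k m])
  show ?thesis
  proof (rule unit_vector_racah [OF bij_betw_tail_point [OF d] racah_nonsingular_tail_params [OF k d],
        where U = "\<lambda>\<nu>. conn_coeff_normalized d (cyc d) \<kappa> \<nu> \<mu>" and sg = "\<lambda>\<nu>. (-1) ^ (n + \<nu> d)" and t
            = t and k = K])
    fix \<nu> assume n: "\<nu> \<in> multi_idx d n"
    have B: "jacobi_norm_sq d ?\<kappa> \<nu> > 0" by (rule jacobi_norm_sq_pos [OF d kt n])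
    show "conn_coeff_normalized d (cyc d) \<kappa> \<nu> \<mu> = (-1) ^ (n + \<nu> d) *
        (racah_poly (d - 1) n (\<lambda>j. \<mu> (d + 1 - j)) (tail_point d \<nu>) (tail_params d \<kappa>) * t \<nu>)"
      unfolding conn_coeff_normalized_def conn_coeff_cyc_tail [OF k n m d] t_def by (simp only: mult_ac)
    show "((-1 :: real) ^ (n + \<nu> d))\<^sup>2 = 1" by (simp flip: power_mult)
    show "0 \<le> t \<nu>"
      unfolding t_def using A B by (intro mult_nonneg_nonneg factors_nonneg [OF k d]) auto
    have "(t \<nu>)\<^sup>2 = jacobi_norm_sq d \<kappa> \<mu> / jacobi_norm_sq d ?\<kappa> \<nu> * ((source_factor d \<kappa> \<nu>)\<^sup>2
        * (target_factor d \<kappa> \<mu>)\<^sup>2)"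
      unfolding t_def power_mult_distrib using A B by simp
    then show "(t \<nu>)\<^sup>2 = K * racah_weight_reduced (d - 1) n (tail_point d \<nu>) (tail_params d \<kappa>)"
      unfolding reduced_weight_tail_point [OF k n d] jacobi_norm_sq_eq [OF d kt n] K_def by simp
  qed (use conn_coeff_normalized_columns [OF d k m] n in auto)
qed

text \<open>
\<open>\<nu>\<close> is fixed and the row of the orthogonal matrix is normalized.
\<close>

theorem conn_coeff_normalized_cyc_head:
  assumes d: "d \<ge> 1" and k: "integrable_exponents d \<kappa>"
    and n: "\<nu> \<in> multi_idx d n" and m: "\<mu> \<in> multi_idx d n"
  shows "conn_coeff_normalized d (cyc d) \<kappa> \<nu> \<mu> = (-1) ^ (n + \<nu> d) *
      racah_weighted_orthonormal (d - 1) n \<nu> (head_point d \<mu>) (head_params d n \<kappa>)"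
proof -
  let ?\<kappa> = "\<kappa> \<circ> cyc d"
  have kt: "integrable_exponents d ?\<kappa>" by (rule permuted_params_gt [OF k cyc_permutes])
  define t where "t \<mu> = sqrt (jacobi_norm_sq d \<kappa> \<mu> / jacobi_norm_sq d ?\<kappa> \<nu>) *
     (head_source_factor d \<kappa> \<nu> * (\<Prod>i=1..d. head_target_factor d \<kappa> \<mu> i))" for \<mu>
  define K where "K = simplex_norm_const d \<kappa> n * (head_source_factor d \<kappa> \<nu>)\<^sup>2 / jacobi_norm_sq d ?\<kappa> \<nu>"
  have B: "jacobi_norm_sq d ?\<kappa> \<nu> > 0" by (rule jacobi_norm_sq_pos [OF d kt n])
  have rows: "(\<Sum>\<mu>\<in>multi_idx d n. (conn_coeff_normalized d (cyc d) \<kappa> \<nu> \<mu>)\<^sup>2) = 1"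
    using conn_coeff_normalized_rows [OF d k n n] by (simp add: power2_eq_square)
  show ?thesis
  proof (rule unit_vector_racah [OF bij_betw_head_point [OF d] racah_nonsingular_head_params [OF k d],
        where U = "\<lambda>\<mu>. conn_coeff_normalized d (cyc d) \<kappa> \<nu> \<mu>" and sg = "\<lambda>\<mu>. (-1) ^ (n + \<nu> d)" and t
            = t and k = K])
    fix \<mu> assume m: "\<mu> \<in> multi_idx d n"
    have A: "jacobi_norm_sq d \<kappa> \<mu> > 0" by (rule jacobi_norm_sq_pos [OF d k m])
    show "conn_coeff_normalized d (cyc d) \<kappa> \<nu> \<mu> = (-1) ^ (n + \<nu> d) *
        (racah_poly (d - 1) n \<nu> (head_point d \<mu>) (head_params d n \<kappa>) * t \<mu>)"
      unfolding conn_coeff_normalized_def conn_coeff_cyc_head [OF k n m d] t_def by (simp only: mult_ac)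
    show "((-1 :: real) ^ (n + \<nu> d))\<^sup>2 = 1" by (simp flip: power_mult)
    show "0 \<le> t \<mu>"
      unfolding t_def using A B by (intro mult_nonneg_nonneg factors_nonneg [OF k d]) auto
    have "(t \<mu>)\<^sup>2 = jacobi_norm_sq d \<kappa> \<mu> / jacobi_norm_sq d ?\<kappa> \<nu> *
        ((head_source_factor d \<kappa> \<nu>)\<^sup>2 * (\<Prod>i=1..d. head_target_factor d \<kappa> \<mu> i)\<^sup>2)"
      unfolding t_def power_mult_distrib using A B by simp
    then show "(t \<mu>)\<^sup>2 = K * racah_weight_reduced (d - 1) n (head_point d \<mu>) (head_params d n \<kappa>)"
      unfolding reduced_weight_head_point [OF k m d] jacobi_norm_sq_eq [OF d k m] K_def by simp
  qed (use rows m in auto)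
qed

theorem theorem6p3:
  fixes d n :: nat and \<kappa> :: "nat \<Rightarrow> real" and \<nu> \<mu> :: "nat \<Rightarrow> nat"
  assumes "d \<ge> 2"
    and "\<forall>i\<in>{1..d+1}. \<kappa> i > -1"
    and "\<nu> \<in> multi_idx d n" and "\<mu> \<in> multi_idx d n"
  shows "conn_coeff_normalized d (cycle_of_list [1..<d+1]) \<kappa> \<nu> \<mu> =
      (-1) ^ (n + \<nu> d) *
      racah_weighted_orthonormal (d - 1) n
        (\<lambda>j. \<mu> (d + 1 - j))
        (\<lambda>j. \<Sum>i=d+1-j..d. \<nu> i)
        (\<lambda>j. \<kappa> 1 + (\<Sum>i=d+2-j..d+1. \<kappa> i) + real j)
    \<and> conn_coeff_normalized d (cycle_of_list [1..<d+1]) \<kappa> \<nu> \<mu> =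
      (-1) ^ (n + \<nu> d) *
      racah_weighted_orthonormal (d - 1) n
        (\<lambda>j. \<nu> j)
        (\<lambda>j. \<Sum>i=1..j. \<mu> i)
        (\<lambda>j. if j = 0 then \<kappa> 1
              else - (\<Sum>i=j+1..d+1. \<kappa> i) - 2 * real n - real d + real j)"
proof -
  have d: "d \<ge> 1" using assms(1) by simp
  have 1: "racah_weighted_orthonormal (d - 1) n idx (tail_point d \<nu>) \<beta>
      = racah_weighted_orthonormal (d - 1) n idx (\<lambda>j. \<Sum>i=d+1-j..d. \<nu> i) \<beta>" for idx \<beta>
    by (rule racah_weighted_orthonormal_cong) (simp add: tail_point_def tail_sum_def)
  have 2: "racah_weighted_orthonormal (d - 1) n idx (head_point d \<mu>) \<beta>
      = racah_weighted_orthonormal (d - 1) n idx (\<lambda>j. \<Sum>i=1..j. \<mu> i) \<beta>" for idx \<beta>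
    by (rule racah_weighted_orthonormal_cong) (simp add: head_point_def)
  have h: "tail_params d \<kappa> = (\<lambda>j. \<kappa> 1 + (\<Sum>i=d+2-j..d+1. \<kappa> i) + real j)"
    by (rule ext) (simp only: tail_params_def)
  have h': "head_params d n \<kappa> = (\<lambda>j. if j = 0 then \<kappa> 1
              else - (\<Sum>i=j+1..d+1. \<kappa> i) - 2 * real n - real d + real j)"
    by (rule ext) (simp only: head_params_def)
  show ?thesis
    using conn_coeff_normalized_cyc_tail [OF d assms(2-4)] conn_coeff_normalized_cyc_head [OF d assms(2-4)]
    unfolding 1 2 h h' cyc_def by blast
qed

end
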